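(* Let $t_1,t_2>0$ be real, let $$\Psi_1(x,z)=\mathrm{Ai}(x+z)-\frac{1}{xz}\mathrm{Ai}'(x+z),$$ and let $T_1$ be the integral operator $$T_1:f(z)\mapsto\int_{t_1}^\infty K_1(z,w)f(w)\,dw,\qquad K_1(z,w)=\int_{t_2}^\infty\Psi_1(x,z)\Psi_1(x,w)\,dx .$$ Define the differential operators of orders $4$ and $6$ $$S_1(z,\partial_z)=\frac1z\left(\sum_{k=0}^2\partial_z^k\,a_k(z)(z-t_1)^k\,\partial_z^k\right)\frac1z,\qquad \widetilde S_1(z,\partial_z)=\frac1z\left(\sum_{k=0}^3\partial_z^k\,\widetilde a_k(z)(z-t_1)^k\,\partial_z^k\right)\frac1z,$$ where \begin{align*} a_2(z)&=z^2,\\ a_1(z)&=-2\left(z^4+(t_2-t_1)z^3-3t_1\right),\\ a_0(z)&=z^3\left(z^3+2(t_2-t_1)z^2+(t_2-t_1)^2z-8\right)+(t_1+t_2)z^2/3,\\ \widetilde a_3(z)&=z^2,\\ \widetilde a_2(z)&=-3\left(z^4+(t_2-t_1)z^3-4t_1\right),\\ \widetilde a_1(z)&=3\left(z^6+2(t_2-t_1)z^5+(t_2-t_1)^2z^4-10z^3+(5t_1-4t_2)z^2-3t_1(t_2-t_1)z\right),\\ \widetilde a_0(z)&=-z^8-3(t_2-t_1)z^7-3(t_2-t_1)^2z^6-\left((t_2-t_1)^3-32\right)z^5+(42t_2-63t_1)z^4\\ &\quad+(36t_1^2-48t_1t_2+12t_2^2)z^3+t_1t_2(t_1+t_2)z^2+12t_1^2-6t_1t_2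 . \end{align*} Then $S_1$ and $\widetilde S_1$ both commute with $T_1$, they commute with each other, and they satisfy the algebraic relation $$\widetilde S_1^2=S_1^3-\frac{t_1^2-t_1t_2+t_2^2}{3}\,S_1+\frac{(t_1-2t_2)(2t_1-t_2)(t_1+t_2)}{27},$$ which for generic values of $t_1,t_2$ defines an elliptic curve.
   Context: $\mathrm{Ai}$ is the Airy function of the first kind. In the formulas for differential operators, functions of $z$ act as multiplication operators and products are compositions. A differential operator $S$ commutes with $T_1$ if $S(T_1f)=T_1(Sf)$ for every test function $f$, i.e. every $f\in C^\infty([t_1,\infty))$ all of whose derivatives decay faster than any power of $z$ as $z\to\infty$. The final clause means that for generic $(t_1,t_2)$ the plane curve $Y^2=X^3-\frac{t_1^2-t_1t_2+t_2^2}{3}X+\frac{(t_1-2t_2)(2t_1-t_2)(t_1+t_2)}{27}$ is nonsingular.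
   Formalization: The printed algebraic relation fails for all t_1,t_2>0; it is proved instead with S_1 replaced by S_1+6t_1-4t_2 and \widetilde S_1 replaced by \widetilde S_1-(24+5t_1^3-9t_1^2t_2+6t_1t_2^2), with the same curve; all other claims are for the printed operators. *)

theory Defs
  imports "HOL-Analysis.Analysis" "HOL-Computational_Algebra.Polynomial"
begin

section \<open>Airy function and the integral operator\<close>

text \<open>The integral is only conditionally convergent; the Henstock--Kurzweil integral over
  the half-line is the improper integral, whereas the Lebesgue integral would be the
  default value 0.\<close>

definition Airy_Ai :: "real \<Rightarrow> real" where
  "Airy_Ai x = integral {0..} (\<lambda>t. cos (t ^ 3 / 3 + x * t)) / pi"

definition Psi1 :: "real \<Rightarrow> real \<Rightarrow> real" where
  "Psi1 x z = Airy_Ai (x + z) - 1 / (x * z) * deriv Airy_Ai (x + z)"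

definition K1 :: "real \<Rightarrow> real \<Rightarrow> real \<Rightarrow> real" where
  "K1 t2 z w = (LBINT x:{t2..}. Psi1 x z * Psi1 x w)"

definition T1 :: "real \<Rightarrow> real \<Rightarrow> (real \<Rightarrow> real) \<Rightarrow> real \<Rightarrow> real" where
  "T1 t1 t2 f z = (LBINT w:{t1..}. K1 t2 z w * f w)"


section \<open>Smooth functions and test functions on a closed half-line\<close>

text \<open>Functions on \<open>[a,\<infinity>)\<close> are total functions whose values below \<open>a\<close> are irrelevant; the
  derivative at \<open>a\<close> is one-sided.\<close>

definition Dz :: "real \<Rightarrow> (real \<Rightarrow> real) \<Rightarrow> real \<Rightarrow> real" where
  "Dz a f z = vector_derivative f (at z within {a..})"

definition smooth_from :: "real \<Rightarrow> (real \<Rightarrow> real) \<Rightarrow> bool" where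
  "smooth_from a f \<longleftrightarrow> (\<forall>n. \<forall>z\<ge>a. (Dz a ^^ n) f differentiable (at z within {a..}))"

definition test_function :: "real \<Rightarrow> (real \<Rightarrow> real) \<Rightarrow> bool" where
  "test_function a f \<longleftrightarrow>
     smooth_from a f \<and> (\<forall>n m. ((\<lambda>z. z ^ m * (Dz a ^^ n) f z) \<longlongrightarrow> 0) at_top)"

definition commutes_with ::
  "real \<Rightarrow> ((real \<Rightarrow> real) \<Rightarrow> real \<Rightarrow> real) \<Rightarrow> ((real \<Rightarrow> real) \<Rightarrow> real \<Rightarrow> real) \<Rightarrow> bool" where
  "commutes_with a S T \<longleftrightarrow> (\<forall>f. test_function a f \<longrightarrow> (\<forall>z\<ge>a. S (T f) z = T (S f) z))"

text \<open>Equality of differential operators, as equality of their actions on smooth functions.\<close>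

definition diffop_eq ::
  "real \<Rightarrow> ((real \<Rightarrow> real) \<Rightarrow> real \<Rightarrow> real) \<Rightarrow> ((real \<Rightarrow> real) \<Rightarrow> real \<Rightarrow> real) \<Rightarrow> bool" where
  "diffop_eq a P Q \<longleftrightarrow> (\<forall>f. smooth_from a f \<longrightarrow> (\<forall>z\<ge>a. P f z = Q f z))"


section \<open>The differential operators\<close>

text \<open>For \<open>cs = [c\<^sub>0, \<dots>, c\<^sub>m]\<close> this is the composition
  \<open>(1/z) (\<Sum>k\<le>m. \<partial>\<^sup>k c\<^sub>k(z) (z - t)\<^sup>k \<partial>\<^sup>k) (1/z)\<close>.\<close>

definition sandwich_op ::
  "real \<Rightarrow> (real \<Rightarrow> real) list \<Rightarrow> (real \<Rightarrow> real) \<Rightarrow> real \<Rightarrow> real" where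
  "sandwich_op t cs f z =
     1 / z * (\<Sum>k<length cs.
       (Dz t ^^ k) (\<lambda>y. (cs ! k) y * (y - t) ^ k * (Dz t ^^ k) (\<lambda>u. 1 / u * f u) y) z)"

definition S1 :: "real \<Rightarrow> real \<Rightarrow> (real \<Rightarrow> real) \<Rightarrow> real \<Rightarrow> real" where
  "S1 t1 t2 = sandwich_op t1
     [\<lambda>z. z^3 * (z^3 + 2 * (t2 - t1) * z^2 + (t2 - t1)^2 * z - 8) + (t1 + t2) * z^2 / 3,
      \<lambda>z. - 2 * (z^4 + (t2 - t1) * z^3 - 3 * t1),
      \<lambda>z. z^2]"

definition S1_tilde :: "real \<Rightarrow> real \<Rightarrow> (real \<Rightarrow> real) \<Rightarrow> real \<Rightarrow> real" where
  "S1_tilde t1 t2 = sandwich_op t1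
     [\<lambda>z. - (z^8) - 3 * (t2 - t1) * z^7 - 3 * (t2 - t1)^2 * z^6
          - ((t2 - t1)^3 - 32) * z^5 + (42 * t2 - 63 * t1) * z^4
          + (36 * t1^2 - 48 * t1 * t2 + 12 * t2^2) * z^3
          + t1 * t2 * (t1 + t2) * z^2 + 12 * t1^2 - 6 * t1 * t2,
      \<lambda>z. 3 * (z^6 + 2 * (t2 - t1) * z^5 + (t2 - t1)^2 * z^4 - 10 * z^3
          + (5 * t1 - 4 * t2) * z^2 - 3 * t1 * (t2 - t1) * z),
      \<lambda>z. - 3 * (z^4 + (t2 - t1) * z^3 - 4 * t1),
      \<lambda>z. z^2]"

text \<open>With the formulas printed in the source, which are those of \<open>S1\<close> and \<open>S1_tilde\<close>, the
  relation \<open>S1_tilde\<^sup>2 = S1\<^sup>3 - g S1 + h\<close> is false for all \<open>t1, t2 > 0\<close>: the constant terms of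
  both operators are off. It becomes true, with the same curve, once the scalars
  \<open>6 t1 - 4 t2\<close> and \<open>-(24 + 5 t1\<^sup>3 - 9 t1\<^sup>2 t2 + 6 t1 t2\<^sup>2)\<close> are added to \<open>S1\<close> and \<open>S1_tilde\<close>;
  commutators are unaffected. Hence \<open>shift_op\<close>, which adds a scalar operator.\<close>

definition shift_op ::
  "((real \<Rightarrow> real) \<Rightarrow> real \<Rightarrow> real) \<Rightarrow> real \<Rightarrow> (real \<Rightarrow> real) \<Rightarrow> real \<Rightarrow> real" where
  "shift_op S c f z = S f z + c * f z"


section \<open>The curve\<close>

definition curve_g :: "real \<Rightarrow> real \<Rightarrow> real" where
  "curve_g t1 t2 = (t1^2 - t1 * t2 + t2^2) / 3"

definition curve_h :: "real \<Rightarrow> real \<Rightarrow> real" where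
  "curve_h t1 t2 = (t1 - 2 * t2) * (2 * t1 - t2) * (t1 + t2) / 27"

text \<open>Nonsingularity of the complex plane curve \<open>F X Y = 0\<close>, by the Jacobian criterion.\<close>

definition nonsingular_curve :: "(complex \<Rightarrow> complex \<Rightarrow> complex) \<Rightarrow> bool" where
  "nonsingular_curve F \<longleftrightarrow>
     (\<forall>X Y. F X Y = 0 \<longrightarrow> deriv (\<lambda>x. F x Y) X \<noteq> 0 \<or> deriv (\<lambda>y. F X y) Y \<noteq> 0)"

text \<open>Generic parameters are those off the zero set of some nonzero polynomial in \<open>(t1, t2)\<close>.\<close>

definition for_generic_positive :: "(real \<Rightarrow> real \<Rightarrow> bool) \<Rightarrow> bool" where
  "for_generic_positive P \<longleftrightarrow>
     (\<exists>p :: real poly poly. p \<noteq> 0 \<and>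
       (\<forall>t1>0. \<forall>t2>0. poly (poly p [:t2:]) t1 \<noteq> 0 \<longrightarrow> P t1 t2))"

end

theory Submission
  imports Defs "HOL-Complex_Analysis.Cauchy_Integral_Theorem" "HOL-Real_Asymp.Real_Asymp"
begin

text \<open>
  The kernel \<open>\<Psi>\<^sub>1\<close> is symmetric, so by Fubini \<open>T\<^sub>1\<close> is the composition of the transform
  \<open>f \<mapsto> \<integral> \<Psi>\<^sub>1(x,w) f(w) dw\<close> over \<open>[t\<^sub>1,\<infinity>)\<close> with the same transform
      over \<open>[t\<^sub>2,\<infinity>)\<close>. The operators
  are bispectral: \<open>S\<^sub>1\<close> acting on \<open>\<Psi>\<^sub>1(x,z)\<close> in \<open>z\<close> agrees,
      up to a scalar that is antisymmetric in
  \<open>(t\<^sub>1,t\<^sub>2)\<close>, with the operator obtained by exchanging \<open>t\<^sub>1\<close> and \<open>t\<^sub>2\<close>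
      acting in \<open>x\<close>. Each
  \<open>\<partial>\<^sup>k c(z) (z - t)\<^sup>k \<partial>\<^sup>k\<close> is symmetric for the integral over
      \<open>[t,\<infinity>)\<close>, because the factor
  \<open>(z - t)\<^sup>k\<close> kills all boundary terms. Hence the first transform intertwines \<open>S\<^sub>1\<close> with its
  exchanged form, the second one intertwines back, and the two scalars cancel.

  The identities between differential operators are checked on powers of \<open>z\<close>, where they
  become polynomial identities.
\<close>


section \<open>Smooth functions on a half-line\<close>

text \<open>The scalars in the bispectral identities are an artefact of normalization: adding to
  each operator and to its exchanged form the scalar from the curve relation
  (\<open>6 * t1 - 4 * t2\<close> for \<open>S1 t1 t2\<close>, \<open>6 * t2 - 4 * t1\<close> for
  \<open>S1 t2 t1\<close>) makes them vanish. One shift repairs both statements, and commutators do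
  not see it.

  In the algebra the exponent \<open>s\<close> of the test power stays a free real variable. An
  operator sends \<open>z powr s\<close> to \<open>z powr (s - N)\<close> times a polynomial in
  \<open>z\<close> with coefficients polynomial in \<open>s\<close>, \<open>t1\<close>,
  \<open>t2\<close>. Composition is then arithmetic on finite lists, and an operator identity is one
  polynomial identity per entry. The action on \<open>Psi1\<close> is computed in the same way with
  two lists, the coefficients of \<open>Ai\<close> and \<open>Ai'\<close>.

  The analytic obstacle is that the integral defining \<open>Airy_Ai\<close> converges only
  conditionally, so it cannot be differentiated under the integral sign by domination. Moving the
  contour once gives absolutely convergent integrals and a crude bound \<open>C * exp (- y)\<close>
  for every derivative. This bound drives the interchange of operators and integrals, the use of
  Fubini and the decay of the transforms.\<close>

lemma Dz_eqI:
  assumes "(f has_real_derivative d) (at z within {a..})" "z \<ge> a"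
  shows "Dz a f z = d"
proof -
  \<comment> \<open>The derivative selected in \<open>Dz_def\<close> is unique only at a limit
    point; a connected set with more than one point has no isolated points.\<close>
  have "at z within {a..} \<noteq> bot"
  proof -
    have "{a..} \<noteq> {x}" for x using infinite_Ici[of a] by (metis finite.emptyI finite.insertI)
    then have "z islimpt {a..}"
      using assms(2) by (intro connected_imp_perfect) auto
    then show ?thesis by (simp add: trivial_limit_within)
  qed
  then show ?thesis
    unfolding Dz_def using assms(1)
    by (simp add: has_real_derivative_iff_has_vector_derivative vector_derivative_within)
qed

lemma Dz_cong:
  assumes "\<And>y. y \<ge> a \<Longrightarrow> f y = g y" "z \<ge> a"
  shows "Dz a f z = Dz a g z"
proof -
  have "(f has_vector_derivative d) (at z within {a..}) \<longleftrightarrow> (g has_vector_derivative d) (at z within {a..})" for d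
    using assms by (intro has_vector_derivative_cong_ev) (auto simp: eventually_at_filter)
  then show ?thesis unfolding Dz_def vector_derivative_def by simp
qed

lemma Dz_iter_cong:
  assumes "\<And>y. y \<ge> a \<Longrightarrow> f y = g y" "z \<ge> a"
  shows "(Dz a ^^ n) f z = (Dz a ^^ n) g z"
  using assms(2) 
proof (induction n arbitrary: z)
  case 0 then show ?case using assms by simp
next
  case (Suc n) then show ?case by (auto intro: Dz_cong)
qed

definition diff_from :: "real \<Rightarrow> (real \<Rightarrow> real) \<Rightarrow> bool" where
  "diff_from a f \<longleftrightarrow> (\<forall>z\<ge>a. f differentiable (at z within {a..}))"

lemma differentiable_cong_from:
  assumes "\<And>y. y \<ge> a \<Longrightarrow> f y = g y" "diff_from a f"
  shows "diff_from a g"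
  unfolding diff_from_def
proof (intro allI impI)
  fix z assume "a \<le> z"
  then have "f differentiable (at z within {a..})" using assms by (auto simp: diff_from_def)
  then show "g differentiable (at z within {a..})"
    unfolding differentiable_def
    by (elim ex_forward has_derivative_transform[rotated 2]) (use assms(1) \<open>a \<le> z\<close> in auto)
qed

lemma smooth_from_alt: "smooth_from a f \<longleftrightarrow> (\<forall>n. diff_from a ((Dz a ^^ n) f))"
  by (auto simp: smooth_from_def diff_from_def)

lemma smooth_from_cong:
  assumes "\<And>y. y \<ge> a \<Longrightarrow> f y = g y" "smooth_from a f"
  shows "smooth_from a g"
  unfolding smooth_from_alt
proof
  fix n
  show "diff_from a ((Dz a ^^ n) g)"
    by (rule differentiable_cong_from[of a "(Dz a ^^ n) f"])
       (use assms in \<open>auto intro: Dz_iter_cong simp: smooth_from_alt\<close>)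
qed

lemma smooth_from_Dz: "smooth_from a f \<Longrightarrow> smooth_from a (Dz a f)"
  unfolding smooth_from_alt by (metis funpow_Suc_right o_apply)

lemma diff_from_has_derivative:
  assumes "diff_from a f" "z \<ge> a"
  shows "(f has_real_derivative Dz a f z) (at z within {a..})"
proof -
  obtain d where "(f has_real_derivative d) (at z within {a..})"
    using assms unfolding diff_from_def real_differentiable_def by auto
  with Dz_eqI[OF this assms(2)] show ?thesis by simp
qed

lemma smooth_from_has_derivative:
  assumes "smooth_from a f" "z \<ge> a"
  shows "(f has_real_derivative Dz a f z) (at z within {a..})"
  by (rule diff_from_has_derivative) (use assms in \<open>auto simp: smooth_from_def diff_from_def dest: spec[of _ 0]\<close>)

text \<open>A chain in which every function is the derivative of its predecessor determines all
  iterates of \<open>Dz\<close> at once. The closure properties of smooth functions below each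
  exhibit such a chain.\<close>

lemma
  assumes "\<And>n z. z \<ge> a \<Longrightarrow> (F n has_real_derivative F (Suc n) z) (at z within {a..})"
  shows smooth_from_family: "smooth_from a (F 0)"
    and Dz_iter_family: "z \<ge> a \<Longrightarrow> (Dz a ^^ n) (F 0) z = F n z"
proof -
  have *: "(Dz a ^^ n) (F 0) z = F n z" if "z \<ge> a" for n z
    using that
  proof (induction n arbitrary: z)
    case (Suc n)
    have "Dz a ((Dz a ^^ n) (F 0)) z = Dz a (F n) z"
      using Suc by (intro Dz_cong) auto
    also have "\<dots> = F (Suc n) z" using assms Suc.prems by (intro Dz_eqI) auto
    finally show ?case by simp
  qed simp
  then show "z \<ge> a \<Longrightarrow> (Dz a ^^ n) (F 0) z = F n z" .
  show "smooth_from a (F 0)"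
    unfolding smooth_from_alt
  proof
    fix n
    show "diff_from a ((Dz a ^^ n) (F 0))"
    proof (rule differentiable_cong_from[of _ "F n"])
      show "diff_from a (F n)"
        using assms unfolding diff_from_def by (meson real_differentiable_def)
    qed (simp add: *)
  qed
qed

lemma smooth_from_add:
  assumes "smooth_from a f" "smooth_from a g"
  shows "smooth_from a (\<lambda>z. f z + g z)"
    and "z \<ge> a \<Longrightarrow> (Dz a ^^ n) (\<lambda>z. f z + g z) z = (Dz a ^^ n) f z + (Dz a ^^ n) g z"
proof -
  have "((\<lambda>z. (Dz a ^^ n) f z + (Dz a ^^ n) g z) has_real_derivative (Dz a ^^ Suc n) f z
      + (Dz a ^^ Suc n) g z) (at z within {a..})" if "z \<ge> a" for n z
    unfolding funpow.simps o_def using assms that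
    by (intro derivative_intros diff_from_has_derivative) (auto simp: smooth_from_alt)
  from smooth_from_family[of a "\<lambda>n z. (Dz a ^^ n) f z + (Dz a ^^ n) g z", OF this]
    Dz_iter_family[of a "\<lambda>n z. (Dz a ^^ n) f z + (Dz a ^^ n) g z", OF this]
  show "smooth_from a (\<lambda>z. f z + g z)"
    "z \<ge> a \<Longrightarrow> (Dz a ^^ n) (\<lambda>z. f z + g z) z = (Dz a ^^ n) f z + (Dz a ^^ n) g z"
    by auto
qed

lemma smooth_from_cmult:
  assumes "smooth_from a f"
  shows "smooth_from a (\<lambda>z. c * f z)"
    and "z \<ge> a \<Longrightarrow> (Dz a ^^ n) (\<lambda>z. c * f z) z = c * (Dz a ^^ n) f z"
proof -
  have "((\<lambda>z. c * (Dz a ^^ n) f z) has_real_derivative c * (Dz a ^^ Suc n) f z) (at z within {a..})" if "z \<ge> a" for n z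
    unfolding funpow.simps o_def using assms that
    by (intro DERIV_cmult diff_from_has_derivative) (auto simp: smooth_from_alt)
  from smooth_from_family[of a "\<lambda>n z. c * (Dz a ^^ n) f z", OF this]
    Dz_iter_family[of a "\<lambda>n z. c * (Dz a ^^ n) f z", OF this]
  show "smooth_from a (\<lambda>z. c * f z)"
    "z \<ge> a \<Longrightarrow> (Dz a ^^ n) (\<lambda>z. c * f z) z = c * (Dz a ^^ n) f z"
    by auto
qed

lemma smooth_from_times_id:
  assumes "smooth_from a f"
  shows "smooth_from a (\<lambda>z. z * f z)"
    and "z \<ge> a \<Longrightarrow> (Dz a ^^ n) (\<lambda>z. z * f z) z = z * (Dz a ^^ n) f z + real n * (Dz a ^^ (n - 1)) f z"
proof -
  \<comment> \<open>The Leibniz rule for \<open>z * f\<close> has only two terms because the second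
    derivative of \<open>z\<close> is \<open>0\<close>. For \<open>n = 0\<close> the truncated index
    \<open>n - 1\<close> is harmless, since its coefficient is \<open>0\<close>.\<close>
  define F where "F = (\<lambda>n z. z * (Dz a ^^ n) f z + real n * (Dz a ^^ (n - 1)) f z)"
  have "(F n has_real_derivative F (Suc n) z) (at z within {a..})" if "z \<ge> a" for n z
  proof -
    have *: "((Dz a ^^ n) f has_real_derivative (Dz a ^^ Suc n) f z) (at z within {a..})" for n
      unfolding funpow.simps o_def using assms that
      by (intro diff_from_has_derivative) (auto simp: smooth_from_alt)
    show ?thesis
    proof (cases n)
      case 0
      then show ?thesis unfolding F_def using *[of 0] by (auto intro!: derivative_eq_intros)
    next
      case (Suc m)
      show ?thesis unfolding F_def Suc diff_Suc_1
        by (rule derivative_eq_intros * refl)+ (simp add: algebra_simps)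
    qed
  qed
  from smooth_from_family[of a F, OF this] Dz_iter_family[of a F, OF this]
  show "smooth_from a (\<lambda>z. z * f z)"
    "z \<ge> a \<Longrightarrow> (Dz a ^^ n) (\<lambda>z. z * f z) z = z * (Dz a ^^ n) f z + real n * (Dz a ^^ (n - 1)) f z"
    by (auto simp: F_def)
qed

text \<open>For \<open>g = f / z\<close> the Leibniz rule applied to \<open>z * g = f\<close> reads
  \<open>z * g^(n+1) + (n+1) * g^(n) = f^(n+1)\<close>; the recursion solves this for the highest
  derivative.\<close>

fun div_id_deriv :: "real \<Rightarrow> (real \<Rightarrow> real) \<Rightarrow> nat \<Rightarrow> real \<Rightarrow> real" where
  "div_id_deriv a f 0 z = f z / z"
| "div_id_deriv a f (Suc n) z = ((Dz a ^^ Suc n) f z - real (Suc n) * div_id_deriv a f n z) / z"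

lemma smooth_from_div_id:
  assumes "smooth_from a f" "a > 0"
  shows "smooth_from a (\<lambda>z. f z / z)"
    and "z \<ge> a \<Longrightarrow> (Dz a ^^ n) (\<lambda>z. f z / z) z = div_id_deriv a f n z"
proof -
  have "(div_id_deriv a f n has_real_derivative div_id_deriv a f (Suc n) z) (at z within {a..})" if "z \<ge> a" for n z
    using that
  proof (induction n)
    case 0
    have "((\<lambda>z. f z / z) has_real_derivative (Dz a f z * z - f z * 1) / (z * z)) (at z within {a..})"
      using 0 assms by (intro derivative_intros smooth_from_has_derivative) auto
    moreover have "(Dz a f z * z - f z * 1) / (z * z) = div_id_deriv a f (Suc 0) z"
      using 0 assms by (simp add: field_simps)
    moreover have "div_id_deriv a f 0 = (\<lambda>z. f z / z)" by auto
    ultimately show ?case by metis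
  next
    case (Suc n)
    have *: "((Dz a ^^ Suc n) f has_real_derivative (Dz a ^^ Suc (Suc n)) f z) (at z within {a..})"
      unfolding funpow.simps(2)[of "Suc n"] o_def using assms Suc.prems
      by (intro diff_from_has_derivative) (auto simp: smooth_from_alt simp del: funpow.simps)
    define p where "p = (Dz a ^^ Suc n) f"
    define p' where "p' = (Dz a ^^ Suc (Suc n)) f z"
    define q where "q = div_id_deriv a f n"
    define q' where "q' = div_id_deriv a f (Suc n) z"
    have p: "(p has_real_derivative p') (at z within {a..})" using * by (simp only: p_def p'_def)
    have q: "(q has_real_derivative q') (at z within {a..})" using Suc.IH Suc.prems by (simp only: q_def q'_def)
    have q'eq: "q' = (p z - real (Suc n) * q z) / z"
      by (simp add: p_def q_def q'_def)
    have "((\<lambda>z. (p z - real (Suc n) * q z) / z) has_real_derivative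
       ((p' - real (Suc n) * q') * z - (p z - real (Suc n) * q z) * 1) / (z * z)) (at z within {a..})"
      using Suc.prems assms by (intro derivative_intros DERIV_cmult p q) auto
    moreover have "((p' - real (Suc n) * q') * z - (p z - real (Suc n) * q z) * 1) / (z * z) 
         = (p' - real (Suc (Suc n)) * q') / z"
      using Suc.prems assms unfolding q'eq by (simp add: field_simps)
    ultimately have "((\<lambda>z. (p z - real (Suc n) * q z) / z) has_real_derivative
       (p' - real (Suc (Suc n)) * q') / z) (at z within {a..})" by (simp only:)
    moreover have "div_id_deriv a f (Suc n) = (\<lambda>z. (p z - real (Suc n) * q z) / z)"
      by (rule ext) (simp only: p_def q_def div_id_deriv.simps(2))
    moreover have "(p' - real (Suc (Suc n)) * q') / z = div_id_deriv a f (Suc (Suc n)) z"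
      by (simp only: p'_def q'_def div_id_deriv.simps(2))
    ultimately show ?case by (simp only:)
  qed
  from smooth_from_family[of a "div_id_deriv a f", OF this] Dz_iter_family[of a "div_id_deriv a f", OF this]
  moreover have "div_id_deriv a f 0 = (\<lambda>z. f z / z)"
    by auto
  ultimately show "smooth_from a (\<lambda>z. f z / z)"
    "z \<ge> a \<Longrightarrow> (Dz a ^^ n) (\<lambda>z. f z / z) z = div_id_deriv a f n z"
    by auto
qed

section \<open>Differential operators and their jets\<close>

text \<open>Only the two generators of the Laurent polynomials are admitted as nonconstant
  multipliers, so that inductive proofs need no product rule.\<close>

inductive diff_op :: "real \<Rightarrow> ((real \<Rightarrow> real) \<Rightarrow> real \<Rightarrow> real) \<Rightarrow> bool" for a where
  scale: "diff_op a (\<lambda>f z. c * f z)"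
| times: "diff_op a (\<lambda>f z. z * f z)"
| div: "diff_op a (\<lambda>f z. f z / z)"
| Dz: "diff_op a (Dz a)"
| add: "diff_op a P \<Longrightarrow> diff_op a Q \<Longrightarrow> diff_op a (\<lambda>f z. P f z + Q f z)"
| comp: "diff_op a P \<Longrightarrow> diff_op a Q \<Longrightarrow> diff_op a (P \<circ> Q)"

lemma diff_op_comp: "diff_op a P \<Longrightarrow> diff_op a Q \<Longrightarrow> diff_op a (\<lambda>f. P (Q f))"
  using diff_op.comp[of a P Q] by (simp only: o_def)

inductive laurent :: "(real \<Rightarrow> real) \<Rightarrow> bool" where
  const: "laurent (\<lambda>z. c)"
| id: "laurent (\<lambda>z. z)"
| inv: "laurent (\<lambda>z. 1 / z)"
| add: "laurent c \<Longrightarrow> laurent d \<Longrightarrow> laurent (\<lambda>z. c z + d z)"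
| mult: "laurent c \<Longrightarrow> laurent d \<Longrightarrow> laurent (\<lambda>z. c z * d z)"

lemma laurent_minus: "laurent c \<Longrightarrow> laurent (\<lambda>z. - c z)"
  using laurent.mult[OF laurent.const[of "-1"], of c] by simp

lemma laurent_diff: "laurent c \<Longrightarrow> laurent d \<Longrightarrow> laurent (\<lambda>z. c z - d z)"
  using laurent.add[OF _ laurent_minus, of c d] by simp

lemma laurent_power: "laurent c \<Longrightarrow> laurent (\<lambda>z. c z ^ n)"
  by (induction n) (auto intro: laurent.intros)

lemma laurent_divide_const: "laurent c \<Longrightarrow> laurent (\<lambda>z. c z / k)"
  using laurent.mult[OF _ laurent.const[of "1 / k"], of c] by simp

lemmas laurent_intros = laurent.intros laurent_minus laurent_diff laurent_power laurent_divide_const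

lemma diff_op_laurent: "laurent c \<Longrightarrow> diff_op a (\<lambda>f z. c z * f z)"
proof (induction rule: laurent.induct)
  case (add c d)
  then show ?case using diff_op.add[OF add.IH] by (simp add: algebra_simps)
next
  case (mult c d)
  then show ?case using diff_op_comp[OF mult.IH] by (simp add: algebra_simps)
qed (auto intro: diff_op.scale diff_op.times diff_op.div)

lemma diff_op_Dz_iter: "diff_op a P \<Longrightarrow> diff_op a (\<lambda>f. (Dz a ^^ n) (P f))"
  by (induction n) (auto intro: diff_op_comp[OF diff_op.Dz])

lemma diff_op_sum: 
  assumes "\<And>i. i \<in> A \<Longrightarrow> diff_op a (P i)"
  shows "diff_op a (\<lambda>f z. \<Sum>i\<in>A. P i f z)"
  using assms
proof (induction A rule: infinite_finite_induct)
  case (insert x F)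
  then show ?case by (auto intro: diff_op.add)
qed (use diff_op.scale[of a 0] in auto)

lemma diff_op_sandwich:
  assumes "list_all laurent cs"
  shows "diff_op a (sandwich_op a cs)"
proof -
  have inv: "diff_op a (\<lambda>f u. 1 / u * f u)"
    by (rule diff_op_laurent[OF laurent.inv])
  have "diff_op a (\<lambda>f. (Dz a ^^ k) (\<lambda>y. (cs ! k) y * (y - a) ^ k * (Dz a ^^ k) (\<lambda>u. 1 / u * f u) y))"
    if "k < length cs" for k
  proof (rule diff_op_Dz_iter, rule diff_op_comp[of a "\<lambda>f y. (cs ! k) y * (y - a) ^ k * f y"])
    have "laurent (\<lambda>y. (cs ! k) y * (y - a) ^ k)"
      by (rule laurent.mult laurent_power laurent_diff laurent.id laurent.const assms[unfolded list_all_length, rule_format] that)+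
    then show "diff_op a (\<lambda>f y. (cs ! k) y * (y - a) ^ k * f y)" by (rule diff_op_laurent)
    show "diff_op a (\<lambda>f. (Dz a ^^ k) (\<lambda>u. 1 / u * f u))" by (rule diff_op_Dz_iter[OF inv])
  qed
  then have "diff_op a (\<lambda>f z. \<Sum>k<length cs. (Dz a ^^ k) (\<lambda>y. (cs ! k) y * (y
      - a) ^ k * (Dz a ^^ k) (\<lambda>u. 1 / u * f u) y) z)"
    by (intro diff_op_sum) simp
  from diff_op_comp[OF inv this] show ?thesis
    unfolding sandwich_op_def[abs_def] .
qed

lemma diff_op_S1: "diff_op t1 (S1 t1 t2)"
  unfolding S1_def by (rule diff_op_sandwich, unfold list.pred_inject(2)) (intro conjI list.pred_inject(1) laurent_intros)

lemma diff_op_S1_tilde: "diff_op t1 (S1_tilde t1 t2)"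
  unfolding S1_tilde_def by (rule diff_op_sandwich, unfold list.pred_inject(2)) (intro conjI list.pred_inject(1) laurent_intros)

lemma diff_op_shift: "diff_op a P \<Longrightarrow> diff_op a (shift_op P c)"
  unfolding shift_op_def[abs_def] by (intro diff_op.add diff_op.scale)

section \<open>Finite jets and the reduction to powers\<close>

definition jet_zero :: "real \<Rightarrow> nat \<Rightarrow> (real \<Rightarrow> real) \<Rightarrow> real \<Rightarrow> bool" where
  "jet_zero a n f z \<longleftrightarrow> (\<forall>i<n. (Dz a ^^ i) f z = 0)"

context
  fixes a :: real
  assumes a: "a > 0"
begin

lemma diff_op_cong:
  assumes "diff_op a P" "\<And>y. y \<ge> a \<Longrightarrow> f y = g y" "z \<ge> a"
  shows "P f z = P g z"
proof -
  have "\<forall>f g. (\<forall>y\<ge>a. f y = g y) \<longrightarrow> (\<forall>z\<ge>a. P f z = P g z)"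
    using assms(1)
  proof (induction rule: diff_op.induct)
    case Dz
    then show ?case using Dz_cong[of a] by blast
  next
    case (comp P Q)
    then show ?case unfolding o_apply by blast
  next
    case (add P Q)
    show ?case
    proof (intro allI impI)
      fix f g :: "real \<Rightarrow> real" and z assume *: "\<forall>y\<ge>a. f y = g y" "z \<ge> a"
      have "P f z = P g z"
        by (rule add.IH(1)[THEN spec, THEN spec, THEN mp, THEN spec, THEN mp]) (use * in auto)
      moreover have "Q f z = Q g z"
        by (rule add.IH(2)[THEN spec, THEN spec, THEN mp, THEN spec, THEN mp]) (use * in auto)
      ultimately show "P f z + Q f z = P g z + Q g z" by (simp only:)
    qed
  qed auto
  with assms(2,3) show ?thesis by blast
qed

lemma diff_op_smooth:
  assumes "diff_op a P" "smooth_from a f"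
  shows "smooth_from a (P f)"
proof -
  have "\<forall>f. smooth_from a f \<longrightarrow> smooth_from a (P f)"
    using assms(1)
    by (induction rule: diff_op.induct)
      (auto intro: a smooth_from_add smooth_from_cmult smooth_from_times_id smooth_from_div_id smooth_from_Dz)
  from this[rule_format, OF assms(2)] show ?thesis .
qed

lemma diff_op_add:
  assumes "diff_op a P" "smooth_from a f" "smooth_from a g" "z \<ge> a"
  shows "P (\<lambda>z. f z + g z) z = P f z + P g z"
proof -
  have "\<forall>f g. smooth_from a f \<longrightarrow> smooth_from a g \<longrightarrow> (\<forall>z\<ge>a. P (\<lambda>z. f z
      + g z) z = P f z + P g z)"
    using assms(1)
  proof (induction rule: diff_op.induct)
    case (comp P Q)
    show ?case
    proof (intro allI impI)
      fix f g z assume *: "smooth_from a f" "smooth_from a g" "a \<le> z"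
      have "P (Q (\<lambda>z. f z + g z)) z = P (\<lambda>z. Q f z + Q g z) z"
        using comp.IH(2) * by (intro diff_op_cong[OF comp.hyps(1)]) auto
      also have "\<dots> = P (Q f) z + P (Q g) z"
        by (rule comp.IH(1)[rule_format]) (use * diff_op_smooth[OF comp.hyps(2)] in auto)
      finally show "(P \<circ> Q) (\<lambda>z. f z + g z) z = (P \<circ> Q) f z + (P \<circ> Q) g z" by (simp only: o_apply)
    qed
  next
    case Dz
    then show ?case using smooth_from_add(2)[of a _ _ _ 1] by simp
  qed (auto simp: algebra_simps add_divide_distrib)
  from this[rule_format, OF assms(2-)] show ?thesis .
qed

lemma diff_op_cmult:
  assumes "diff_op a P" "smooth_from a f" "z \<ge> a"
  shows "P (\<lambda>z. c * f z) z = c * P f z"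
proof -
  have "\<forall>f. smooth_from a f \<longrightarrow> (\<forall>z\<ge>a. P (\<lambda>z. c * f z) z = c * P f z)"
    using assms(1)
  proof (induction rule: diff_op.induct)
    case (comp P Q)
    show ?case
    proof (intro allI impI)
      fix f z assume *: "smooth_from a f" "a \<le> z"
      have "P (Q (\<lambda>z. c * f z)) z = P (\<lambda>z. c * Q f z) z"
        using comp.IH(2) * by (intro diff_op_cong[OF comp.hyps(1)]) auto
      also have "\<dots> = c * P (Q f) z"
        by (rule comp.IH(1)[rule_format]) (use * diff_op_smooth[OF comp.hyps(2)] in auto)
      finally show "(P \<circ> Q) (\<lambda>z. c * f z) z = c * (P \<circ> Q) f z" by (simp only: o_apply)
    qed
  next
    case Dz
    then show ?case using smooth_from_cmult(2)[of a _ _ 1] by simp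
  qed (auto simp: algebra_simps)
  from this[rule_format, OF assms(2-)] show ?thesis .
qed

text \<open>\<open>N\<close> acts as an order: \<open>Dz\<close> costs one entry of the jet, and the
  multipliers cost none by their Leibniz rules. The extra \<open>j\<close> makes the claim
  composable, since an outer operator needs a whole jet of the inner result and not only its
  value.\<close>

lemma diff_op_jet_zero:
  assumes "diff_op a P"
  shows "\<exists>N. \<forall>f z j. smooth_from a f \<longrightarrow> z \<ge> a \<longrightarrow> jet_zero a (N
      + j) f z \<longrightarrow> jet_zero a j (P f) z"
  using assms
proof (induction rule: diff_op.induct)
  case (scale c)
  show ?case by (rule exI[of _ 0]) (auto simp: jet_zero_def smooth_from_cmult)
next
  case times
  show ?case by (rule exI[of _ 0]) (auto simp: jet_zero_def smooth_from_times_id)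
next
  case div
  have "div_id_deriv a f i z = 0" if "i < j" "jet_zero a j f z" for f i j z
    using that by (induction i) (auto simp: jet_zero_def simp del: funpow.simps(2))
  note * = this
  show ?case
  proof (intro exI[of _ 0] allI impI)
    fix f z j assume f: "smooth_from a f" "z \<ge> a" "jet_zero a (0 + j) f z"
    show "jet_zero a j (\<lambda>z. f z / z) z"
      unfolding jet_zero_def
    proof (intro allI impI)
      fix i assume "i < j"
      then show "(Dz a ^^ i) (\<lambda>z. f z / z) z = 0"
        unfolding smooth_from_div_id(2)[OF f(1) a f(2)] using f(3) by (intro *[of i j]) auto
    qed
  qed
next
  case Dz
  show ?case
  proof (intro exI[of _ 1] allI impI)
    fix f z j assume f: "smooth_from a f" "z \<ge> a" "jet_zero a (1 + j) f z"
    have "(Dz a ^^ i) (Dz a f) z = (Dz a ^^ Suc i) f z" for i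
      by (simp only: funpow_Suc_right o_apply)
    with f(3) show "jet_zero a j (Dz a f) z"
      unfolding jet_zero_def by (simp del: funpow.simps)
  qed
next
  case (add P Q)
  obtain M where M: "\<forall>f z j. smooth_from a f \<longrightarrow> z \<ge> a \<longrightarrow> jet_zero a (M
      + j) f z \<longrightarrow> jet_zero a j (P f) z"
    using add.IH(1) by (rule exE)
  obtain N where N: "\<forall>f z j. smooth_from a f \<longrightarrow> z \<ge> a \<longrightarrow> jet_zero a (N
      + j) f z \<longrightarrow> jet_zero a j (Q f) z"
    using add.IH(2) by (rule exE)
  show ?case
  proof (intro exI[of _ "M + N"] allI impI)
    fix f z j assume *: "smooth_from a f" "z \<ge> a" "jet_zero a (M + N + j) f z"
    have "jet_zero a j (P f) z"
      by (rule M[rule_format]) (use * in \<open>auto simp: jet_zero_def\<close>)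
    moreover have "jet_zero a j (Q f) z"
      by (rule N[rule_format]) (use * in \<open>auto simp: jet_zero_def\<close>)
    ultimately show "jet_zero a j (\<lambda>z. P f z + Q f z) z"
      using smooth_from_add(2)[OF diff_op_smooth[OF add.hyps(1) *(1)] diff_op_smooth[OF add.hyps(2) *(1)] *(2)]
      by (simp add: jet_zero_def)
  qed
next
  case (comp P Q)
  obtain M where M: "\<forall>f z j. smooth_from a f \<longrightarrow> z \<ge> a \<longrightarrow> jet_zero a (M
      + j) f z \<longrightarrow> jet_zero a j (P f) z"
    using comp.IH(1) by (rule exE)
  obtain N where N: "\<forall>f z j. smooth_from a f \<longrightarrow> z \<ge> a \<longrightarrow> jet_zero a (N
      + j) f z \<longrightarrow> jet_zero a j (Q f) z"
    using comp.IH(2) by (rule exE)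
  show ?case
  proof (intro exI[of _ "N + M"] allI impI)
    fix f z j assume *: "smooth_from a f" "z \<ge> a" "jet_zero a (N + M + j) f z"
    have "jet_zero a (M + j) (Q f) z"
      by (rule N[rule_format]) (use * in \<open>auto simp: add.assoc\<close>)
    then have "jet_zero a j (P (Q f)) z"
      by (intro M[rule_format] diff_op_smooth[OF comp.hyps(2)]) (use * in auto)
    then show "jet_zero a j ((P \<circ> Q) f) z" by (simp only: o_apply)
  qed
qed

lemma
  shows smooth_from_poly: "smooth_from a (poly p)"
    and Dz_iter_poly: "z \<ge> a \<Longrightarrow> (Dz a ^^ n) (poly p) z = poly ((pderiv ^^ n) p) z"
proof -
  have "(poly ((pderiv ^^ n) p) has_real_derivative poly ((pderiv ^^ Suc n) p) z) (at z within {a..})" for n z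
    by (auto intro: has_field_derivative_at_within poly_DERIV)
  from smooth_from_family[of a "\<lambda>n. poly ((pderiv ^^ n) p)", OF this]
    Dz_iter_family[of a "\<lambda>n. poly ((pderiv ^^ n) p)", OF this]
  show "smooth_from a (poly p)" "z \<ge> a \<Longrightarrow> (Dz a ^^ n) (poly p) z = poly ((pderiv ^^ n) p) z"
    by auto
qed

lemma poly_antiderivative: "\<exists>q. pderiv q = (p :: real poly)"
proof (induction p)
  case 0
  then show ?case by (intro exI[of _ 0]) simp
next
  case (pCons c p)
  define q where "q = Poly (0 # map (\<lambda>i. coeff (pCons c p) i / real (Suc i)) [0..<Suc (degree (pCons c p))])"
  have "coeff (pderiv q) n = coeff (pCons c p) n" for n
    unfolding coeff_pderiv q_def
    by (cases "n \<le> degree (pCons c p)") (auto simp: nth_default_def coeff_eq_0 simp del: upt_Suc)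
  then show ?case by (auto simp: poly_eq_iff)
qed

text \<open>The Taylor polynomial, built without factorials: take an antiderivative of an
  interpolant for \<open>Dz a f\<close> and adjust its constant term to match \<open>f\<close> at
  \<open>z\<close>.\<close>

lemma jet_interpolation:
  assumes "smooth_from a f" "z \<ge> a"
  shows "\<exists>q. \<forall>i<N. (Dz a ^^ i) f z = (Dz a ^^ i) (poly q) z"
  using assms(1)
proof (induction N arbitrary: f)
  case (Suc N)
  obtain q where q: "\<forall>i<N. (Dz a ^^ i) (Dz a f) z = (Dz a ^^ i) (poly q) z"
    using Suc.IH[OF smooth_from_Dz[OF Suc.prems]] by auto
  obtain r where r: "pderiv r = q" using poly_antiderivative by blast
  define p where "p = r + [:f z - poly r z:]"
  have p: "pderiv p = q" by (simp add: p_def r pderiv_add pderiv_pCons)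
  have "(Dz a ^^ i) f z = (Dz a ^^ i) (poly p) z" if "i < Suc N" for i
  proof (cases i)
    case 0
    then show ?thesis by (simp add: p_def)
  next
    case (Suc j)
    have "(Dz a ^^ i) (poly p) z = poly ((pderiv ^^ j) (pderiv p)) z"
      using Dz_iter_poly[OF assms(2), of i p] by (simp only: Suc funpow_Suc_right o_apply)
    also have "\<dots> = (Dz a ^^ j) (Dz a f) z"
      using q that Suc assms(2) p by (simp add: Dz_iter_poly)
    finally show ?thesis by (simp only: Suc funpow_Suc_right o_apply)
  qed
  then show ?case by blast
qed simp

lemma smooth_from_power: "smooth_from a (\<lambda>z. z ^ n)"
  using smooth_from_poly[of "monom 1 n"] by (simp add: poly_monom[abs_def])

lemma diff_op_poly:
  assumes "diff_op a P" "z \<ge> a"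
  shows "P (poly q) z = (\<Sum>i\<le>degree q. coeff q i * P (\<lambda>z. z ^ i) z)"
proof -
  have "smooth_from a (\<lambda>z. \<Sum>i\<le>n. c i * z ^ i) \<and> P (\<lambda>z. \<Sum>i\<le>n. c i * z ^ i) z =
      (\<Sum>i\<le>n. c i * P (\<lambda>z. z ^ i) z)" for n and c :: "nat \<Rightarrow> real"
  proof (induction n)
    case 0
    show ?case
      using smooth_from_cmult(1)[OF smooth_from_power, of "c 0" 0]
        diff_op_cmult[OF assms(1) smooth_from_power assms(2), of "c 0" 0] by simp
  next
    case (Suc n)
    then show ?case
      using smooth_from_cmult(1)[OF smooth_from_power, of "c (Suc n)" "Suc n"]
        diff_op_cmult[OF assms(1) smooth_from_power assms(2), of "c (Suc n)" "Suc n"]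
        diff_op_add[OF assms(1) _ _ assms(2), of "\<lambda>z. \<Sum>i\<le>n. c i * z ^ i" "\<lambda>z. c (Suc n) * z ^ Suc n"]
      unfolding sum.atMost_Suc by (auto intro: smooth_from_add)
  qed
  moreover have "poly q = (\<lambda>z. \<Sum>i\<le>degree q. coeff q i * z ^ i)"
    by (auto simp: poly_altdef)
  ultimately show ?thesis by metis
qed

text \<open>At a given point a differential operator sees only a finite jet of its argument, and every
  jet is the jet of a polynomial; so powers suffice to test equality.\<close>

theorem diffop_eqI_powers:
  assumes P: "diff_op a P" and Q: "diff_op a Q"
    and eq: "\<And>n z. z \<ge> a \<Longrightarrow> P (\<lambda>z. z ^ n) z = Q (\<lambda>z. z ^ n) z"
  shows "diffop_eq a P Q"
  unfolding diffop_eq_def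
proof (intro allI impI)
  fix f z assume f: "smooth_from a f" and z: "z \<ge> a"
  have determined: "\<exists>N. \<forall>q. (\<forall>i<N. (Dz a ^^ i) f z = (Dz a ^^ i) (poly q) z) \<longrightarrow> R f z = R (poly q) z"
    if R: "diff_op a R" for R
  proof -
    obtain N where N: "\<And>f z j. smooth_from a f \<Longrightarrow> z \<ge> a \<Longrightarrow> jet_zero a (N
        + j) f z \<Longrightarrow> jet_zero a j (R f) z"
      using diff_op_jet_zero[OF R] by blast
    show ?thesis
    \<comment> \<open>A jet of length \<open>1\<close> is the mere value at \<open>z\<close>, which
      is why one entry beyond \<open>N\<close> is matched.\<close>
    proof (intro exI[of _ "N + 1"] allI impI)
      fix q assume q: "\<forall>i<N + 1. (Dz a ^^ i) f z = (Dz a ^^ i) (poly q) z"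
      define g where "g = (\<lambda>z. f z + (-1) * poly q z)"
      have q': "smooth_from a (\<lambda>z. (-1) * poly q z)" by (intro smooth_from_cmult smooth_from_poly)
      have "jet_zero a (N + 1) g z"
        unfolding jet_zero_def g_def smooth_from_add(2)[OF f q' z] smooth_from_cmult(2)[OF smooth_from_poly z]
        using q by simp
      moreover have g: "smooth_from a g" unfolding g_def by (intro smooth_from_add f q')
      ultimately have "R g z = 0" using N[of g z 1] z by (auto simp: jet_zero_def)
      moreover have "R g z = R f z + (-1) * R (poly q) z"
        unfolding g_def using diff_op_add[OF R f q' z] diff_op_cmult[OF R smooth_from_poly z, of "-1" q] by simp
      ultimately show "R f z = R (poly q) z" by simp
    qed
  qed
  obtain M where M: "\<forall>q. (\<forall>i<M. (Dz a ^^ i) f z = (Dz a ^^ i) (poly q) z) \<longrightarrow> P f z = P (poly q) z"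
    using determined[OF P] by blast
  obtain N where N: "\<forall>q. (\<forall>i<N. (Dz a ^^ i) f z = (Dz a ^^ i) (poly q) z) \<longrightarrow> Q f z = Q (poly q) z"
    using determined[OF Q] by blast
  obtain q where "\<forall>i<max M N. (Dz a ^^ i) f z = (Dz a ^^ i) (poly q) z"
    using jet_interpolation[OF f z] by blast
  then have "P f z = P (poly q) z" "Q f z = Q (poly q) z"
    using M N by auto
  with eq z P Q show "P f z = Q f z" by (simp add: diff_op_poly)
qed

end

section \<open>Symbols of differential operators\<close>

text \<open>A list encodes the coefficients of a Laurent polynomial, lowest power first; the exponent
  \<open>k\<close> of the first term may be any real number.\<close>

primrec lsum :: "real \<Rightarrow> real list \<Rightarrow> real \<Rightarrow> real" where
  "lsum k [] z = 0"
| "lsum k (c # cs) z = c * z powr k + lsum (k + 1) cs z"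

text \<open>Differentiation lowers the first exponent to \<open>k - 1\<close> but keeps the length
  of the list, even when a coefficient becomes \<open>0\<close>. So positions in a list stay
  predictable for arbitrary \<open>k\<close>.\<close>

primrec lderiv :: "real \<Rightarrow> real list \<Rightarrow> real list" where
  "lderiv k [] = []"
| "lderiv k (c # cs) = (k * c) # lderiv (k + 1) cs"

primrec lderiv_iter :: "nat \<Rightarrow> real \<Rightarrow> real list \<Rightarrow> real list" where
  "lderiv_iter 0 k cs = cs"
| "lderiv_iter (Suc n) k cs = lderiv_iter n (k - 1) (lderiv k cs)"

fun ladd :: "real list \<Rightarrow> real list \<Rightarrow> real list" where
  "ladd [] ys = ys"
| "ladd (x # xs) [] = x # xs"
| "ladd (x # xs) (y # ys) = (x + y) # ladd xs ys"

primrec lmult :: "real list \<Rightarrow> real list \<Rightarrow> real list" where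
  "lmult [] cs = []"
| "lmult (b # bs) cs = ladd (map ((*) b) cs) (0 # lmult bs cs)"

text \<open>\<open>\<sigma> k\<close> lists the coefficients of the image of a single power with
  exponent \<open>k\<close>; this is the linear extension to a list with first exponent
  \<open>k\<close>. The drop \<open>N\<close> of the exponent, common to all terms, is left out here
  and restored in \<open>has_symbol_apply\<close>.\<close>

primrec lapply :: "(real \<Rightarrow> real list) \<Rightarrow> real \<Rightarrow> real list \<Rightarrow> real list" where
  "lapply \<sigma> k [] = []"
| "lapply \<sigma> k (c # cs) = ladd (map ((*) c) (\<sigma> k)) (0 # lapply \<sigma> (k + 1) cs)"

lemma lsum_ladd: "lsum k (ladd xs ys) z = lsum k xs z + lsum k ys z"
  by (induction xs ys arbitrary: k rule: ladd.induct) (auto simp: algebra_simps)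

lemma lsum_scale: "lsum k (map ((*) b) cs) z = b * lsum k cs z"
  by (induction cs arbitrary: k) (auto simp: algebra_simps)

lemma lsum_mult_powr: "z > 0 \<Longrightarrow> z powr j * lsum k cs z = lsum (j + k) cs z"
  by (induction cs arbitrary: k) (auto simp: algebra_simps powr_add)

lemma lsum_lmult:
  assumes "z > 0"
  shows "lsum k (lmult bs cs) z = (\<Sum>i<length bs. bs ! i * z ^ i) * lsum k cs z"
proof (induction bs arbitrary: k)
  case (Cons b bs)
  have "lsum (k + 1) cs z = z * lsum k cs z"
    using lsum_mult_powr[of z 1 k cs] assms by (simp add: add.commute)
  then show ?case
    by (simp add: lsum_ladd lsum_scale Cons sum.lessThan_Suc_shift sum_distrib_left algebra_simps del: sum.lessThan_Suc)
qed simp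

lemma lsum_has_derivative:
  assumes "z > 0"
  shows "(lsum k cs has_real_derivative lsum (k - 1) (lderiv k cs) z) (at z)"
proof (induction cs arbitrary: k)
  case (Cons c cs)
  have "((\<lambda>z. c * z powr k + lsum (k + 1) cs z) has_real_derivative
      c * (k * z powr (k - 1)) + lsum (k + 1 - 1) (lderiv (k + 1) cs) z) (at z)"
    using assms by (intro derivative_intros DERIV_cmult has_real_derivative_powr Cons)
  then show ?case by (simp add: algebra_simps lsum.simps[abs_def])
qed (simp add: lsum.simps[abs_def])

lemma Dz_iter_lsum:
  assumes "a > 0"
  shows "z \<ge> a \<Longrightarrow> (Dz a ^^ n) (lsum k cs) z = lsum (k - real n) (lderiv_iter n k cs) z"
proof (induction n arbitrary: k cs)
  case (Suc n)
  have "(Dz a ^^ Suc n) (lsum k cs) z = (Dz a ^^ n) (lsum (k - 1) (lderiv k cs)) z"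
    unfolding funpow_Suc_right o_apply using assms Suc.prems
    by (intro Dz_iter_cong Dz_eqI has_field_derivative_at_within[OF lsum_has_derivative]) auto
  also have "\<dots> = lsum (k - 1 - real n) (lderiv_iter n (k - 1) (lderiv k cs)) z"
    by (rule Suc.IH[OF Suc.prems])
  finally show ?case by (simp add: algebra_simps)
qed simp

lemma smooth_from_lsum:
  assumes "a > 0"
  shows "smooth_from a (lsum k cs)"
proof -
  have "(Dz a ^^ n) (lsum k cs) differentiable at z within {a..}" if "z \<ge> a" for n z
    using differentiable_cong_from[of a "lsum (k - real n) (lderiv_iter n k cs)" "(Dz a ^^ n) (lsum k cs)"]
      Dz_iter_lsum[OF assms] lsum_has_derivative assms that
    unfolding diff_from_def by (smt (verit) has_field_derivative_at_within real_differentiable_def)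
  then show ?thesis by (auto simp: smooth_from_def)
qed

text \<open>In the exponent \<open>s - 2 - 2 * real k\<close> the \<open>2\<close> comes from the
  two factors \<open>1 / z\<close> and \<open>2 * real k\<close> from the two blocks of
  \<open>k\<close> derivatives. Multiplication by the polynomial \<open>Cs ! k\<close> leaves the
  first exponent unchanged.\<close>

lemma sandwich_op_powr:
  assumes "a > 0" "z \<ge> a" "length Cs = length cs"
    and C: "\<And>k y. k < length cs \<Longrightarrow> (cs ! k) y * (y - a) ^ k = (\<Sum>i<length (Cs ! k). Cs ! k ! i * y ^ i)"
  shows "sandwich_op a cs (lsum s [1]) z =
    (\<Sum>k<length cs. lsum (s - 2 - 2 * real k)
        (lderiv_iter k (s - 1 - real k) (lmult (Cs ! k) (lderiv_iter k (s - 1) [1]))) z)"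
proof -
  have div: "1 / y * lsum k cs y = lsum (k - 1) cs y" if "y \<ge> a" for y k cs
    using lsum_mult_powr[of y "-1" k cs] that assms(1) by (simp add: powr_minus_divide)
  have "(Dz a ^^ k) (\<lambda>y. (cs ! k) y * (y - a) ^ k * (Dz a ^^ k) (\<lambda>u. 1 / u * lsum s [1] u) y) z
    = lsum (s - 1 - 2 * real k) (lderiv_iter k (s - 1 - real k) (lmult (Cs ! k) (lderiv_iter k (s - 1) [1]))) z"
    if k: "k < length cs" for k
  proof -
    have "(Dz a ^^ k) (\<lambda>u. 1 / u * lsum s [1] u) y = lsum (s - 1 - real k) (lderiv_iter k (s - 1) [1]) y" if "y \<ge> a" for y
    proof -
      have "(Dz a ^^ k) (\<lambda>u. 1 / u * lsum s [1] u) y = (Dz a ^^ k) (lsum (s - 1) [1]) y"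
        by (intro Dz_iter_cong div that)
      also have "\<dots> = lsum (s - 1 - real k) (lderiv_iter k (s - 1) [1]) y"
        by (rule Dz_iter_lsum[OF assms(1) that])
      finally show ?thesis .
    qed
    then have "(Dz a ^^ k) (\<lambda>y. (cs ! k) y * (y - a) ^ k * (Dz a ^^ k) (\<lambda>u. 1 / u * lsum s [1] u) y) z
      = (Dz a ^^ k) (lsum (s - 1 - real k) (lmult (Cs ! k) (lderiv_iter k (s - 1) [1]))) z"
      using assms(1,2) k by (intro Dz_iter_cong) (auto simp: C lsum_lmult)
    also have "\<dots> = lsum (s - 1 - real k - real k) (lderiv_iter k (s - 1 - real k) (lmult (Cs ! k) (lderiv_iter k (s - 1) [1]))) z"
      by (rule Dz_iter_lsum[OF assms(1,2)])
    also have "s - 1 - real k - real k = s - 1 - 2 * real k" by simp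
    finally show ?thesis .
  qed
  then have "sandwich_op a cs (lsum s [1]) z = 
    1 / z * (\<Sum>k<length cs. lsum (s - 1 - 2 * real k) (lderiv_iter k (s - 1 - real k) (lmult (Cs ! k) (lderiv_iter k (s - 1) [1]))) z)"
    unfolding sandwich_op_def by (intro arg_cong2[of _ _ _ _ "(*)"] refl sum.cong) auto
  also have "\<dots> = (\<Sum>k<length cs. lsum (s - 1 - 2 * real k - 1) (lderiv_iter k (s - 1 - real k) (lmult (Cs ! k) (lderiv_iter k (s
      - 1) [1]))) z)"
    unfolding sum_distrib_left by (intro sum.cong refl div assms(2))
  finally show ?thesis by (simp add: algebra_simps)
qed

definition has_symbol :: "real \<Rightarrow> ((real \<Rightarrow> real) \<Rightarrow> real \<Rightarrow> real) \<Rightarrow> real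
    \<Rightarrow> (real \<Rightarrow> real list) \<Rightarrow> bool" where
  "has_symbol a P N \<sigma> \<longleftrightarrow> (\<forall>s. \<forall>z\<ge>a. P (lsum s [1]) z = lsum (s - N) (\<sigma> s) z)"

lemma has_symbol_apply:
  assumes "a > 0" "diff_op a P" "has_symbol a P N \<sigma>" "z \<ge> a"
  shows "P (lsum k cs) z = lsum (k - N) (lapply \<sigma> k cs) z"
proof (induction cs arbitrary: k)
  case Nil
  have "P (\<lambda>z. 0 * lsum k [1] z) z = 0"
    using assms by (subst diff_op_cmult) (auto intro: smooth_from_lsum)
  then show ?case by (simp add: lsum.simps[abs_def])
next
  case (Cons c cs)
  have "P (lsum k (c # cs)) z = P (\<lambda>z. c * lsum k [1] z + lsum (k + 1) cs z) z"
    by (simp add: lsum.simps[abs_def])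
  also have "\<dots> = c * P (lsum k [1]) z + P (lsum (k + 1) cs) z"
    using diff_op_add[OF assms(1,2) smooth_from_cmult(1)[OF smooth_from_lsum[OF assms(1)]] smooth_from_lsum[OF assms(1)] assms(4)]
      diff_op_cmult[OF assms(1,2) smooth_from_lsum[OF assms(1)] assms(4)]
      by (simp del: lsum.simps)
  also have "\<dots> = c * lsum (k - N) (\<sigma> k) z + lsum (k + 1 - N) (lapply \<sigma> (k + 1) cs) z"
    using assms(3,4) by (simp only: Cons has_symbol_def)
  also have "\<dots> = lsum (k - N) (lapply \<sigma> k (c # cs)) z"
    by (simp add: lsum_ladd lsum_scale algebra_simps)
  finally show ?case .
qed

lemma has_symbol_comp:
  assumes "a > 0" "diff_op a P" "diff_op a Q" "has_symbol a P M \<sigma>" "has_symbol a Q N \<tau>"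
  shows "has_symbol a (P \<circ> Q) (M + N) (\<lambda>s. lapply \<sigma> (s - N) (\<tau> s))"
  unfolding has_symbol_def
proof (intro allI impI)
  fix s z assume z: "a \<le> z"
  have "P (Q (lsum s [1])) z = P (lsum (s - N) (\<tau> s)) z"
    using assms z by (intro diff_op_cong[OF assms(1,2)]) (auto simp: has_symbol_def)
  also have "\<dots> = lsum (s - N - M) (lapply \<sigma> (s - N) (\<tau> s)) z"
    using assms z by (intro has_symbol_apply)
  finally show "(P \<circ> Q) (lsum s [1]) z = lsum (s - (M + N)) (lapply \<sigma> (s - N) (\<tau> s)) z"
    by (simp add: algebra_simps)
qed

lemma lsum_replicate: "lsum k (replicate n 0 @ cs) z = lsum (k + real n) cs z"
  by (induction n arbitrary: k) (simp_all add: algebra_simps)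

text \<open>Symbols can be added entrywise only if they belong to the same drop; leading zeros raise
  the smaller one.\<close>

lemma has_symbol_pad:
  assumes "has_symbol a P N \<sigma>"
  shows "has_symbol a P (N + real n) (\<lambda>s. replicate n 0 @ \<sigma> s)"
  using assms by (simp add: has_symbol_def lsum_replicate)

lemma has_symbol_add:
  assumes "has_symbol a P N \<sigma>" "has_symbol a Q N \<tau>"
  shows "has_symbol a (\<lambda>f z. P f z + Q f z) N (\<lambda>s. ladd (\<sigma> s) (\<tau> s))"
  using assms by (simp add: has_symbol_def lsum_ladd)

lemma has_symbol_scale:
  assumes "has_symbol a P N \<sigma>"
  shows "has_symbol a (\<lambda>f z. c * P f z) N (\<lambda>s. map ((*) c) (\<sigma> s))"
  using assms by (simp add: has_symbol_def lsum_scale)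

lemma has_symbol_id: "has_symbol a (\<lambda>f. f) 0 (\<lambda>s. [1])"
  by (simp add: has_symbol_def)

lemma diffop_eqI_symbol:
  assumes a: "a > 0" and P: "diff_op a P" "has_symbol a P N \<sigma>" and Q: "diff_op a Q" "has_symbol a Q N \<tau>"
    and eq: "\<And>s. \<sigma> s = \<tau> s"
  shows "diffop_eq a P Q"
proof (rule diffop_eqI_powers[OF a P(1) Q(1)])
  fix n z assume z: "a \<le> z"
  \<comment> \<open>Since \<open>a\<close> is positive, \<open>powr\<close> agrees with the ordinary
    power on \<open>{a..}\<close>, which is all that the operator sees.\<close>
  have "R (\<lambda>z. z ^ n) z = R (lsum (real n) [1]) z" if "diff_op a R" for R
    using a z by (intro diff_op_cong[OF a that]) (auto simp: powr_realpow)
  then show "P (\<lambda>z. z ^ n) z = Q (\<lambda>z. z ^ n) z"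
    using P Q z eq unfolding has_symbol_def by metis
qed

section \<open>The symbols of \<open>S1\<close> and \<open>S1_tilde\<close>\<close>

definition symbol_S1 :: "real \<Rightarrow> real \<Rightarrow> real \<Rightarrow> real list" where
  "symbol_S1 t1 t2 s =
    [s^4 * t1^2 - 6 * s^3 * t1^2 + 7 * s^2 * t1^2 + 6 * s * t1^2 - 8 * t1^2,
     - 2 * s^4 * t1 + 8 * s^3 * t1 - 4 * s^2 * t1 - 8 * s * t1 + 6 * t1,
     s^4 - 2 * s^3 - s^2 + 2 * s,
     - 2 * s^2 * t1^2 + 2 * s^2 * t1 * t2 + 2 * t1^2 - 2 * t1 * t2,
     4 * s^2 * t1 - 2 * s^2 * t2 + 4 * s * t1 - 2 * s * t2 - 23/3 * t1 + 13/3 * t2,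
     - 2 * s^2 - 4 * s - 2,
     t1^2 - 2 * t1 * t2 + t2^2,
     - 2 * t1 + 2 * t2,
     1]"

text \<open>Entry \<open>i\<close> belongs to the exponent \<open>s - 6 + i\<close> (to
  \<open>s - 4 + i\<close> in \<open>symbol_S1\<close>). Entry \<open>0\<close> is the indicial
  polynomial at \<open>z = 0\<close>: \<open>- t1^3 (s+1)(s-1)(s-2)(s-3)(s-4)(s-6)\<close> here, and
  \<open>t1^2 (s+1)(s-1)(s-2)(s-4)\<close> in \<open>symbol_S1\<close>.\<close>

definition symbol_S1_tilde :: "real \<Rightarrow> real \<Rightarrow> real \<Rightarrow> real list" where
  "symbol_S1_tilde t1 t2 s =
    [- (s^6 * t1^3) + 15 * s^5 * t1^3 - 79 * s^4 * t1^3 + 165 * s^3 * t1^3 - 64 * s^2 * t1^3 - 180 * s * t1^3 + 144 * t1^3,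
     3 * s^6 * t1^2 - 36 * s^5 * t1^2 + 150 * s^4 * t1^2 - 240 * s^3 * t1^2 + 27 * s^2 * t1^2 + 276 * s * t1^2 - 180 * t1^2,
     - 3 * s^6 * t1 + 27 * s^5 * t1 - 81 * s^4 * t1 + 81 * s^3 * t1 + 36 * s^2 * t1 - 108 * s * t1 + 48 * t1,
     s^6 - 6 * s^5 + 3 * s^4 * t1^3 - 3 * s^4 * t1^2 * t2 + 10 * s^4 - 12 * s^3 * t1^3 + 12 * s^3 * t1^2 * t2 + 6 * s^2 * t1^3
         - 6 * s^2 * t1^2 * t2 - 11 * s^2 + 12 * s * t1^3 - 12 * s * t1^2 * t2 + 6 * s - 9 * t1^3 + 9 * t1^2 * t2,
     - 9 * s^4 * t1^2 + 6 * s^4 * t1 * t2 + 18 * s^3 * t1^2 - 12 * s^3 * t1 * t2 + 3 * s^2 * t1^2 - 3 * s^2 * t1 * t2 - 12 * s * t1^2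
         + 9 * s * t1 * t2 + 12 * t1^2 - 6 * t1 * t2,
     9 * s^4 * t1 - 3 * s^4 * t2 + 3 * s^2 * t2 - 9 * t1,
     - 3 * s^4 - 6 * s^3 - 3 * s^2 * t1^3 + 6 * s^2 * t1^2 * t2 - 3 * s^2 * t1 * t2^2 - 9 * s^2 - 3 * s * t1^3 + 6 * s * t1^2 * t2
         - 3 * s * t1 * t2^2 - 6 * s + 6 * t1^3 - 11 * t1^2 * t2 + 7 * t1 * t2^2 + 24,
     9 * s^2 * t1^2 - 12 * s^2 * t1 * t2 + 3 * s^2 * t2^2 + 18 * s * t1^2 - 24 * s * t1 * t2 + 6 * s * t2^2 + 9 * t1^2 - 12 * t1 * t2 + 3 * t2^2,
     - 9 * s^2 * t1 + 6 * s^2 * t2 - 27 * s * t1 + 18 * s * t2 - 27 * t1 + 18 * t2,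
     3 * s^2 + 12 * s + t1^3 - 3 * t1^2 * t2 + 3 * t1 * t2^2 - t2^3 + 17,
     - 3 * t1^2 + 6 * t1 * t2 - 3 * t2^2,
     3 * t1 - 3 * t2,
     - 1]"

lemmas list_eval = lapply.simps ladd.simps lmult.simps lderiv.simps lderiv_iter.simps list.map append.simps

text \<open>Entry \<open>k\<close> lists the coefficients of \<open>a\<^sub>k(z) (z - t\<^sub>1)\<^sup>k\<close>.\<close>

definition coeffs_S1 :: "real \<Rightarrow> real \<Rightarrow> real list list" where
  "coeffs_S1 t1 t2 =
   [[0, 0, 1/3 * t1 + 1/3 * t2, - 8, t1^2 - 2 * t1 * t2 + t2^2, - 2 * t1 + 2 * t2, 1],
    [- 6 * t1^2, 6 * t1, 0, - 2 * t1^2 + 2 * t1 * t2, 4 * t1 - 2 * t2, - 2],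
    [0, 0, t1^2, - 2 * t1, 1]]"

definition coeffs_S1_tilde :: "real \<Rightarrow> real \<Rightarrow> real list list" where
  "coeffs_S1_tilde t1 t2 =
   [[12 * t1^2 - 6 * t1 * t2, 0, t1^2 * t2 + t1 * t2^2, 36 * t1^2 - 48 * t1 * t2 + 12 * t2^2, - 63 * t1 + 42 * t2, t1^3 - 3 * t1^2 * t2
       + 3 * t1 * t2^2 - t2^3 + 32, - 3 * t1^2 + 6 * t1 * t2 - 3 * t2^2, 3 * t1 - 3 * t2, - 1],
    [0, - 9 * t1^3 + 9 * t1^2 * t2, - 6 * t1^2 + 3 * t1 * t2, 45 * t1 - 12 * t2, - 3 * t1^3 + 6 * t1^2 * t2 - 3 * t1 * t2^2 - 30, 9 * t1^2
        - 12 * t1 * t2 + 3 * t2^2, - 9 * t1 + 6 * t2, 3],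
    [12 * t1^3, - 24 * t1^2, 12 * t1, 3 * t1^3 - 3 * t1^2 * t2, - 9 * t1^2 + 6 * t1 * t2, 9 * t1 - 3 * t2, - 3],
    [0, 0, - (t1^3), 3 * t1^2, - 3 * t1, 1]]"

lemma S1_has_symbol:
  assumes "t1 > 0"
  shows "has_symbol t1 (S1 t1 t2) 4 (symbol_S1 t1 t2)"
  unfolding has_symbol_def
proof (intro allI impI)
  fix s z assume z: "t1 \<le> z"
  let ?L = "(\<lambda>k. lderiv_iter k (s - 1 - real k) (lmult (coeffs_S1 t1 t2 ! k) (lderiv_iter k (s - 1) [1])))"
  \<comment> \<open>Summand \<open>k\<close> starts at exponent \<open>s - 2 - 2 * k\<close>, so
    \<open>4\<close>, \<open>2\<close> and \<open>0\<close> leading zeros align all three at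
    \<open>s - 6\<close>. The two extra zeros on the right come from the factor \<open>z^2\<close>
    in \<open>a_2\<close>.\<close>
  have *: "ladd (ladd ([0, 0, 0, 0] @ ?L 0) ([0, 0] @ ?L (Suc 0))) (?L (Suc (Suc 0))) = [0, 0] @ symbol_S1 t1 t2 s"
    unfolding coeffs_S1_def symbol_S1_def
    by (simp only: list_eval nth_Cons_0 nth_Cons_Suc of_nat_Suc of_nat_0 list.inject, (intro conjI refl; algebra))
  have "S1 t1 t2 (lsum s [1]) z = (\<Sum>k<3. lsum (s - 2 - 2 * real k) (?L k) z)"
    unfolding S1_def
    by (subst sandwich_op_powr[OF assms z, where Cs = "coeffs_S1 t1 t2"])
     (simp add: coeffs_S1_def, auto simp: coeffs_S1_def less_Suc_eq numeral_eq_Suc field_simps)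
  also have "\<dots> = lsum (s - 6) (ladd (ladd ([0, 0, 0, 0] @ ?L 0) ([0, 0] @ ?L (Suc 0))) (?L (Suc (Suc 0)))) z"
    unfolding lsum_ladd by (simp add: lessThan_Suc eval_nat_numeral)
  finally show "S1 t1 t2 (lsum s [1]) z = lsum (s - 4) (symbol_S1 t1 t2 s) z"
    unfolding * by simp
qed

lemma S1_tilde_has_symbol:
  assumes "t1 > 0"
  shows "has_symbol t1 (S1_tilde t1 t2) 6 (symbol_S1_tilde t1 t2)"
  unfolding has_symbol_def
proof (intro allI impI)
  fix s z assume z: "t1 \<le> z"
  let ?L = "(\<lambda>k. lderiv_iter k (s - 1 - real k) (lmult (coeffs_S1_tilde t1 t2 ! k) (lderiv_iter k (s - 1) [1])))"
  \<comment> \<open>The same alignment for four summands, now at \<open>s - 8\<close>.\<close>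
  have *: "ladd (ladd (ladd ([0, 0, 0, 0, 0, 0] @ ?L 0) ([0, 0, 0, 0] @ ?L (Suc 0))) ([0,
      0] @ ?L (Suc (Suc 0)))) (?L (Suc (Suc (Suc 0)))) = [0, 0] @ symbol_S1_tilde t1 t2 s"
    unfolding coeffs_S1_tilde_def symbol_S1_tilde_def
    by (simp only: list_eval nth_Cons_0 nth_Cons_Suc of_nat_Suc of_nat_0 list.inject, (intro conjI refl; algebra))
  have "S1_tilde t1 t2 (lsum s [1]) z = (\<Sum>k<4. lsum (s - 2 - 2 * real k) (?L k) z)"
    unfolding S1_tilde_def
    by (subst sandwich_op_powr[OF assms z, where Cs = "coeffs_S1_tilde t1 t2"])
     (simp add: coeffs_S1_tilde_def, auto simp: coeffs_S1_tilde_def less_Suc_eq numeral_eq_Suc field_simps)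
  also have "\<dots> = lsum (s - 8) (ladd (ladd (ladd ([0, 0, 0, 0, 0, 0] @ ?L 0) ([0, 0, 0, 0] @ ?L (Suc 0))) ([0,
      0] @ ?L (Suc (Suc 0)))) (?L (Suc (Suc (Suc 0))))) z"
    unfolding lsum_ladd by (simp add: lessThan_Suc eval_nat_numeral)
  finally show "S1_tilde t1 t2 (lsum s [1]) z = lsum (s - 6) (symbol_S1_tilde t1 t2 s) z"
    unfolding * by simp
qed

text \<open>The symbol of the square of the shifted \<open>S1\<close>, written out so that the cube
  needs only one more \<open>lapply\<close> to an explicit list; this limits the size of the
  polynomial identities in the curve relation.\<close>

definition symbol_S1_shift_sq :: "real \<Rightarrow> real \<Rightarrow> real \<Rightarrow> real list" where
  "symbol_S1_shift_sq t1 t2 s =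
    [s^8 * t1^4 - 28 * s^7 * t1^4 + 314 * s^6 * t1^4 - 1792 * s^5 * t1^4 + 5369 * s^4 * t1^4 - 7252 * s^3 * t1^4 + 76 * s^2 * t1^4
        + 9072 * s * t1^4 - 5760 * t1^4,
     - 4 * s^8 * t1^3 + 96 * s^7 * t1^3 - 924 * s^6 * t1^3 + 4536 * s^5 * t1^3 - 11676 * s^4 * t1^3 + 13104 * s^3 * t1^3
         + 2524 * s^2 * t1^3 - 17736 * s * t1^3 + 10080 * t1^3,
     6 * s^8 * t1^2 - 120 * s^7 * t1^2 + 960 * s^6 * t1^2 - 3900 * s^5 * t1^2 + 8178 * s^4 * t1^2 - 6780 * s^3 * t1^2 - 3960 * s^2 * t1^2
         + 10800 * s * t1^2 - 5184 * t1^2,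
     - 4 * s^8 * t1 + 64 * s^7 * t1 - 4 * s^6 * t1^4 + 4 * s^6 * t1^3 * t2 - 404 * s^6 * t1 + 48 * s^5 * t1^4 - 48 * s^5 * t1^3 * t2
         + 1264 * s^5 * t1 - 200 * s^4 * t1^4 + 200 * s^4 * t1^3 * t2 - 1916 * s^4 * t1 + 320 * s^3 * t1^4 - 320 * s^3 * t1^3 * t2
         + 736 * s^3 * t1 - 36 * s^2 * t1^4 + 36 * s^2 * t1^3 * t2 + 1604 * s^2 * t1 - 368 * s * t1^4 + 368 * s * t1^3 * t2 - 2064 * s * t1
         + 240 * t1^4 - 240 * t1^3 * t2 + 720 * t1,
     s^8 - 12 * s^7 + 16 * s^6 * t1^3 - 12 * s^6 * t1^2 * t2 + 54 * s^6 - 144 * s^5 * t1^3 + 108 * s^5 * t1^2 * t2 - 108 * s^5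
         + 1370/3 * s^4 * t1^3 - 1006/3 * s^4 * t1^2 * t2 + 69 * s^4 - 580 * s^3 * t1^3 + 392 * s^3 * t1^2 * t2 + 72 * s^3
         - 58/3 * s^2 * t1^3 + 194/3 * s^2 * t1^2 * t2 - 124 * s^2 + 724 * s * t1^3 - 500 * s * t1^2 * t2 + 48 * s - 1360/3 * t1^3
         + 848/3 * t1^2 * t2,
     - 24 * s^6 * t1^2 + 12 * s^6 * t1 * t2 + 144 * s^5 * t1^2 - 72 * s^5 * t1 * t2 - 988/3 * s^4 * t1^2 + 428/3 * s^4 * t1 * t2
         + 1072/3 * s^3 * t1^2 - 272/3 * s^3 * t1 * t2 + 256/3 * s^2 * t1^2 - 260/3 * s^2 * t1 * t2 - 1504/3 * s * t1^2
         + 488/3 * s * t1 * t2 + 268 * t1^2 - 68 * t1 * t2,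
     16 * s^6 * t1 - 4 * s^6 * t2 - 48 * s^5 * t1 + 12 * s^5 * t2 + 6 * s^4 * t1^4 - 12 * s^4 * t1^3 * t2 + 6 * s^4 * t1^2 * t2^2
         + 266/3 * s^4 * t1 - 22/3 * s^4 * t2 - 12 * s^3 * t1^4 + 24 * s^3 * t1^3 * t2 - 12 * s^3 * t1^2 * t2^2 - 292/3 * s^3 * t1
         - 16/3 * s^3 * t2 - 2 * s^2 * t1^4 + 4 * s^2 * t1^3 * t2 - 2 * s^2 * t1^2 * t2^2 - 242/3 * s^2 * t1 + 34/3 * s^2 * t2
         + 8 * s * t1^4 - 16 * s * t1^3 * t2 + 8 * s * t1^2 * t2^2 + 364/3 * s * t1 - 20/3 * s * t2 - 8 * t1^4 + 16 * t1^3 * t2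
         - 8 * t1^2 * t2^2 - 48 * t1,
     - 4 * s^6 - 24 * s^4 * t1^3 + 36 * s^4 * t1^2 * t2 - 12 * s^4 * t1 * t2^2 - 16 * s^4 - 40/3 * s^2 * t1^3 + 12 * s^2 * t1^2 * t2
         + 4/3 * s^2 * t1 * t2^2 + 20 * s^2 + 112/3 * t1^3 - 48 * t1^2 * t2 + 32/3 * t1 * t2^2,
     36 * s^4 * t1^2 - 36 * s^4 * t1 * t2 + 6 * s^4 * t2^2 + 72 * s^3 * t1^2 - 72 * s^3 * t1 * t2 + 12 * s^3 * t2^2 + 464/3 * s^2 * t1^2
         - 392/3 * s^2 * t1 * t2 + 38/3 * s^2 * t2^2 + 356/3 * s * t1^2 - 284/3 * s * t1 * t2 + 20/3 * s * t2^2 - 155/9 * t1^2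
         + 98/9 * t1 * t2 + 1/9 * t2^2,
     - 24 * s^4 * t1 + 12 * s^4 * t2 - 96 * s^3 * t1 + 48 * s^3 * t2 - 4 * s^2 * t1^4 + 12 * s^2 * t1^3 * t2 - 12 * s^2 * t1^2 * t2^2
         + 4 * s^2 * t1 * t2^3 - 784/3 * s^2 * t1 + 344/3 * s^2 * t2 - 8 * s * t1^4 + 24 * s * t1^3 * t2 - 24 * s * t1^2 * t2^2
         + 8 * s * t1 * t2^3 - 992/3 * s * t1 + 400/3 * s * t2 - 4 * t1^4 + 12 * t1^3 * t2 - 12 * t1^2 * t2^2 + 4 * t1 * t2^3 - 424/3 * t1
         + 164/3 * t2,
     6 * s^4 + 36 * s^3 + 16 * s^2 * t1^3 - 36 * s^2 * t1^2 * t2 + 24 * s^2 * t1 * t2^2 - 4 * s^2 * t2^3 + 122 * s^2 + 48 * s * t1^3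
         - 108 * s * t1^2 * t2 + 72 * s * t1 * t2^2 - 12 * s * t2^3 + 204 * s + 146/3 * t1^3 - 326/3 * t1^2 * t2 + 214/3 * t1 * t2^2
         - 34/3 * t2^3 + 136,
     - 24 * s^2 * t1^2 + 36 * s^2 * t1 * t2 - 12 * s^2 * t2^2 - 96 * s * t1^2 + 144 * s * t1 * t2 - 48 * s * t2^2 - 412/3 * t1^2
         + 204 * t1 * t2 - 200/3 * t2^2,
     16 * s^2 * t1 - 12 * s^2 * t2 + 80 * s * t1 - 60 * s * t2 + t1^4 - 4 * t1^3 * t2 + 6 * t1^2 * t2^2 - 4 * t1 * t2^3 + 434/3 * t1 + t2^4
         - 322/3 * t2,
     - 4 * s^2 - 24 * s - 4 * t1^3 + 12 * t1^2 * t2 - 12 * t1 * t2^2 + 4 * t2^3 - 52,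
     6 * t1^2 - 12 * t1 * t2 + 6 * t2^2,
     - 4 * t1 + 4 * t2,
     1]"

lemma has_symbol_shift:
  assumes "has_symbol a P (real n) \<sigma>"
  shows "has_symbol a (shift_op P c) (real n) (\<lambda>s. ladd (\<sigma> s) (replicate n 0 @ [c]))"
proof -
  have "has_symbol a (\<lambda>f z. c * f z) (0 + real n) (\<lambda>s. replicate n 0 @ map ((*) c) [1])"
    by (intro has_symbol_pad has_symbol_scale has_symbol_id)
  then show ?thesis
    using has_symbol_add[OF assms] by (simp add: shift_op_def[abs_def])
qed

section \<open>The commutator and the curve relation\<close>

context
  fixes t1 t2 :: real
  assumes t1: "t1 > 0"
begin

text \<open>Both products lower exponents by at most \<open>10\<close>, so their symbols are
  compared entry by entry. With the indicial polynomials \<open>p\<close> of \<open>S1\<close> and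
  \<open>q\<close> of \<open>S1_tilde\<close>, entry \<open>0\<close> asserts
  \<open>p (s - 6) * q s = q (s - 4) * p s\<close>, where both sides have the same roots; the other
  entries are further polynomial identities in \<open>s\<close>, \<open>t1\<close>,
  \<open>t2\<close>.\<close>

lemma S1_S1_tilde_commute: "diffop_eq t1 (S1 t1 t2 \<circ> S1_tilde t1 t2) (S1_tilde t1 t2 \<circ> S1 t1 t2)"
proof (rule diffop_eqI_symbol[OF t1])
  show "diff_op t1 (S1 t1 t2 \<circ> S1_tilde t1 t2)" "diff_op t1 (S1_tilde t1 t2 \<circ> S1 t1 t2)"
    by (intro diff_op.comp diff_op_S1 diff_op_S1_tilde)+
  show "has_symbol t1 (S1 t1 t2 \<circ> S1_tilde t1 t2) 10 (\<lambda>s. lapply (symbol_S1 t1 t2) (s - 6) (symbol_S1_tilde t1 t2 s))"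
    using has_symbol_comp[OF t1 diff_op_S1 diff_op_S1_tilde S1_has_symbol[OF t1] S1_tilde_has_symbol[OF t1]] by simp
  show "has_symbol t1 (S1_tilde t1 t2 \<circ> S1 t1 t2) 10 (\<lambda>s. lapply (symbol_S1_tilde t1 t2) (s - 4) (symbol_S1 t1 t2 s))"
    using has_symbol_comp[OF t1 diff_op_S1_tilde diff_op_S1 S1_tilde_has_symbol[OF t1] S1_has_symbol[OF t1]] by simp
  fix s
  show "lapply (symbol_S1 t1 t2) (s - 6) (symbol_S1_tilde t1 t2 s) = lapply (symbol_S1_tilde t1 t2) (s - 4) (symbol_S1 t1 t2 s)"
    unfolding symbol_S1_def symbol_S1_tilde_def
    by (simp only: list_eval list.inject, (intro conjI refl; algebra))
qed

abbreviation (input) "shifted_S1 \<equiv> shift_op (S1 t1 t2) (6 * t1 - 4 * t2)"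
abbreviation (input) "shifted_S1_tilde \<equiv> shift_op (S1_tilde t1 t2) (- (24 + 5 * t1^3 - 9 * t1^2 * t2 + 6 * t1 * t2^2))"

lemma symbol_shift:
  "has_symbol t1 shifted_S1 4 (\<lambda>s. ladd (symbol_S1 t1 t2 s) [0, 0, 0, 0, 6 * t1 - 4 * t2])"
  "has_symbol t1 shifted_S1_tilde 6 (\<lambda>s. ladd (symbol_S1_tilde t1 t2 s) [0, 0, 0, 0, 0, 0, - (24 + 5 * t1^3 - 9 * t1^2 * t2
      + 6 * t1 * t2^2)])"
  using has_symbol_shift[of t1 "S1 t1 t2" 4] has_symbol_shift[of t1 "S1_tilde t1 t2" 6]
    S1_has_symbol[OF t1] S1_tilde_has_symbol[OF t1] by (simp_all add: eval_nat_numeral)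

lemma symbol_S_sq: "has_symbol t1 (shifted_S1 \<circ> shifted_S1) 8 (symbol_S1_shift_sq t1 t2)"
proof -
  have "lapply (\<lambda>s. ladd (symbol_S1 t1 t2 s) [0, 0, 0, 0, 6 * t1 - 4 * t2]) (s - 4) (ladd (symbol_S1 t1 t2 s) [0, 0, 0, 0, 6 * t1 - 4 * t2])
     = symbol_S1_shift_sq t1 t2 s" for s
    unfolding symbol_S1_def symbol_S1_shift_sq_def
    by (simp only: list_eval list.inject, (intro conjI refl; algebra))
  moreover have "diff_op t1 shifted_S1" by (intro diff_op_shift diff_op_S1)
  ultimately show ?thesis
    using has_symbol_comp[OF t1 _ _ symbol_shift(1) symbol_shift(1)] by simp
qed

lemma curve_relation:
  "diffop_eq t1 (shifted_S1_tilde ^^ 2) (\<lambda>f z. (shifted_S1 ^^ 3) f z - curve_g t1 t2 * shifted_S1 f z + curve_h t1 t2 * f z)"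
proof -
  \<comment> \<open>\<open>g\<close> absorbs the minus sign, so that the right-hand side is a sum of
    three terms and \<open>has_symbol_add\<close> applies.\<close>
  define g where "g = - (1/3 * (t1^2 - t1 * t2 + t2^2))"
  define h where "h = 1/27 * ((t1 - 2 * t2) * (2 * t1 - t2) * (t1 + t2))"
  let ?\<sigma> = "\<lambda>s. ladd (symbol_S1 t1 t2 s) [0, 0, 0, 0, 6 * t1 - 4 * t2]"
  let ?\<tau> = "\<lambda>s. ladd (symbol_S1_tilde t1 t2 s) [0, 0, 0, 0, 0, 0, - (24 + 5 * t1^3 - 9 * t1^2 * t2 + 6 * t1 * t2^2)]"
  have d: "diff_op t1 shifted_S1" "diff_op t1 shifted_S1_tilde" by (intro diff_op_shift diff_op_S1 diff_op_S1_tilde)+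
  have "diffop_eq t1 (shifted_S1_tilde \<circ> shifted_S1_tilde) (\<lambda>f z. ((shifted_S1 \<circ> (shifted_S1 \<circ> shifted_S1)) f z
      + g * shifted_S1 f z) + h * f z)"
  proof (rule diffop_eqI_symbol[OF t1])
    show "diff_op t1 (shifted_S1_tilde \<circ> shifted_S1_tilde)" by (intro diff_op.comp d)
    show "diff_op t1 (\<lambda>f z. ((shifted_S1 \<circ> (shifted_S1 \<circ> shifted_S1)) f z + g * shifted_S1 f z) + h * f z)"
      by (intro diff_op.add diff_op.comp[of t1 shifted_S1] d diff_op.scale diff_op_comp[OF diff_op.scale])
    show "has_symbol t1 (shifted_S1_tilde \<circ> shifted_S1_tilde) 12 (\<lambda>s. lapply ?\<tau> (s - 6) (?\<tau> s))"
      using has_symbol_comp[OF t1 d(2,2) symbol_shift(2,2)] by simp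
    have "has_symbol t1 (shifted_S1 \<circ> (shifted_S1 \<circ> shifted_S1)) 12 (\<lambda>s. lapply ?\<sigma> (s - 8) (symbol_S1_shift_sq t1 t2 s))"
      using has_symbol_comp[OF t1 d(1) diff_op.comp[OF d(1,1)] symbol_shift(1) symbol_S_sq] by simp
    \<comment> \<open>The drop is \<open>4\<close> for \<open>shifted_S1\<close> and
      \<open>0\<close> for the scalar \<open>h\<close>; \<open>8\<close> and \<open>12\<close>
      leading zeros raise both to the drop \<open>12\<close> of the cube.\<close>
    moreover have "has_symbol t1 (\<lambda>f z. g * shifted_S1 f z) 12 (\<lambda>s. [0,0,0,0,0,0,0,0] @ map ((*) g) (?\<sigma> s))"
      using has_symbol_pad[OF has_symbol_scale[OF symbol_shift(1)], where n = 8] by (simp add: eval_nat_numeral)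
    moreover have "has_symbol t1 (\<lambda>f z. h * f z) 12 (\<lambda>s. [0,0,0,0,0,0,0,0,0,0,0,0] @ [h])"
      using has_symbol_pad[OF has_symbol_scale[OF has_symbol_id], where n = 12] by (simp add: eval_nat_numeral)
    ultimately show "has_symbol t1 (\<lambda>f z. ((shifted_S1 \<circ> (shifted_S1 \<circ> shifted_S1)) f z + g * shifted_S1 f z) + h * f z) 12
      (\<lambda>s. ladd (ladd (lapply ?\<sigma> (s - 8) (symbol_S1_shift_sq t1 t2 s)) ([0,0,0,0,0,0,0,0] @ map ((*) g) (?\<sigma> s)))
         ([0,0,0,0,0,0,0,0,0,0,0,0] @ [h]))"
      by (intro has_symbol_add)
    fix s
    show "lapply ?\<tau> (s - 6) (?\<tau> s) =
      ladd (ladd (lapply ?\<sigma> (s - 8) (symbol_S1_shift_sq t1 t2 s)) ([0,0,0,0,0,0,0,0] @ map ((*) g) (?\<sigma> s)))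
         ([0,0,0,0,0,0,0,0,0,0,0,0] @ [h])"
      unfolding symbol_S1_def symbol_S1_tilde_def symbol_S1_shift_sq_def g_def h_def
      by (simp only: list_eval list.inject, (intro conjI refl; algebra))
  qed
  moreover have "curve_g t1 t2 = - g" "curve_h t1 t2 = h"
    by (simp_all add: curve_g_def curve_h_def g_def h_def)
  ultimately show ?thesis
    by (simp add: numeral_3_eq_3 numeral_2_eq_2 o_def)
qed

end

section \<open>Integrals over a half-line\<close>

lemma set_integrable_exp_minus: "set_integrable lborel {a..} (\<lambda>w::real. exp (- w))"
proof -
  have "(\<lambda>w::real. exp (- w)) absolutely_integrable_on {a..}"
    using integrable_on_exp_minus_to_infinity[of 1 a] by (intro nonnegative_absolutely_integrable_1) auto
  then show ?thesis
    by (simp add: set_integrable_def absolutely_integrable_on_def integrable_completion)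
qed

lemma borel_measurable_indicator_atLeast:
  fixes f :: "real \<Rightarrow> real"
  assumes "continuous_on {a..} f"
  shows "(\<lambda>w. indicator {a..} w *\<^sub>R f w) \<in> borel_measurable lborel"
  using borel_measurable_continuous_on_indicator[OF _ assms] by simp

lemma set_integrable_exp_bound:
  fixes f :: "real \<Rightarrow> real"
  assumes "continuous_on {a..} f" "\<And>w. w \<ge> a \<Longrightarrow> \<bar>f w\<bar> \<le> C * exp (- w)"
  shows "set_integrable lborel {a..} f"
proof (rule set_integrable_bound)
  show "set_integrable lborel {a..} (\<lambda>w. C * exp (- w))"
    by (intro set_integrable_mult_right set_integrable_exp_minus)
  show "set_borel_measurable lborel {a..} f"
    unfolding set_borel_measurable_def by (intro borel_measurable_indicator_atLeast assms)
  show "AE w in lborel. w \<in> {a..} \<longrightarrow> norm (f w) \<le> norm (C * exp (- w))"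
    using assms(2) by (intro AE_I2) (auto intro: order.trans[OF _ abs_ge_self])
qed

lemma set_integral_exp_bound:
  fixes f :: "real \<Rightarrow> real"
  assumes "continuous_on {a..} f" "\<And>w. w \<ge> a \<Longrightarrow> \<bar>f w\<bar> \<le> C * exp (- w)"
  shows "\<bar>LBINT w:{a..}. f w\<bar> \<le> C * (LBINT w:{a..}. exp (- w))"
proof -
  have "norm (LBINT w:{a..}. f w) \<le> (LBINT w:{a..}. norm (f w))"
    by (intro set_integral_norm_bound set_integrable_exp_bound[OF assms])
  also have "\<dots> \<le> (LBINT w:{a..}. C * exp (- w))"
    using assms by (intro set_integral_mono set_integrable_norm set_integrable_exp_bound[OF assms] 
      set_integrable_mult_right set_integrable_exp_minus) auto
  finally show ?thesis by simp
qed

text \<open>Dominated convergence for the difference quotients along a sequence: by the mean value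
  inequality they obey the same majorant as \<open>f'\<close>.\<close>

lemma has_real_derivative_set_integral:
  fixes f f' :: "real \<Rightarrow> real \<Rightarrow> real"
  assumes \<delta>: "\<delta> > 0"
    and f: "\<And>x. \<bar>x - x0\<bar> < \<delta> \<Longrightarrow> set_integrable lborel {a..} (f x)"
    and f': "\<And>x w. \<bar>x - x0\<bar> < \<delta> \<Longrightarrow> w \<ge> a \<Longrightarrow>
        ((\<lambda>x. f x w) has_real_derivative f' x w) (at x)"
    and cont: "continuous_on {a..} (f' x0)"
    and bound: "\<And>x w. \<bar>x - x0\<bar> < \<delta> \<Longrightarrow> w \<ge> a \<Longrightarrow> \<bar>f' x w\<bar> \<le> C * exp (- w)"
  shows "((\<lambda>x. LBINT w:{a..}. f x w) has_real_derivative (LBINT w:{a..}. f' x0 w)) (at x0)"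
  unfolding has_field_derivative_iff tendsto_at_iff_sequentially
proof (intro allI impI)
  fix X :: "nat \<Rightarrow> real"
  assume X: "\<forall>i. X i \<in> UNIV - {x0}" "X \<longlonglongrightarrow> x0"
  then have "eventually (\<lambda>i. dist (X i) x0 < \<delta>) sequentially"
    using \<delta> by (auto simp: tendsto_iff)
  then obtain N where N: "\<And>i. i \<ge> N \<Longrightarrow> \<bar>X i - x0\<bar> < \<delta>"
    by (auto simp: eventually_sequentially dist_real_def)
  \<comment> \<open>The shift by \<open>N\<close> places every quotient inside the neighbourhood
    where the majorant holds; \<open>LIMSEQ_offset\<close> removes it at the end.\<close>
  define q where "q = (\<lambda>i w. (f (X (i + N)) w - f x0 w) / (X (i + N) - x0))"
  have X0: "X i \<noteq> x0" for i using X by auto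
  have fX: "set_integrable lborel {a..} (f (X (i + N)))" "set_integrable lborel {a..} (f x0)" for i
    using N[of "i + N"] \<delta> f[of x0] f[of "X (i + N)"] by simp_all
  have qi: "set_integrable lborel {a..} (q i)" for i
    unfolding q_def by (rule set_integrable_divide, rule set_integral_diff(1), rule fX, rule fX)
  have qb: "\<bar>q i w\<bar> \<le> C * exp (- w)" if w: "w \<ge> a" for i w
  proof -
    let ?y = "X (i + N)"
    have "norm (f ?y w - f x0 w) \<le> C * exp (- w) * norm (?y - x0)"
    proof (rule field_differentiable_bound[where S = "ball x0 \<delta>" and f = "\<lambda>x. f x w" and f' = "\<lambda>x. f' x w"])
      fix x assume "x \<in> ball x0 \<delta>"
      then have x: "\<bar>x - x0\<bar> < \<delta>" by (simp add: dist_real_def abs_minus_commute)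
      show "((\<lambda>x. f x w) has_field_derivative f' x w) (at x within ball x0 \<delta>)"
        by (rule has_field_derivative_at_within, rule f'[OF x w])
      show "norm (f' x w) \<le> C * exp (- w)"
        using bound[OF x w] by simp
    next
      show "?y \<in> ball x0 \<delta>" using N[of "i + N"] by (simp add: dist_real_def abs_minus_commute)
    qed (use \<delta> in auto)
    moreover have "?y - x0 \<noteq> 0" using X0[of "i + N"] by simp
    ultimately have "norm (f ?y w - f x0 w) / norm (?y - x0) \<le> C * exp (- w)"
      by (subst pos_divide_le_eq) auto
    then show ?thesis unfolding q_def by simp
  qed
  have "(\<lambda>i. LBINT w. indicator {a..} w *\<^sub>R q i w) \<longlonglongrightarrow> (LBINT w. indicator {a..} w *\<^sub>R f' x0 w)"
  proof (rule integral_dominated_convergence[where w = "\<lambda>w. indicator {a..} w *\<^sub>R (C * exp (- w))"])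
    show "(\<lambda>w. indicator {a..} w *\<^sub>R f' x0 w) \<in> borel_measurable lborel"
      by (intro borel_measurable_indicator_atLeast cont)
    show "(\<lambda>w. indicator {a..} w *\<^sub>R q i w) \<in> borel_measurable lborel" for i
      using qi[of i] unfolding set_integrable_def by auto
    show "integrable lborel (\<lambda>w. indicator {a..} w *\<^sub>R (C * exp (- w)))"
      using set_integrable_mult_right[OF set_integrable_exp_minus, of a C] unfolding set_integrable_def by simp
    show "AE w in lborel. norm (indicator {a..} w *\<^sub>R q i w) \<le> indicator {a..} w *\<^sub>R (C * exp (- w))" for i
      using qb[of _ i] by (intro AE_I2) (auto simp: indicator_def)
    show "AE w in lborel. (\<lambda>i. indicator {a..} w *\<^sub>R q i w) \<longlonglongrightarrow> indicator {a..} w *\<^sub>R f' x0 w"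
    proof (intro AE_I2)
      fix w
      show "(\<lambda>i. indicator {a..} w *\<^sub>R q i w) \<longlonglongrightarrow> indicator {a..} w *\<^sub>R f' x0 w"
      proof (cases "w \<ge> a")
        case True
        have "((\<lambda>y. (f y w - f x0 w) / (y - x0)) \<longlongrightarrow> f' x0 w) (at x0)"
          using f'[of x0 w] \<delta> True by (simp add: has_field_derivative_iff)
        moreover have "(\<lambda>i. X (i + N)) \<longlonglongrightarrow> x0" using X(2) by (rule LIMSEQ_ignore_initial_segment)
        ultimately have "(\<lambda>i. q i w) \<longlonglongrightarrow> f' x0 w"
          unfolding q_def tendsto_at_iff_sequentially using X0 by (auto simp: o_def)
        with True show ?thesis by simp
      qed simp
    qed
  qed
  moreover have "(LBINT w. indicator {a..} w *\<^sub>R q i w) =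
     ((LBINT w:{a..}. f (X (i + N)) w) - (LBINT w:{a..}. f x0 w)) / (X (i + N) - x0)" for i
  proof -
    have "(LBINT w. indicator {a..} w *\<^sub>R q i w) = (LBINT w:{a..}. (f (X (i + N)) w - f x0 w) / (X (i + N) - x0))"
      by (simp add: set_lebesgue_integral_def q_def)
    also have "\<dots> = (LBINT w:{a..}. f (X (i + N)) w - f x0 w) / (X (i + N) - x0)" by simp
    also have "(LBINT w:{a..}. f (X (i + N)) w - f x0 w) = (LBINT w:{a..}. f (X (i + N)) w) - (LBINT w:{a..}. f x0 w)"
      by (rule set_integral_diff(2), rule fX, rule fX)
    finally show ?thesis .
  qed
  ultimately have "(\<lambda>i. ((\<lambda>y. ((LBINT w:{a..}. f y w) - (LBINT w:{a..}. f x0 w)) / (y - x0)) \<circ> X) (i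
      + N)) \<longlonglongrightarrow> (LBINT w:{a..}. f' x0 w)"
    by (simp add: set_lebesgue_integral_def o_def)
  then show "((\<lambda>y. ((LBINT w:{a..}. f y w) - (LBINT w:{a..}. f x0 w)) / (y
      - x0)) \<circ> X) \<longlonglongrightarrow> (LBINT w:{a..}. f' x0 w)"
    by (rule LIMSEQ_offset)
qed

lemma integral_FTC_atLeast:
  fixes G g :: "real \<Rightarrow> real"
  assumes G: "\<And>x. x \<ge> a \<Longrightarrow> (G has_real_derivative g x) (at x within {a..})"
    and g: "continuous_on {a..} g" "set_integrable lborel {a..} g"
    and lim: "(G \<longlongrightarrow> 0) at_top"
  shows "(LBINT x:{a..}. g x) = - G a"
proof (rule tendsto_unique[of "at_top :: real filter"])
  show "((\<lambda>b. LBINT x:{a..b}. g x) \<longlongrightarrow> (LBINT x:{a..}. g x)) at_top"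
    by (rule tendsto_set_lebesgue_integral_at_top) (use g in auto)
  have "((\<lambda>b. G b - G a) \<longlongrightarrow> 0 - G a) at_top"
    by (intro tendsto_intros lim)
  moreover have "eventually (\<lambda>b. G b - G a = (LBINT x:{a..b}. g x)) at_top"
    using eventually_ge_at_top[of a]
  proof eventually_elim
    case (elim b)
    have "(G has_vector_derivative g x) (at x within {a..b})" if "a \<le> x" "x \<le> b" for x
      using has_field_derivative_subset[OF G[OF that(1)], of "{a..b}"]
      by (auto simp: has_real_derivative_iff_has_vector_derivative)
    moreover have "continuous_on {a..b} g" by (rule continuous_on_subset[OF g(1)]) auto
    ultimately show ?case
      unfolding set_lebesgue_integral_def using integral_FTC_atLeastAtMost[OF elim, of G g] by auto
  qed
  ultimately show "((\<lambda>b. LBINT x:{a..b}. g x) \<longlongrightarrow> - G a) at_top"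
    by (simp add: tendsto_cong)
qed simp

section \<open>The Airy function\<close>

text \<open>An entire function of \<open>u\<close> whose real part on the real axis is the integrand
  in \<open>Airy_Ai_def\<close>.\<close>

definition airy_exp :: "real \<Rightarrow> complex \<Rightarrow> complex" where
  "airy_exp y u = exp (\<i> * (u ^ 3 / 3 + of_real y * u))"

text \<open>On the line \<open>Im u = 1\<close> the Airy integrand decays like \<open>exp(-t\<^sup>2)\<close>, uniformly after any
  number of differentiations in \<open>y\<close>.\<close>

definition airy_integrand :: "nat \<Rightarrow> real \<Rightarrow> real \<Rightarrow> real" where
  "airy_integrand k y t = Re ((\<i> * (of_real t + \<i>)) ^ k * airy_exp y (of_real t + \<i>))"

text \<open>The \<open>k\<close>-th derivative of \<open>Ai\<close>: differentiation in
  \<open>y\<close> multiplies the integrand by \<open>i * u\<close> with \<open>u = t + i\<close>.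
  The identification of index \<open>0\<close> with \<open>Airy_Ai\<close> is
  \<open>Airy_Ai_eq\<close>.\<close>

definition airy_deriv :: "nat \<Rightarrow> real \<Rightarrow> real" where
  "airy_deriv k y = (LBINT t:{0..}. airy_integrand k y t) / pi"

lemma norm_airy_exp: "norm (airy_exp y (of_real t + \<i> * of_real e)) = exp (e ^ 3 / 3 - t\<^sup>2 * e - y * e)"
  by (simp add: airy_exp_def norm_exp_eq_Re power3_eq_cube power2_eq_square field_simps)

lemma airy_exp_has_derivative:
  "(airy_exp y has_field_derivative \<i> * (u\<^sup>2 + of_real y) * airy_exp y u) (at u within A)"
  unfolding airy_exp_def by (auto intro!: derivative_eq_intros simp: field_simps)

text \<open>The height \<open>1\<close> of the line produces the factor \<open>exp (- y)\<close>,
  and the decay \<open>exp (- t^2)\<close> absorbs the power of \<open>u\<close>. One constant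
  serves all real \<open>y\<close>.\<close>

lemma airy_integrand_bound:
  "\<exists>C. \<forall>y. \<forall>t\<ge>0. \<bar>airy_integrand k y t\<bar> \<le> C * exp (- y) * exp (- t)"
proof (intro exI allI impI)
  fix y t :: real assume t: "t \<ge> 0"
  have "\<bar>airy_integrand k y t\<bar> \<le> norm ((\<i> * (of_real t + \<i>)) ^ k * airy_exp y (of_real t + \<i>))"
    unfolding airy_integrand_def by (rule abs_Re_le_cmod)
  also have "\<dots> = norm (of_real t + \<i>) ^ k * exp (1 / 3 - t\<^sup>2 - y)"
    using norm_airy_exp[of y t 1] by (simp add: norm_mult norm_power)
  also have "\<dots> \<le> exp t ^ k * exp (1 / 3 - t\<^sup>2 - y)"
  proof (intro mult_right_mono power_mono)
    have "norm (of_real t + \<i>) \<le> t + 1"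
      using norm_triangle_ineq[of "of_real t" \<i>] t by simp
    also have "\<dots> \<le> exp t" using exp_ge_add_one_self[of t] by linarith
    finally show "norm (of_real t + \<i>) \<le> exp t" .
  qed auto
  also have "\<dots> = exp (real k * t + (1 / 3 - t\<^sup>2 - y))"
    by (simp add: exp_add exp_of_nat_mult)
  also have "\<dots> \<le> exp ((1 / 3 + (real k + 1)\<^sup>2 / 4) - y - t)"
  \<comment> \<open>Completing the square: \<open>(k + 1) * t - t^2\<close> is at most
    \<open>(k + 1)^2 / 4\<close>.\<close>
  proof -
    have "0 \<le> (t - (real k + 1) / 2)\<^sup>2" by simp
    then show ?thesis by (simp add: power2_eq_square field_simps)
  qed
  also have "\<dots> = exp (1 / 3 + (real k + 1)\<^sup>2 / 4) * exp (- y) * exp (- t)"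
    by (simp flip: exp_add)
  finally show "\<bar>airy_integrand k y t\<bar> \<le> exp (1 / 3 + (real k + 1)\<^sup>2 / 4) * exp (- y) * exp (- t)" .
qed

lemma continuous_on_airy_integrand: "continuous_on A (airy_integrand k y)"
  unfolding airy_integrand_def airy_exp_def by (intro continuous_intros) auto

lemma set_integrable_airy_integrand: "set_integrable lborel {0..} (airy_integrand k y)"
proof -
  obtain C where "\<forall>y. \<forall>t\<ge>0. \<bar>airy_integrand k y t\<bar> \<le> C * exp (- y) * exp (- t)"
    using airy_integrand_bound by blast
  then show ?thesis
    by (intro set_integrable_exp_bound[where C = "C * exp (- y)"] continuous_on_airy_integrand) auto
qed

lemma airy_deriv_bound: "\<exists>C\<ge>0. \<forall>y. \<bar>airy_deriv k y\<bar> \<le> C * exp (- y)"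
proof -
  obtain C where C: "\<forall>y. \<forall>t\<ge>0. \<bar>airy_integrand k y t\<bar> \<le> C * exp (- y) * exp (- t)"
    using airy_integrand_bound by blast
  define D where "D = C * (LBINT t:{0..}. exp (- t)) / pi"
  have D: "\<bar>airy_deriv k y\<bar> \<le> D * exp (- y)" for y
  proof -
    have "\<bar>LBINT t:{0..}. airy_integrand k y t\<bar> \<le> C * exp (- y) * (LBINT t:{0..}. exp (- t))"
      by (rule set_integral_exp_bound) (use C continuous_on_airy_integrand in auto)
    then show ?thesis unfolding airy_deriv_def D_def by (simp add: field_simps)
  qed
  moreover have "D \<ge> 0" using D[of 0] by simp
  ultimately show ?thesis by blast
qed

lemma airy_integrand_has_derivative:
  "((\<lambda>y. airy_integrand k y t) has_real_derivative airy_integrand (Suc k) y t) (at y)"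
proof -
  let ?u = "of_real t + \<i>"
  have "((\<lambda>z. (\<i> * ?u) ^ k * exp (\<i> * (?u ^ 3 / 3 + z * ?u))) has_field_derivative
     (\<i> * ?u) ^ Suc k * exp (\<i> * (?u ^ 3 / 3 + of_real y * ?u))) (at (of_real y))"
    by (auto intro!: derivative_eq_intros simp: field_simps)
  from bounded_linear.has_vector_derivative[OF bounded_linear_Re has_vector_derivative_real_field[OF this]]
  show ?thesis
    unfolding airy_integrand_def airy_exp_def has_real_derivative_iff_has_vector_derivative by simp
qed

lemma airy_deriv_has_derivative: "(airy_deriv k has_real_derivative airy_deriv (Suc k) y) (at y)"
proof -
  obtain C where C: "\<forall>y. \<forall>t\<ge>0. \<bar>airy_integrand (Suc k) y t\<bar> \<le> C * exp (- y) * exp (- t)"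
    using airy_integrand_bound by blast
  have C0: "C \<ge> 0" using C[rule_format, of 0 0] by simp
  have "((\<lambda>y. LBINT t:{0..}. airy_integrand k y t) has_real_derivative (LBINT t:{0..}. airy_integrand (Suc k) y t)) (at y)"
  \<comment> \<open>The constant covers the interval of radius \<open>1\<close> around
    \<open>y\<close>, where \<open>exp (- x)\<close> is at most \<open>exp (1 - y)\<close>.\<close>
  proof (rule has_real_derivative_set_integral[where \<delta> = 1 and f' = "airy_integrand (Suc k)" and C = "C * exp (1 - y)"])
    fix x t :: real assume x: "\<bar>x - y\<bar> < 1" and t: "t \<ge> 0"
    have "\<bar>airy_integrand (Suc k) x t\<bar> \<le> C * exp (- x) * exp (- t)" using C t by blast
    also have "\<dots> \<le> C * exp (1 - y) * exp (- t)"
      using x C0 by (intro mult_right_mono mult_left_mono) auto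
    finally show "\<bar>airy_integrand (Suc k) x t\<bar> \<le> C * exp (1 - y) * exp (- t)" .
  qed (auto intro: set_integrable_airy_integrand continuous_on_airy_integrand airy_integrand_has_derivative)
  from DERIV_cdivide[OF this, of pi] show ?thesis
    unfolding airy_deriv_def[abs_def] .
qed

text \<open>The Airy equation: the difference of the two integrands is the
  \<open>t\<close>-derivative of \<open>Re (i * airy_exp y u)\<close> along the line. The boundary
  term at \<open>u = i\<close> vanishes because the exponent there is the real number
  \<open>1/3 - y\<close>.\<close>

lemma airy_deriv_2: "airy_deriv 2 y = y * airy_deriv 0 y"
proof -
  define G where "G t = Re (\<i> * airy_exp y (of_real t + \<i>))" for t
  have "(LBINT t:{0..}. airy_integrand 2 y t - y * airy_integrand 0 y t) = - G 0"
  proof (rule integral_FTC_atLeast)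
    fix t :: real
    have "((\<lambda>z. \<i> * airy_exp y (z + \<i>)) has_field_derivative \<i> * (\<i> * ((of_real t + \<i>)\<^sup>2
        + of_real y) * airy_exp y (of_real t + \<i>))) (at (of_real t))"
      by (intro DERIV_cmult DERIV_shift[THEN iffD1] airy_exp_has_derivative)
    from bounded_linear.has_vector_derivative[OF bounded_linear_Re has_vector_derivative_real_field[OF this]]
    have "(G has_real_derivative Re (\<i> * (\<i> * ((of_real t + \<i>)\<^sup>2 + of_real y) * airy_exp y (of_real t + \<i>)))) (at t within {0..})"
      unfolding G_def[abs_def] has_real_derivative_iff_has_vector_derivative by blast
    moreover have "\<i> * (\<i> * ((of_real t + \<i>)\<^sup>2 + of_real y) * airy_exp y (of_real t + \<i>)) =
        (\<i> * (of_real t + \<i>)) ^ 2 * airy_exp y (of_real t + \<i>) - of_real y * airy_exp y (of_real t + \<i>)"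
      by (simp add: power2_eq_square algebra_simps)
    ultimately show "(G has_real_derivative airy_integrand 2 y t - y * airy_integrand 0 y t) (at t within {0..})"
      by (simp add: airy_integrand_def)
  next
    show "continuous_on {0..} (\<lambda>t. airy_integrand 2 y t - y * airy_integrand 0 y t)"
      by (intro continuous_intros continuous_on_airy_integrand)
    show "set_integrable lborel {0..} (\<lambda>t. airy_integrand 2 y t - y * airy_integrand 0 y t)"
      by (rule set_integral_diff(1), rule set_integrable_airy_integrand, rule set_integrable_mult_right, rule set_integrable_airy_integrand)
    have "((\<lambda>t. exp (1 / 3 - t\<^sup>2 - y)) \<longlongrightarrow> 0) at_top" by real_asymp
    then show "(G \<longlongrightarrow> 0) at_top"
    proof (rule Lim_null_comparison[rotated], intro always_eventually allI)
      fix t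
      have "\<bar>G t\<bar> \<le> norm (\<i> * airy_exp y (of_real t + \<i>))" unfolding G_def by (rule abs_Re_le_cmod)
      then show "norm (G t) \<le> exp (1 / 3 - t\<^sup>2 - y)"
        using norm_airy_exp[of y t 1] by (simp add: norm_mult)
    qed
  qed
  also have "G 0 = 0"
    by (simp add: G_def airy_exp_def power3_eq_cube Im_exp)
  also have "(LBINT t:{0..}. airy_integrand 2 y t - y * airy_integrand 0 y t) =
     (LBINT t:{0..}. airy_integrand 2 y t) - (LBINT t:{0..}. y * airy_integrand 0 y t)"
    by (rule set_integral_diff(2), rule set_integrable_airy_integrand, rule set_integrable_mult_right, rule set_integrable_airy_integrand)
  finally show ?thesis by (simp add: airy_deriv_def field_simps)
qed

lemma has_integral_atLeast_improper:
  fixes f :: "real \<Rightarrow> real"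
  assumes f: "\<And>b. b \<ge> a \<Longrightarrow> (f has_integral I b) {a..b}" and I: "(I \<longlongrightarrow> L) at_top"
  shows "(f has_integral L) {a..}"
proof -
  have "\<not> (\<exists>c d. {a..} = cbox c d)"
  proof
    assume "\<exists>c d. {a..} = cbox c d"
    then obtain c d where cd: "{a..} = cbox c d" by blast
    have "max a (d + 1) \<in> cbox c d" unfolding cd[symmetric] by simp
    then show False by simp
  qed
  moreover have "\<exists>B>0. \<forall>c d. ball 0 B \<subseteq> cbox c d \<longrightarrow>
      (\<exists>z. ((\<lambda>x. if x \<in> {a..} then f x else 0) has_integral z) (cbox c d) \<and> norm (z - L) < e)" if "e > 0" for e
  proof -
    obtain R where R: "\<And>b. b \<ge> R \<Longrightarrow> norm (I b - L) < e"
      using I \<open>e > 0\<close> by (auto simp: tendsto_iff eventually_at_top_linorder dist_norm)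
    \<comment> \<open>Every box around the ball of radius \<open>B\<close> extends on the right
      beyond both \<open>R\<close> and \<open>a\<close>, and on the left to \<open>a\<close> or
      further.\<close>
    define B where "B = 1 + max \<bar>R\<bar> \<bar>a\<bar>"
    show ?thesis
    proof (rule exI[of _ B], intro conjI allI impI)
      show "B > 0" by (simp add: B_def)
      fix c d :: real assume sub: "ball 0 B \<subseteq> cbox c d"
      have "max \<bar>R\<bar> \<bar>a\<bar> \<in> ball 0 B" "- max \<bar>R\<bar> \<bar>a\<bar> \<in> ball 0 B" by (auto simp: B_def)
      then have cd: "d \<ge> R" "d \<ge> a" "c \<le> a" using sub by fastforce+
      have "(f has_integral I d) {a..d}" by (rule f[OF cd(2)])
      then have "((\<lambda>x. if x \<in> {a..d} then f x else 0) has_integral I d) {c..d}"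
        using cd by (subst has_integral_restrict) auto
      moreover have "((\<lambda>x. if x \<in> {a..} then f x else 0) has_integral I d) {c..d} \<longleftrightarrow>
          ((\<lambda>x. if x \<in> {a..d} then f x else 0) has_integral I d) {c..d}"
        by (intro has_integral_cong) auto
      ultimately have "((\<lambda>x. if x \<in> {a..} then f x else 0) has_integral I d) (cbox c d)"
        by simp
      with R[OF cd(1)] show "\<exists>z. ((\<lambda>x. if x \<in> {a..} then f x else 0) has_integral z) (cbox c d) \<and> norm (z - L) < e"
        by blast
    qed
  qed
  ultimately show ?thesis by (subst has_integral_alt) auto
qed

text \<open>The integral over \<open>[0,R]\<close> is moved up to \<open>Im u = 1\<close> by comparing the values of a
  primitive at the corners of a rectangle: the left edge contributes an imaginary number and
  the right edge tends to \<open>0\<close>.\<close>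

lemma Airy_Ai_eq: "Airy_Ai y = airy_deriv 0 y"
proof -
  have "airy_exp y holomorphic_on UNIV"
    unfolding airy_exp_def by (intro holomorphic_intros) auto
  then obtain \<Phi> where \<Phi>: "\<And>u. (\<Phi> has_field_derivative airy_exp y u) (at u)"
    using holomorphic_convex_primitive'[of UNIV "airy_exp y"] by auto
  have horizontal: "((\<lambda>t. Re (\<Phi> (of_real t + c))) has_real_derivative Re (airy_exp y (of_real t + c))) (at t within A)" for c t A
  proof -
    have "((\<lambda>z. \<Phi> (z + c)) has_field_derivative airy_exp y (of_real t + c)) (at (of_real t))"
      by (intro DERIV_shift[THEN iffD1] \<Phi>)
    from bounded_linear.has_vector_derivative[OF bounded_linear_Re has_vector_derivative_real_field[OF this]]
    show ?thesis unfolding has_real_derivative_iff_has_vector_derivative .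
  qed
  have vertical: "((\<lambda>e. \<Phi> (c + \<i> * of_real e)) has_vector_derivative \<i> * airy_exp y (c
      + \<i> * of_real e)) (at e within A)" for c e A
  proof -
    have "((\<lambda>z. \<Phi> (c + \<i> * z)) has_field_derivative airy_exp y (c + \<i> * of_real e) * \<i>) (at (of_real e))"
      by (rule DERIV_chain2[OF \<Phi>]) (auto intro!: derivative_eq_intros)
    from has_vector_derivative_real_field[OF this] show ?thesis by (simp add: mult.commute)
  qed
  have left: "Re (\<Phi> \<i>) = Re (\<Phi> 0)"
  proof -
    have "((\<lambda>e. Re (\<Phi> (0 + \<i> * of_real e))) has_real_derivative 0) (at e)" for e
    proof -
      \<comment> \<open>At \<open>u = i * e\<close> the exponent is the real number
        \<open>e^3 / 3 - y * e\<close>, so \<open>airy_exp\<close> is real on the imaginary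
        axis.\<close>
      have "Re (\<i> * airy_exp y (0 + \<i> * of_real e)) = 0"
        by (simp add: airy_exp_def Im_exp power3_eq_cube)
      with bounded_linear.has_vector_derivative[OF bounded_linear_Re vertical[of 0 e UNIV]]
      show ?thesis unfolding has_real_derivative_iff_has_vector_derivative by simp
    qed
    from DERIV_isconst_all[of "\<lambda>e. Re (\<Phi> (0 + \<i> * of_real e))" 1 0] this show ?thesis by simp
  qed
  have right: "norm (\<Phi> (of_real R + \<i>) - \<Phi> (of_real R)) \<le> exp (1 / 3 + \<bar>y\<bar>) / R\<^sup>2" if R: "R > 0" for R
  proof -
    let ?K = "exp (1 / 3 + \<bar>y\<bar>)"
    \<comment> \<open>A primitive of the majorant \<open>?K * exp (- R^2 * e)\<close> on the right
      edge; \<open>?K\<close> bounds \<open>exp (e^3 / 3 - y * e)\<close> for \<open>e\<close>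
      between \<open>0\<close> and \<open>1\<close>.\<close>
    define \<phi> where "\<phi> e = - (?K / R\<^sup>2) * exp (- (R\<^sup>2) * e)" for e
    have "norm (\<Phi> (of_real R + \<i> * of_real 1) - \<Phi> (of_real R + \<i> * of_real 0)) \<le> \<phi> 1 - \<phi> 0"
    proof (rule differentiable_bound_general[where f = "\<lambda>e. \<Phi> (of_real R
        + \<i> * of_real e)" and \<phi>' = "\<lambda>e. ?K * exp (- (R\<^sup>2) * e)"])
      show "continuous_on {0..1} (\<lambda>e. \<Phi> (of_real R + \<i> * of_real e))"
        using vertical by (meson has_vector_derivative_continuous continuous_on_eq_continuous_within)
      show "continuous_on {0..1} \<phi>" unfolding \<phi>_def using R by (intro continuous_intros) auto
      fix e :: real assume e: "0 < e" "e < 1"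
      show "((\<lambda>e. \<Phi> (of_real R + \<i> * of_real e)) has_vector_derivative \<i> * airy_exp y (of_real R + \<i> * of_real e)) (at e)"
        by (rule vertical)
      have "(\<phi> has_real_derivative ?K * exp (- (R\<^sup>2) * e)) (at e)"
      proof -
        have "(\<phi> has_real_derivative - (?K / R\<^sup>2) * (exp (- (R\<^sup>2) * e) * - (R\<^sup>2))) (at e)"
          unfolding \<phi>_def by (intro DERIV_cmult DERIV_fun_exp DERIV_cmult_Id)
        then show ?thesis using R by simp
      qed
      then show "(\<phi> has_vector_derivative ?K * exp (- (R\<^sup>2) * e)) (at e)"
        by (simp add: has_real_derivative_iff_has_vector_derivative)
      have "e ^ 3 \<le> 1" using e by (simp add: power_le_one)
      moreover have "\<bar>y * e\<bar> \<le> \<bar>y\<bar> * 1"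
        unfolding abs_mult using e by (intro mult_left_mono) auto
      ultimately have "e ^ 3 / 3 - R\<^sup>2 * e - y * e \<le> (1 / 3 + \<bar>y\<bar>) + - (R\<^sup>2) * e" by simp
      then show "norm (\<i> * airy_exp y (of_real R + \<i> * of_real e)) \<le> ?K * exp (- (R\<^sup>2) * e)"
        unfolding norm_mult norm_airy_exp exp_add[symmetric] by simp
    qed auto
    also have "\<phi> 1 - \<phi> 0 \<le> ?K / R\<^sup>2"
      unfolding \<phi>_def using R by (simp add: field_simps)
    finally show ?thesis by simp
  qed
  have "((\<lambda>b. LBINT t:{0..b}. airy_integrand 0 y t) \<longlongrightarrow> (LBINT t:{0..}. airy_integrand 0 y t)) at_top"
    by (rule tendsto_set_lebesgue_integral_at_top) (auto intro: set_integrable_airy_integrand)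
  moreover have "eventually (\<lambda>b. (LBINT t:{0..b}. airy_integrand 0 y t) = Re (\<Phi> (of_real b + \<i>)) - Re (\<Phi> \<i>)) at_top"
    using eventually_ge_at_top[of 0]
  proof eventually_elim
    case (elim b)
    have "(LBINT t:{0..b}. airy_integrand 0 y t) = Re (\<Phi> (of_real b + \<i>)) - Re (\<Phi> (of_real 0 + \<i>))"
      unfolding set_lebesgue_integral_def
    proof (rule integral_FTC_atLeastAtMost[OF elim])
      show "((\<lambda>t. Re (\<Phi> (of_real t + \<i>))) has_vector_derivative airy_integrand 0 y t) (at t within {0..b})" for t
        using horizontal[of \<i> t] by (simp add: airy_integrand_def has_real_derivative_iff_has_vector_derivative)
    qed (rule continuous_on_airy_integrand)
    then show ?case by simp
  qed
  ultimately have "((\<lambda>b. Re (\<Phi> (of_real b + \<i>)) - Re (\<Phi> \<i>)) \<longlongrightarrow>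
      (LBINT t:{0..}. airy_integrand 0 y t)) at_top"
    by (simp add: tendsto_cong)
  moreover have "((\<lambda>b. Re (\<Phi> (of_real b + \<i>)) - Re (\<Phi> (of_real b))) \<longlongrightarrow> 0) at_top"
  proof (rule Lim_null_comparison)
    show "eventually (\<lambda>b. norm (Re (\<Phi> (of_real b + \<i>)) - Re (\<Phi> (of_real b))) \<le> exp (1 / 3
        + \<bar>y\<bar>) / b\<^sup>2) at_top"
      using eventually_gt_at_top[of 0]
    proof eventually_elim
      case (elim b)
      show ?case
        using order.trans[OF abs_Re_le_cmod right[OF elim]] by simp
    qed
    show "((\<lambda>b. exp (1 / 3 + \<bar>y\<bar>) / b\<^sup>2) \<longlongrightarrow> 0) at_top" by real_asymp
  qed
  ultimately have lim: "((\<lambda>b. Re (\<Phi> (of_real b)) - Re (\<Phi> 0)) \<longlongrightarrow> (LBINT t:{0..}. airy_integrand 0 y t)) at_top"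
    using left tendsto_diff by fastforce
  have "((\<lambda>t. cos (t ^ 3 / 3 + y * t)) has_integral Re (\<Phi> (of_real b)) - Re (\<Phi> 0)) {0..b}" if "b \<ge> 0" for b
  proof -
    have "Re (airy_exp y (of_real t + 0)) = cos (t ^ 3 / 3 + y * t)" for t
      by (simp add: airy_exp_def Re_exp power3_eq_cube)
    then have "((\<lambda>t. Re (\<Phi> (of_real t))) has_real_derivative cos (t ^ 3 / 3 + y * t)) (at t within {0..b})" for t
      using horizontal[of 0 t "{0..b}"] by simp
    then show ?thesis
      using fundamental_theorem_of_calculus[OF that, of "\<lambda>t. Re (\<Phi> (of_real t))" "\<lambda>t. cos (t ^ 3 / 3 + y * t)"]
      by (simp add: has_real_derivative_iff_has_vector_derivative)
  qed
  from has_integral_atLeast_improper[OF this lim] show ?thesis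
    unfolding Airy_Ai_def airy_deriv_def by (simp add: integral_unique)
qed

lemma deriv_Airy_Ai: "deriv Airy_Ai y = airy_deriv 1 y"
proof -
  have "Airy_Ai = airy_deriv 0" by (rule ext) (rule Airy_Ai_eq)
  then show ?thesis using DERIV_imp_deriv[OF airy_deriv_has_derivative[of 0 y]] by simp
qed

section \<open>Test functions and symmetry of the operators\<close>

lemma test_function_smooth: "test_function a f \<Longrightarrow> smooth_from a f"
  by (simp add: test_function_def)

lemma test_function_lim: "test_function a f \<Longrightarrow> ((\<lambda>z. z ^ m * (Dz a ^^ n) f z) \<longlongrightarrow> 0) at_top"
  by (simp add: test_function_def)

lemma test_function_Dz:
  assumes "test_function a f" shows "test_function a (Dz a f)"
proof -
  have "(Dz a ^^ n) (Dz a f) = (Dz a ^^ Suc n) f" for n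
    by (simp only: funpow_Suc_right o_apply)
  then show ?thesis using assms smooth_from_Dz[of a f] by (simp add: test_function_def del: funpow.simps)
qed

lemma tendsto_cong_from:
  assumes "(g \<longlongrightarrow> l) at_top" "\<And>z::real. z \<ge> a \<Longrightarrow> f z = g z"
  shows "(f \<longlongrightarrow> l) at_top"
proof -
  have "eventually (\<lambda>z. f z = g z) at_top"
    using eventually_ge_at_top[of a] by eventually_elim (rule assms(2))
  then show ?thesis using assms(1) by (simp add: tendsto_cong)
qed

lemma test_function_cmult: "test_function a f \<Longrightarrow> test_function a (\<lambda>z. c * f z)"
  unfolding test_function_def
proof (elim conjE, intro conjI allI)
  assume f: "smooth_from a f" "\<forall>n m. ((\<lambda>z. z ^ m * (Dz a ^^ n) f z) \<longlongrightarrow> 0) at_top"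
  show "smooth_from a (\<lambda>z. c * f z)" by (rule smooth_from_cmult[OF f(1)])
  fix n m
  have "((\<lambda>z. c * (z ^ m * (Dz a ^^ n) f z)) \<longlongrightarrow> 0) at_top"
    using tendsto_mult_right_zero[OF f(2)[rule_format]] .
  then show "((\<lambda>z. z ^ m * (Dz a ^^ n) (\<lambda>z. c * f z) z) \<longlongrightarrow> 0) at_top"
    by (rule tendsto_cong_from[of _ _ a]) (simp add: smooth_from_cmult(2)[OF f(1)])
qed

lemma test_function_add:
  assumes f: "test_function a f" and g: "test_function a g" shows "test_function a (\<lambda>z. f z + g z)"
  unfolding test_function_def
proof (intro conjI allI)
  note fg = test_function_smooth[OF f] test_function_smooth[OF g]
  show "smooth_from a (\<lambda>z. f z + g z)" by (rule smooth_from_add[OF fg])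
  fix n m
  have "((\<lambda>z. z ^ m * (Dz a ^^ n) f z + z ^ m * (Dz a ^^ n) g z) \<longlongrightarrow> 0) at_top"
    by (intro tendsto_add_zero test_function_lim f g)
  then show "((\<lambda>z. z ^ m * (Dz a ^^ n) (\<lambda>z. f z + g z) z) \<longlongrightarrow> 0) at_top"
    by (rule tendsto_cong_from[of _ _ a]) (simp add: smooth_from_add(2)[OF fg] algebra_simps)
qed

lemma test_function_times_id:
  assumes f: "test_function a f" shows "test_function a (\<lambda>z. z * f z)"
  unfolding test_function_def
proof (intro conjI allI)
  note fs = test_function_smooth[OF f]
  show "smooth_from a (\<lambda>z. z * f z)" by (rule smooth_from_times_id[OF fs])
  fix n m
  have "((\<lambda>z. z ^ Suc m * (Dz a ^^ n) f z + real n * (z ^ m * (Dz a ^^ (n - 1)) f z)) \<longlongrightarrow> 0) at_top"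
    by (intro tendsto_add_zero tendsto_mult_right_zero test_function_lim f)
  then show "((\<lambda>z. z ^ m * (Dz a ^^ n) (\<lambda>z. z * f z) z) \<longlongrightarrow> 0) at_top"
    by (rule tendsto_cong_from[of _ _ a]) (simp add: smooth_from_times_id(2)[OF fs] algebra_simps)
qed

lemma test_function_div_id:
  assumes f: "test_function a f" and a: "a > 0" shows "test_function a (\<lambda>z. f z / z)"
  unfolding test_function_def
proof (intro conjI allI)
  note fs = test_function_smooth[OF f]
  show "smooth_from a (\<lambda>z. f z / z)" by (rule smooth_from_div_id[OF fs a])
  fix n m
  have inv: "((\<lambda>z::real. 1 / z) \<longlongrightarrow> 0) at_top" by real_asymp
  have "((\<lambda>z. z ^ m * div_id_deriv a f n z) \<longlongrightarrow> 0) at_top"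
  proof (induction n)
    case 0
    show ?case using tendsto_mult_zero[OF test_function_lim[OF f, of m 0] inv] by simp
  next
    case (Suc n)
    have "((\<lambda>z. (z ^ m * (Dz a ^^ Suc n) f z + (- real (Suc n)) * (z ^ m * div_id_deriv a f n z)) * (1 / z)) \<longlongrightarrow> 0) at_top"
      by (intro tendsto_mult_zero tendsto_add_zero tendsto_mult_right_zero test_function_lim f Suc inv)
    then show ?case by (rule tendsto_cong_from[of _ _ a]) (simp add: algebra_simps diff_divide_distrib add_divide_distrib del: funpow.simps)
  qed
  then show "((\<lambda>z. z ^ m * (Dz a ^^ n) (\<lambda>z. f z / z) z) \<longlongrightarrow> 0) at_top"
    by (rule tendsto_cong_from[of _ _ a]) (simp add: smooth_from_div_id(2)[OF fs a])
qed

lemma diff_op_test_function: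
  assumes a: "a > 0" and P: "diff_op a P" and f: "test_function a f"
  shows "test_function a (P f)"
proof -
  have "\<forall>f. test_function a f \<longrightarrow> test_function a (P f)"
    using P
  proof (induction rule: diff_op.induct)
    case (comp P Q)
    then show ?case unfolding o_apply by blast
  next
    case (add P Q)
    then show ?case by (simp add: test_function_add)
  qed (simp_all add: test_function_cmult test_function_times_id test_function_div_id test_function_Dz a)
  with f show ?thesis by (simp only:)
qed

lemma smooth_from_continuous: "smooth_from a f \<Longrightarrow> continuous_on {a..} f"
  using smooth_from_has_derivative[of a f]
  by (metis atLeast_iff continuous_on_eq_continuous_within has_field_derivative_def has_derivative_continuous)

lemma bounded_from_tendsto_zero:
  fixes f :: "real \<Rightarrow> real"
  assumes cont: "continuous_on {a..} f" and lim: "(f \<longlongrightarrow> 0) at_top"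
  shows "\<exists>B. \<forall>z\<ge>a. \<bar>f z\<bar> \<le> B"
proof -
  have "eventually (\<lambda>z. \<bar>f z\<bar> < 1) at_top"
    using lim by (auto simp: tendsto_iff dist_norm dest: spec[of _ 1])
  then obtain R where R: "\<And>z. z \<ge> R \<Longrightarrow> \<bar>f z\<bar> < 1" by (auto simp: eventually_at_top_linorder)
  have "compact (f ` {a..max a R})"
    by (intro compact_continuous_image continuous_on_subset[OF cont]) auto
  then have "bounded (f ` {a..max a R})" by (rule compact_imp_bounded)
  then obtain B where B: "\<forall>y\<in>f ` {a..max a R}. norm y \<le> B" unfolding bounded_iff by blast
  have "\<bar>f z\<bar> \<le> max 1 B" if "z \<ge> a" for z
    using R[of z] B that by (cases "z \<ge> R") (auto simp: le_max_iff_disj)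
  then show ?thesis by blast
qed

lemma test_function_continuous: "test_function a f \<Longrightarrow> continuous_on {a..} f"
  by (intro smooth_from_continuous test_function_smooth)

lemma test_function_bounded: "test_function a f \<Longrightarrow> \<exists>B. \<forall>z\<ge>a. \<bar>z ^ m * f z\<bar> \<le> B"
  using test_function_lim[of a f m 0]
  by (intro bounded_from_tendsto_zero continuous_intros test_function_continuous) auto

lemma set_integrable_test_product:
  assumes a: "a > 0" and f: "test_function a f" and g: "test_function a g"
  shows "set_integrable lborel {a..} (\<lambda>z. f z * g z)"
proof -
  \<comment> \<open>The square is chosen because \<open>z powr (- 2)\<close> is integrable on
    \<open>{a..}\<close>; the other factor only has to be bounded.\<close>
  obtain B where B: "\<forall>z\<ge>a. \<bar>z ^ 2 * f z\<bar> \<le> B" using test_function_bounded[OF f] by blast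
  obtain C where C: "\<forall>z\<ge>a. \<bar>z ^ 0 * g z\<bar> \<le> C" using test_function_bounded[OF g] by blast
  have "(\<lambda>z. z powr (- 2)) absolutely_integrable_on {a..}"
    using has_integral_powr_to_inf[of "-2" a] a by (intro nonnegative_absolutely_integrable_1) (auto simp: integrable_on_def)
  then have int: "set_integrable lborel {a..} (\<lambda>z::real. z powr (- 2))"
    by (simp add: set_integrable_def absolutely_integrable_on_def integrable_completion)
  show ?thesis
  proof (rule set_integrable_bound)
    show "set_integrable lborel {a..} (\<lambda>z. B * C * z powr (- 2))"
      by (intro set_integrable_mult_right int)
    show "set_borel_measurable lborel {a..} (\<lambda>z. f z * g z)"
      unfolding set_borel_measurable_def
      by (intro borel_measurable_indicator_atLeast continuous_intros test_function_continuous f g)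
    show "AE z in lborel. z \<in> {a..} \<longrightarrow> norm (f z * g z) \<le> norm (B * C * z powr (- 2))"
    proof (intro AE_I2 impI)
      fix z assume "z \<in> {a..}"
      then have z: "z \<ge> a" "z > 0" using a by auto
      have "\<bar>z ^ 2 * f z\<bar> * \<bar>z ^ 0 * g z\<bar> \<le> B * C"
        by (intro mult_mono) (use B C z in auto)
      then have "\<bar>f z * g z\<bar> \<le> B * C * z powr (- 2)"
        using z by (simp add: powr_minus powr_numeral abs_mult field_simps)
      then show "norm (f z * g z) \<le> norm (B * C * z powr (- 2))"
        by (simp only: real_norm_def)
    qed
  qed
qed

lemma test_function_integral_by_parts:
  assumes a: "a > 0" and f: "test_function a f" and g: "test_function a g"
  shows "(LBINT z:{a..}. Dz a f z * g z) = - (f a * g a) - (LBINT z:{a..}. f z * Dz a g z)"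
proof -
  note d = test_function_Dz[OF f] test_function_Dz[OF g]
  note i = set_integrable_test_product[OF a d(1) g] set_integrable_test_product[OF a f d(2)]
  have "(LBINT z:{a..}. Dz a f z * g z + f z * Dz a g z) = - (f a * g a)"
  proof (rule integral_FTC_atLeast)
    fix z assume z: "z \<ge> a"
    show "((\<lambda>z. f z * g z) has_real_derivative Dz a f z * g z + f z * Dz a g z) (at z within {a..})"
      by (rule derivative_eq_intros smooth_from_has_derivative test_function_smooth f g z refl)+ (simp add: algebra_simps)
  next
    show "continuous_on {a..} (\<lambda>z. Dz a f z * g z + f z * Dz a g z)"
      by (intro continuous_intros test_function_continuous f g d)
    show "set_integrable lborel {a..} (\<lambda>z. Dz a f z * g z + f z * Dz a g z)"
      by (rule set_integral_add(1), rule i, rule i)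
    show "((\<lambda>z. f z * g z) \<longlongrightarrow> 0) at_top"
      using tendsto_mult_zero[OF test_function_lim[OF f, of 0 0] test_function_lim[OF g, of 0 0]] by simp
  qed
  also have "(LBINT z:{a..}. Dz a f z * g z + f z * Dz a g z) = (LBINT z:{a..}. Dz a f z * g z) + (LBINT z:{a..}. f z * Dz a g z)"
    by (rule set_integral_add(2), rule i, rule i)
  finally show ?thesis by simp
qed

lemma test_function_Dz_iter: "test_function a f \<Longrightarrow> test_function a ((Dz a ^^ n) f)"
  by (induction n) (auto intro: test_function_Dz)

text \<open>The jet condition on \<open>f\<close> removes every boundary term at \<open>a\<close>,
  so no condition at \<open>a\<close> is imposed on \<open>g\<close>.\<close>

lemma test_function_integral_by_parts_iter:
  assumes a: "a > 0" and f: "test_function a f" 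
  shows "test_function a g \<Longrightarrow> jet_zero a k f a \<Longrightarrow>
    (LBINT z:{a..}. (Dz a ^^ k) f z * g z) = (- 1) ^ k * (LBINT z:{a..}. f z * (Dz a ^^ k) g z)"
proof (induction k arbitrary: g)
  case (Suc k)
  have "(LBINT z:{a..}. Dz a ((Dz a ^^ k) f) z * g z) = - ((Dz a ^^ k) f a * g a) - (LBINT z:{a..}. (Dz a ^^ k) f z * Dz a g z)"
    by (intro test_function_integral_by_parts a test_function_Dz_iter f Suc.prems)
  also have "(Dz a ^^ k) f a = 0" using Suc.prems(2) a by (simp add: jet_zero_def)
  also have "(LBINT z:{a..}. (Dz a ^^ k) f z * Dz a g z) = (- 1) ^ k * (LBINT z:{a..}. f z * (Dz a ^^ k) (Dz a g) z)"
    by (rule Suc.IH) (use Suc.prems a in \<open>auto intro: test_function_Dz simp: jet_zero_def\<close>)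
  finally show ?case by (simp add: funpow_Suc_right del: funpow.simps) (simp add: funpow_swap1)
qed simp

text \<open>Each factor \<open>z - a\<close> raises the order of vanishing by one: at
  \<open>z = a\<close> the Leibniz rule for \<open>z * h - a * h\<close> leaves only
  \<open>i\<close> times the derivative of \<open>h\<close> of order \<open>i - 1\<close>.\<close>

lemma jet_zero_power_mult:
  assumes "smooth_from a f"
  shows "smooth_from a (\<lambda>z. (z - a) ^ k * f z) \<and> jet_zero a k (\<lambda>z. (z - a) ^ k * f z) a"
proof (induction k)
  case 0
  then show ?case using assms by (simp add: jet_zero_def)
next
  case (Suc k)
  define h where "h = (\<lambda>z. (z - a) ^ k * f z)"
  have h: "smooth_from a h" "jet_zero a k h a" using Suc by (auto simp: h_def)
  have eq: "(\<lambda>z. (z - a) ^ Suc k * f z) = (\<lambda>z. z * h z + (- a) * h z)"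
    by (auto simp: h_def algebra_simps)
  note s = smooth_from_times_id(1)[OF h(1)] smooth_from_cmult(1)[OF h(1), of "- a"]
  have "(Dz a ^^ i) (\<lambda>z. z * h z + (- a) * h z) a = 0" if "i < Suc k" for i
    unfolding smooth_from_add(2)[OF s order.refl] smooth_from_times_id(2)[OF h(1) order.refl]
      smooth_from_cmult(2)[OF h(1) order.refl]
    using h(2) that by (cases i) (auto simp: jet_zero_def)
  then show ?case using smooth_from_add(1)[OF s] unfolding eq jet_zero_def by simp
qed

lemma sandwich_op_symmetric:
  assumes a: "a > 0" and cs: "list_all laurent cs" and f: "test_function a f" and g: "test_function a g"
  shows "(LBINT z:{a..}. sandwich_op a cs f z * g z) = (LBINT z:{a..}. f z * sandwich_op a cs g z)"
proof -
  define U where "U = (\<lambda>f u. 1 / u * f u :: real)"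
  have U: "test_function a (U f)" if "test_function a f" for f
    using test_function_div_id[OF that a] by (simp add: U_def)
  define G where "G = (\<lambda>k f y. (cs ! k) y * (y - a) ^ k * (Dz a ^^ k) (U f) y)"
  have c: "diff_op a (\<lambda>f y. (cs ! k) y * f y)" if "k < length cs" for k
    using cs that by (intro diff_op_laurent) (simp add: list_all_length)
  have G_eq: "G k f = (\<lambda>y. (y - a) ^ k * ((cs ! k) y * (Dz a ^^ k) (U f) y))" for k f
    by (auto simp: G_def mult_ac)
  have G: "test_function a (G k f)" "jet_zero a k (G k f) a" if k: "k < length cs" and f: "test_function a f" for k f
  proof -
    have "diff_op a (\<lambda>f y. (y - a) ^ k * f y)"
      by (intro diff_op_laurent laurent_power laurent_diff laurent.id laurent.const)
    then show "test_function a (G k f)" unfolding G_eq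
      by (rule diff_op_test_function[OF a]) (intro diff_op_test_function[OF a c[OF k]] test_function_Dz_iter U f)
    show "jet_zero a k (G k f) a" unfolding G_eq
      by (intro jet_zero_power_mult[THEN conjunct2] test_function_smooth diff_op_test_function[OF a c[OF k]] test_function_Dz_iter U f)
  qed
  \<comment> \<open>Only the outer \<open>k\<close> derivatives are moved. The result pairs the
    \<open>k\<close>-th derivatives of \<open>U f\<close> and \<open>U g\<close> with the weight
    \<open>c_k(z) (z - a)^k\<close>, which is visibly symmetric in \<open>f\<close> and
    \<open>g\<close>.\<close>
  have main: "(LBINT z:{a..}. sandwich_op a cs f z * g z) = (\<Sum>k<length cs. (- 1) ^ k * (LBINT z:{a..}. G k f z * (Dz a ^^ k) (U g) z))"
    if f: "test_function a f" and g: "test_function a g" for f g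
  proof -
    have "(LBINT z:{a..}. sandwich_op a cs f z * g z) = (LBINT z:{a..}. (\<Sum>k<length cs. (Dz a ^^ k) (G k f) z * U g z))"
      unfolding sandwich_op_def G_def U_def by (simp add: sum_distrib_right sum_distrib_left mult_ac)
    also have "\<dots> = (\<Sum>k<length cs. LBINT z:{a..}. (Dz a ^^ k) (G k f) z * U g z)"
      unfolding set_lebesgue_integral_def scaleR_sum_right
      by (rule Bochner_Integration.integral_sum, fold set_integrable_def)
        (intro set_integrable_test_product a test_function_Dz_iter G U f g, simp)
    also have "\<dots> = (\<Sum>k<length cs. (- 1) ^ k * (LBINT z:{a..}. G k f z * (Dz a ^^ k) (U g) z))"
      by (intro sum.cong refl test_function_integral_by_parts_iter a G f U g) auto
    finally show ?thesis .
  qed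
  have "(LBINT z:{a..}. f z * sandwich_op a cs g z) = (LBINT z:{a..}. sandwich_op a cs g z * f z)"
    by (simp add: mult.commute)
  also have "\<dots> = (LBINT z:{a..}. sandwich_op a cs f z * g z)"
    unfolding main[OF f g] main[OF g f] by (intro sum.cong refl arg_cong2[of _ _ _ _ "(*)"]) (simp add: G_def mult_ac)
  finally show ?thesis by simp
qed

section \<open>Kernels built from the Airy function\<close>

text \<open>The linear span of \<open>x^i w^(-j) Ai^(k)(x + w)\<close>. Operators act in
  \<open>x\<close>, whence real exponents there; \<open>w\<close> is a parameter that will be
  bounded below. The rule \<open>cong\<close> compares functions only for positive \<open>x\<close>,
  where the laws of \<open>powr\<close> hold.\<close>

inductive airy_kernel :: "(real \<Rightarrow> real \<Rightarrow> real) \<Rightarrow> bool" where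
  base: "airy_kernel (\<lambda>x w. x powr i * (1 / w) ^ j * airy_deriv k (x + w))"
| scale: "airy_kernel h \<Longrightarrow> airy_kernel (\<lambda>x w. c * h x w)"
| add: "airy_kernel h \<Longrightarrow> airy_kernel h' \<Longrightarrow> airy_kernel (\<lambda>x w. h x w + h' x w)"
| cong: "airy_kernel h \<Longrightarrow> (\<And>x w. x > 0 \<Longrightarrow> h' x w = h x w) \<Longrightarrow> airy_kernel h'"

lemma airy_kernel_times_powr:
  "airy_kernel h \<Longrightarrow> airy_kernel (\<lambda>x w. x powr r * h x w)"
proof (induction rule: airy_kernel.induct)
  case (base i j k)
  show ?case
    by (rule airy_kernel.cong[OF airy_kernel.base[of "r + i" j k]]) (simp add: powr_add)
next
  case (scale h c)
  show ?case by (rule airy_kernel.cong[OF airy_kernel.scale[OF scale.IH, of c]]) simp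
next
  case (add h h')
  show ?case by (rule airy_kernel.cong[OF airy_kernel.add[OF add.IH]]) (simp add: algebra_simps)
next
  case (cong h h')
  show ?case by (rule airy_kernel.cong[OF cong.IH]) (simp add: cong.hyps)
qed

lemma airy_kernel_times_id: "airy_kernel h \<Longrightarrow> airy_kernel (\<lambda>x w. x * h x w)"
  by (rule airy_kernel.cong[OF airy_kernel_times_powr[of h 1]]) auto

lemma airy_kernel_div_id: "airy_kernel h \<Longrightarrow> airy_kernel (\<lambda>x w. h x w / x)"
  by (rule airy_kernel.cong[OF airy_kernel_times_powr[of h "-1"]]) (auto simp: powr_minus_divide)

lemma airy_kernel_derivative:
  "airy_kernel h \<Longrightarrow> \<exists>h'. airy_kernel h' \<and> (\<forall>x>0. \<forall>w.
      ((\<lambda>x. h x w) has_real_derivative h' x w) (at x))"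
proof (induction rule: airy_kernel.induct)
  case (base i j k)
  show ?case
  proof (intro exI conjI allI impI)
    show "airy_kernel (\<lambda>x w. i * (x powr (i - 1) * (1 / w) ^ j * airy_deriv k (x + w)) +
       x powr i * (1 / w) ^ j * airy_deriv (Suc k) (x + w))"
      by (intro airy_kernel.add airy_kernel.scale airy_kernel.base)
    fix x w :: real assume "x > 0"
    moreover have "((\<lambda>x. airy_deriv k (x + w)) has_real_derivative airy_deriv (Suc k) (x + w)) (at x)"
      using airy_deriv_has_derivative[of k "x + w"] by (simp add: DERIV_shift)
    ultimately show "((\<lambda>x. x powr i * (1 / w) ^ j * airy_deriv k (x + w)) has_real_derivative
       i * (x powr (i - 1) * (1 / w) ^ j * airy_deriv k (x + w)) + x powr i * (1 / w) ^ j * airy_deriv (Suc k) (x + w)) (at x)"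
      by (auto intro!: derivative_eq_intros simp: algebra_simps)
  qed
next
  case (scale h c)
  then obtain h' where "airy_kernel h'" "\<forall>x>0. \<forall>w. ((\<lambda>x. h x w) has_real_derivative h' x w) (at x)" by blast
  then show ?case by (intro exI[of _ "\<lambda>x w. c * h' x w"]) (auto intro: airy_kernel.scale DERIV_cmult)
next
  case (add h g)
  then obtain h' g' where "airy_kernel h'" "\<forall>x>0. \<forall>w. ((\<lambda>x. h x w) has_real_derivative h' x w) (at x)"
    "airy_kernel g'" "\<forall>x>0. \<forall>w. ((\<lambda>x. g x w) has_real_derivative g' x w) (at x)" by blast
  then show ?case by (intro exI[of _ "\<lambda>x w. h' x w + g' x w"]) (auto intro: airy_kernel.add DERIV_add)
next
  case (cong h g)
  then obtain h' where h': "airy_kernel h'" "\<forall>x>0. \<forall>w. ((\<lambda>x. h x w) has_real_derivative h' x w) (at x)" by blast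
  have "((\<lambda>x. g x w) has_real_derivative h' x w) (at x)" if "x > 0" for x w
    by (rule has_field_derivative_transform_within_open[OF h'(2)[rule_format, OF that], of "{0<..}"])
      (use that cong.hyps in auto)
  with h'(1) show ?case by blast
qed

lemma airy_kernel_continuous:
  "airy_kernel h \<Longrightarrow> x > 0 \<Longrightarrow> continuous_on {0<..} (h x)"
proof (induction rule: airy_kernel.induct)
  case (base i j k)
  have *: "continuous_on UNIV (airy_deriv k)"
    using DERIV_isCont[OF airy_deriv_has_derivative] by (intro continuous_at_imp_continuous_on) auto
  show ?case by (intro continuous_intros continuous_on_compose2[OF *]) auto
next
  case (cong h h')
  then have "h' x = h x" by auto
  with cong show ?case by simp
qed (auto intro: continuous_intros)

text \<open>The variables are separated: \<open>exp (- w)\<close> gives integrability in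
  \<open>w\<close>, and \<open>M\<close> decays faster than any power of \<open>x\<close>.
  Continuity of \<open>M\<close> makes the majorant locally uniform in \<open>x\<close>, as needed
  to differentiate under the integral.\<close>

lemma airy_kernel_bound:
  assumes a: "a > 0"
  shows "airy_kernel h \<Longrightarrow> \<exists>M. continuous_on {0<..} M \<and> (\<forall>m. ((\<lambda>x::real. x ^ m * M x)
      \<longlongrightarrow> 0) at_top) \<and>
     (\<forall>x>0. \<forall>w\<ge>a. \<bar>h x w\<bar> \<le> M x * exp (- w))"
proof (induction rule: airy_kernel.induct)
  case (base i j k)
  obtain C where C: "C \<ge> 0" "\<And>y. \<bar>airy_deriv k y\<bar> \<le> C * exp (- y)" using airy_deriv_bound by blast
  show ?case
  proof (intro exI conjI allI impI)
    show "continuous_on {0<..} (\<lambda>x. C * (1 / a) ^ j * (x powr i * exp (- x)))"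
      by (intro continuous_intros) auto
    fix m
    have "((\<lambda>x. C * (1 / a) ^ j * (x powr (real m + i) * exp (- x))) \<longlongrightarrow> 0) at_top"
      by (intro tendsto_mult_right_zero) real_asymp
    then show "((\<lambda>x. x ^ m * (C * (1 / a) ^ j * (x powr i * exp (- x)))) \<longlongrightarrow> 0) at_top"
      by (rule tendsto_cong_from[of _ _ 1]) (simp add: powr_add powr_realpow)
  next
    fix x w :: real assume x: "x > 0" and w: "w \<ge> a"
    have "\<bar>x powr i * (1 / w) ^ j * airy_deriv k (x + w)\<bar> = x powr i * ((1 / w) ^ j * \<bar>airy_deriv k (x + w)\<bar>)"
      using a w by (simp add: abs_mult power_abs)
    also have "\<dots> \<le> x powr i * ((1 / a) ^ j * (C * exp (- (x + w))))"
      using a w C by (intro mult_left_mono mult_mono power_mono C) (auto intro: divide_left_mono)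
    finally show "\<bar>x powr i * (1 / w) ^ j * airy_deriv k (x + w)\<bar> \<le> C * (1 / a) ^ j * (x powr i * exp (- x)) * exp (- w)"
      by (simp add: exp_add exp_diff mult_ac exp_minus divide_inverse)
  qed
next
  case (scale h c)
  then obtain M where M: "continuous_on {0<..} M" "\<forall>m. ((\<lambda>x::real. x ^ m * M x) \<longlongrightarrow> 0) at_top"
     "\<forall>x>0. \<forall>w\<ge>a. \<bar>h x w\<bar> \<le> M x * exp (- w)" by blast
  show ?case
  proof (intro exI conjI allI impI)
    show "continuous_on {0<..} (\<lambda>x. \<bar>c\<bar> * M x)" by (intro continuous_intros M)
    show "((\<lambda>x. x ^ m * (\<bar>c\<bar> * M x)) \<longlongrightarrow> 0) at_top" for m
      using tendsto_mult_right_zero[OF M(2)[rule_format, of m], of "\<bar>c\<bar>"] by (simp add: mult_ac)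
    show "\<bar>c * h x w\<bar> \<le> \<bar>c\<bar> * M x * exp (- w)" if "x > 0" "w \<ge> a" for x w
      using mult_left_mono[OF M(3)[rule_format, OF that], of "\<bar>c\<bar>"] by (simp add: abs_mult mult.assoc)
  qed
next
  case (add h g)
  then obtain M N where M: "continuous_on {0<..} M" "\<forall>m. ((\<lambda>x::real. x ^ m * M x) \<longlongrightarrow> 0) at_top"
     "\<forall>x>0. \<forall>w\<ge>a. \<bar>h x w\<bar> \<le> M x * exp (- w)" and
     N: "continuous_on {0<..} N" "\<forall>m. ((\<lambda>x::real. x ^ m * N x) \<longlongrightarrow> 0) at_top"
     "\<forall>x>0. \<forall>w\<ge>a. \<bar>g x w\<bar> \<le> N x * exp (- w)" by blast
  show ?case
  proof (intro exI conjI allI impI)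
    show "continuous_on {0<..} (\<lambda>x. M x + N x)" by (intro continuous_intros M N)
    show "((\<lambda>x. x ^ m * (M x + N x)) \<longlongrightarrow> 0) at_top" for m
      using tendsto_add_zero[OF M(2)[rule_format, of m] N(2)[rule_format, of m]] by (simp add: algebra_simps)
    show "\<bar>h x w + g x w\<bar> \<le> (M x + N x) * exp (- w)" if "x > 0" "w \<ge> a" for x w
      using M(3)[rule_format, OF that] N(3)[rule_format, OF that] by (simp add: algebra_simps)
  qed
next
  case (cong h g)
  then show ?case by simp
qed

section \<open>Integral transforms of test functions\<close>

definition kernel_transform :: "(real \<Rightarrow> real \<Rightarrow> real) \<Rightarrow> real \<Rightarrow>
    (real \<Rightarrow> real) \<Rightarrow> real \<Rightarrow> real" where
  "kernel_transform h a f x = (LBINT w:{a..}. h x w * f w)"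

context
  fixes a B :: real and f :: "real \<Rightarrow> real"
  assumes a: "a > 0" and f_cont: "continuous_on {a..} f" and f_bound: "\<forall>w\<ge>a. \<bar>f w\<bar> \<le> B"
begin

lemma bound_nonneg: "B \<ge> 0" using f_bound[rule_format, of a] by simp

lemma kernel_mult_cont: "airy_kernel h \<Longrightarrow> x > 0 \<Longrightarrow> continuous_on {a..} (\<lambda>w. h x w * f w)"
  using a by (intro continuous_intros f_cont continuous_on_subset[OF airy_kernel_continuous]) auto

lemma kernel_mult_bound:
  assumes "w \<ge> a" "\<bar>h x w\<bar> \<le> M x * exp (- w)"
  shows "\<bar>h x w * f w\<bar> \<le> M x * B * exp (- w)"
proof -
  have "\<bar>h x w * f w\<bar> \<le> (M x * exp (- w)) * B"
    unfolding abs_mult using assms f_bound[rule_format, OF assms(1)] by (intro mult_mono) auto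
  then show ?thesis by (simp add: mult_ac)
qed

lemma kernel_mult_integrable:
  assumes "airy_kernel h" "x > 0"
  shows "set_integrable lborel {a..} (\<lambda>w. h x w * f w)"
proof -
  obtain M where M: "\<forall>x>0. \<forall>w\<ge>a. \<bar>h x w\<bar> \<le> M x * exp (- w)"
    using airy_kernel_bound[OF a assms(1)] by blast
  show ?thesis
    by (rule set_integrable_exp_bound[OF kernel_mult_cont[OF assms]], rule kernel_mult_bound) (use M assms(2) in auto)
qed

lemma kernel_transform_has_derivative:
  assumes h: "airy_kernel h" and h': "airy_kernel h'"
    and der: "\<And>x w. x > 0 \<Longrightarrow> ((\<lambda>x. h x w) has_real_derivative h' x w) (at x)" and x0: "x0 > 0"
  shows "(kernel_transform h a f has_real_derivative kernel_transform h' a f x0) (at x0)"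
proof -
  obtain M where M: "continuous_on {0<..} M" "\<forall>x>0. \<forall>w\<ge>a. \<bar>h' x w\<bar> \<le> M x * exp (- w)"
    using airy_kernel_bound[OF a h'] by blast
  have "isCont M x0" using M(1) x0 by (simp add: continuous_on_eq_continuous_at)
  then obtain d where d: "d > 0" "\<And>x. \<bar>x - x0\<bar> < d \<Longrightarrow> \<bar>M x - M x0\<bar> < 1"
    unfolding continuous_at_eps_delta dist_real_def by (meson zero_less_one)
  \<comment> \<open>The bound \<open>d\<close> keeps \<open>M x\<close> below
    \<open>M x0 + 1\<close>, and the bound \<open>x0\<close> keeps \<open>x\<close>
    positive.\<close>
  define \<delta> where "\<delta> = min d x0"
  have pos: "x > 0" if "\<bar>x - x0\<bar> < \<delta>" for x using that by (auto simp: \<delta>_def)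
  show ?thesis
    unfolding kernel_transform_def[abs_def]
  proof (rule has_real_derivative_set_integral[where \<delta> = \<delta> and f' = "\<lambda>x w. h' x w * f w" and C = "(M x0 + 1) * B"])
    show "\<delta> > 0" using d x0 by (simp add: \<delta>_def)
    show "set_integrable lborel {a..} (\<lambda>w. h x w * f w)" if "\<bar>x - x0\<bar> < \<delta>" for x
      by (rule kernel_mult_integrable[OF h pos[OF that]])
    show "((\<lambda>x. h x w * f w) has_real_derivative h' x w * f w) (at x)" if "\<bar>x - x0\<bar> < \<delta>" for x w
      by (intro DERIV_cmult_right der pos[OF that])
    show "continuous_on {a..} (\<lambda>w. h' x0 w * f w)" by (rule kernel_mult_cont[OF h' x0])
    fix x w assume x: "\<bar>x - x0\<bar> < \<delta>" and w: "w \<ge> a"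
    have "\<bar>h' x w * f w\<bar> \<le> M x * B * exp (- w)"
      by (rule kernel_mult_bound[OF w]) (use M(2) pos[OF x] w in auto)
    also have "\<dots> \<le> (M x0 + 1) * B * exp (- w)"
      using d(2)[of x] x bound_nonneg by (intro mult_right_mono) (auto simp: \<delta>_def)
    finally show "\<bar>h' x w * f w\<bar> \<le> (M x0 + 1) * B * exp (- w)" .
  qed
qed

lemma kernel_transform_bound:
  assumes "airy_kernel h"
  shows "((\<lambda>x. x ^ m * kernel_transform h a f x) \<longlongrightarrow> 0) at_top"
proof -
  obtain M where M: "\<forall>m. ((\<lambda>x::real. x ^ m * M x) \<longlongrightarrow> 0) at_top"
      "\<forall>x>0. \<forall>w\<ge>a. \<bar>h x w\<bar> \<le> M x * exp (- w)"
    using airy_kernel_bound[OF a assms] by blast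
  let ?c = "B * (LBINT w:{a..}. exp (- w))"
  have "\<bar>kernel_transform h a f x\<bar> \<le> M x * ?c" if "x > 0" for x
    unfolding kernel_transform_def
    using set_integral_exp_bound[OF kernel_mult_cont[OF assms that], of "M x * B"] kernel_mult_bound[of _ h x M] M(2) that
    by (simp add: mult.assoc)
  then have "\<bar>x ^ m * kernel_transform h a f x\<bar> \<le> ?c * (x ^ m * M x)" if "x > 0" for x
    using mult_left_mono[of "\<bar>kernel_transform h a f x\<bar>" "M x * ?c" "x ^ m"] that by (simp add: abs_mult mult_ac)
  then show ?thesis
    by (intro Lim_null_comparison[OF _ tendsto_mult_right_zero[OF M(1)[rule_format, of m], of ?c]]
        eventually_mono[OF eventually_gt_at_top[of 0]]) simp
qed

end

lemma airy_kernel_derivatives: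
  assumes "airy_kernel h"
  shows "\<exists>H. H 0 = h \<and> (\<forall>n. airy_kernel (H n)) \<and>
    (\<forall>n x w. x > 0 \<longrightarrow> ((\<lambda>x. H n x w) has_real_derivative H (Suc n) x w) (at x))"
proof -
  obtain d where d: "\<And>h. airy_kernel h \<Longrightarrow> airy_kernel (d h)"
    "\<And>h x w. airy_kernel h \<Longrightarrow> x > 0 \<Longrightarrow> ((\<lambda>x. h x w) has_real_derivative d h x w) (at x)"
    using airy_kernel_derivative by metis
  have "airy_kernel ((d ^^ n) h)" for n by (induction n) (use assms d in auto)
  then show ?thesis by (intro exI[of _ "\<lambda>n. (d ^^ n) h"]) (auto intro: d)
qed

text \<open>Smoothness and decay of the transform are inherited from the kernel, whose successive
  \<open>x\<close>-derivatives remain in the class \<open>airy_kernel\<close>.\<close>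

lemma kernel_transform_test_function:
  assumes a: "a > 0" and b: "b > 0" and f: "test_function a f" and h: "airy_kernel h"
  shows "test_function b (kernel_transform h a f)"
proof -
  obtain B where B: "\<forall>w\<ge>a. \<bar>f w\<bar> \<le> B"
    using test_function_bounded[OF f, of 0] by auto
  note * = a test_function_continuous[OF f] B
  obtain H where H0: "H 0 = h \<and> (\<forall>n. airy_kernel (H n)) \<and>
      (\<forall>n x w. x > 0 \<longrightarrow> ((\<lambda>x. H n x w) has_real_derivative H (Suc n) x w) (at x))"
    using airy_kernel_derivatives[OF h] by (rule exE)
  note H = H0[THEN conjunct1] H0[THEN conjunct2, THEN conjunct1, rule_format]
    H0[THEN conjunct2, THEN conjunct2, rule_format]
  have der: "(kernel_transform (H n) a f has_real_derivative kernel_transform (H (Suc n)) a f x) (at x within {b..})"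
    if "x \<ge> b" for n x
    by (rule has_field_derivative_at_within, rule kernel_transform_has_derivative[OF * H(2) H(2)]) (use b that H(3) in auto)
  show ?thesis
    unfolding test_function_def
  proof (intro conjI allI)
    show "smooth_from b (kernel_transform h a f)"
      using smooth_from_family[of b "\<lambda>n. kernel_transform (H n) a f", OF der] H(1) by simp
    fix n m
    show "((\<lambda>z. z ^ m * (Dz b ^^ n) (kernel_transform h a f) z) \<longlongrightarrow> 0) at_top"
      using kernel_transform_bound[OF * H(2), of m n]
      by (rule tendsto_cong_from[of _ _ b])
        (use Dz_iter_family[of b "\<lambda>n. kernel_transform (H n) a f", OF der] H(1) in simp)
  qed
qed

lemma airy_kernel_test_function:
  assumes b: "b > 0" and w: "w > 0" and h: "airy_kernel h"
  shows "test_function b (\<lambda>x. h x w)"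
proof -
  obtain H where H0: "H 0 = h \<and> (\<forall>n. airy_kernel (H n)) \<and>
      (\<forall>n x w. x > 0 \<longrightarrow> ((\<lambda>x. H n x w) has_real_derivative H (Suc n) x w) (at x))"
    using airy_kernel_derivatives[OF h] by (rule exE)
  note H = H0[THEN conjunct1] H0[THEN conjunct2, THEN conjunct1, rule_format]
    H0[THEN conjunct2, THEN conjunct2, rule_format]
  have der: "((\<lambda>x. H n x w) has_real_derivative H (Suc n) x w) (at x within {b..})" if "x \<ge> b" for n x
    by (rule has_field_derivative_at_within, rule H(3)) (use b that in simp)
  show ?thesis
    unfolding test_function_def
  proof (intro conjI allI)
    show "smooth_from b (\<lambda>x. h x w)"
      using smooth_from_family[of b "\<lambda>n x. H n x w", OF der] H(1) by simp
    fix n m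
    obtain M where M: "\<forall>m. ((\<lambda>x::real. x ^ m * M x) \<longlongrightarrow> 0) at_top"
        "\<forall>x>0. \<forall>v\<ge>w. \<bar>H n x v\<bar> \<le> M x * exp (- v)"
      using airy_kernel_bound[OF w H(2)] by blast
    have "\<bar>x ^ m * H n x w\<bar> \<le> exp (- w) * (x ^ m * M x)" if "x > 0" for x
      using mult_left_mono[OF M(2)[rule_format, OF that order.refl], of "x ^ m"] that by (simp add: abs_mult mult_ac)
    then have "((\<lambda>x. x ^ m * H n x w) \<longlongrightarrow> 0) at_top"
      by (intro Lim_null_comparison[OF _ tendsto_mult_right_zero[OF M(1)[rule_format, of m], of "exp (- w)"]]
          eventually_mono[OF eventually_gt_at_top[of 0]]) simp
    then show "((\<lambda>z. z ^ m * (Dz b ^^ n) (\<lambda>x. h x w) z) \<longlongrightarrow> 0) at_top"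
      by (rule tendsto_cong_from[of _ _ b])
        (use Dz_iter_family[of b "\<lambda>n x. H n x w", OF der] H(1) in simp)
  qed
qed

lemma diff_op_kernel_transform:
  assumes a: "a > 0" and b: "b > 0" and f: "test_function a f" and P: "diff_op b P" and h: "airy_kernel h" and x: "x \<ge> b"
  shows "P (kernel_transform h a f) x = (LBINT w:{a..}. P (\<lambda>x. h x w) x * f w)"
proof -
  obtain B where B: "\<forall>w\<ge>a. \<bar>f w\<bar> \<le> B"
    using test_function_bounded[OF f, of 0] by auto
  note * = a test_function_continuous[OF f] B
  \<comment> \<open>The claim is strengthened to one kernel \<open>h'\<close> that represents
    \<open>P\<close> both on the transform and on the kernel. Keeping \<open>h\<close> arbitrary
    lets the case \<open>comp\<close> feed the kernel produced by \<open>Q\<close> to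
    \<open>P\<close>.\<close>
  have "\<forall>h. airy_kernel h \<longrightarrow> (\<exists>h'. airy_kernel h' \<and> (\<forall>x\<ge>b. P
      (kernel_transform h a f) x = kernel_transform h' a f x) \<and>
     (\<forall>x\<ge>b. \<forall>w. P (\<lambda>x. h x w) x = h' x w))"
    using P
  proof (induction rule: diff_op.induct)
    case (scale c)
    show ?case
    proof (intro allI impI)
      fix h assume "airy_kernel h"
      then show "\<exists>h'. airy_kernel h' \<and> (\<forall>x\<ge>b. c * kernel_transform h a f x = kernel_transform h' a f x) \<and>
          (\<forall>x\<ge>b. \<forall>w. c * h x w = h' x w)"
        by (intro exI[of _ "\<lambda>x w. c * h x w"]) (simp add: airy_kernel.scale kernel_transform_def mult.assoc)
    qed
  next
    case times
    show ?case
    proof (intro allI impI)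
      fix h assume "airy_kernel h"
      then show "\<exists>h'. airy_kernel h' \<and> (\<forall>x\<ge>b. x * kernel_transform h a f x = kernel_transform h' a f x) \<and>
          (\<forall>x\<ge>b. \<forall>w. x * h x w = h' x w)"
        by (intro exI[of _ "\<lambda>x w. x * h x w"]) (simp add: airy_kernel_times_id kernel_transform_def mult.assoc)
    qed
  next
    case div
    show ?case
    proof (intro allI impI)
      fix h assume "airy_kernel h"
      then show "\<exists>h'. airy_kernel h' \<and> (\<forall>x\<ge>b. kernel_transform h a f x / x = kernel_transform h' a f x) \<and>
          (\<forall>x\<ge>b. \<forall>w. h x w / x = h' x w)"
        by (intro exI[of _ "\<lambda>x w. h x w / x"]) (simp add: airy_kernel_div_id kernel_transform_def)
    qed
  next
    case Dz
    show ?case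
    proof (intro allI impI)
      fix h assume h: "airy_kernel h"
      then obtain h' where h': "airy_kernel h'" "\<forall>x>0. \<forall>w. ((\<lambda>x. h x w) has_real_derivative h' x w) (at x)"
        using airy_kernel_derivative by blast
      have "Dz b (kernel_transform h a f) x = kernel_transform h' a f x" if "x \<ge> b" for x
        by (rule Dz_eqI[OF has_field_derivative_at_within that], rule kernel_transform_has_derivative[OF * h h'(1)]) (use b that h'(2) in auto)
      moreover have "Dz b (\<lambda>x. h x w) x = h' x w" if "x \<ge> b" for x w
        by (rule Dz_eqI[OF has_field_derivative_at_within that]) (use b that h'(2) in auto)
      ultimately show "\<exists>h'. airy_kernel h' \<and> (\<forall>x\<ge>b. Dz b (kernel_transform h a f) x = kernel_transform h' a f x)
          \<and> (\<forall>x\<ge>b. \<forall>w. Dz b (\<lambda>x. h x w) x = h' x w)"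
        using h'(1) by blast
    qed
  next
    case (add P Q)
    show ?case
    proof (intro allI impI)
      fix h assume h: "airy_kernel h"
      obtain p where p0: "airy_kernel p \<and> (\<forall>x\<ge>b. P (kernel_transform h a f) x = kernel_transform p a f x) \<and>
          (\<forall>x\<ge>b. \<forall>w. P (\<lambda>x. h x w) x = p x w)"
        using add.IH(1)[rule_format, OF h] by (rule exE)
      note p = p0[THEN conjunct1] p0[THEN conjunct2, THEN conjunct1] p0[THEN conjunct2, THEN conjunct2]
      obtain q where q0: "airy_kernel q \<and> (\<forall>x\<ge>b. Q (kernel_transform h a f) x = kernel_transform q a f x) \<and>
          (\<forall>x\<ge>b. \<forall>w. Q (\<lambda>x. h x w) x = q x w)"
        using add.IH(2)[rule_format, OF h] by (rule exE)
      note q = q0[THEN conjunct1] q0[THEN conjunct2, THEN conjunct1] q0[THEN conjunct2, THEN conjunct2]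
      have "kernel_transform p a f x + kernel_transform q a f x = kernel_transform (\<lambda>x w. p x w + q x w) a f x" if "x \<ge> b" for x
        using that b set_integral_add(2)[OF kernel_mult_integrable[OF * p(1), of x] kernel_mult_integrable[OF * q(1), of x]]
        by (simp add: kernel_transform_def distrib_right)
      with p q show "\<exists>h'. airy_kernel h' \<and> (\<forall>x\<ge>b. P (kernel_transform h a f) x
          + Q (kernel_transform h a f) x = kernel_transform h' a f x) \<and>
          (\<forall>x\<ge>b. \<forall>w. P (\<lambda>x. h x w) x + Q (\<lambda>x. h x w) x = h' x w)"
        by (intro exI[of _ "\<lambda>x w. p x w + q x w"]) (simp add: airy_kernel.add)
    qed
  next
    case (comp P Q)
    show ?case
    proof (intro allI impI)
      fix h assume h: "airy_kernel h"
      obtain q where q0: "airy_kernel q \<and> (\<forall>x\<ge>b. Q (kernel_transform h a f) x = kernel_transform q a f x) \<and>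
          (\<forall>x\<ge>b. \<forall>w. Q (\<lambda>x. h x w) x = q x w)"
        using comp.IH(2)[rule_format, OF h] by (rule exE)
      note q = q0[THEN conjunct1] q0[THEN conjunct2, THEN conjunct1] q0[THEN conjunct2, THEN conjunct2]
      obtain p where p0: "airy_kernel p \<and> (\<forall>x\<ge>b. P (kernel_transform q a f) x = kernel_transform p a f x) \<and>
          (\<forall>x\<ge>b. \<forall>w. P (\<lambda>x. q x w) x = p x w)"
        using comp.IH(1)[rule_format, OF q(1)] by (rule exE)
      note p = p0[THEN conjunct1] p0[THEN conjunct2, THEN conjunct1] p0[THEN conjunct2, THEN conjunct2]
      have "P (Q (kernel_transform h a f)) x = P (kernel_transform q a f) x" if "x \<ge> b" for x
        by (rule diff_op_cong[OF b comp.hyps(1) _ that]) (use q in simp)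
      moreover have "P (Q (\<lambda>x. h x w)) x = P (\<lambda>x. q x w) x" if "x \<ge> b" for x w
        by (rule diff_op_cong[OF b comp.hyps(1) _ that]) (use q in simp)
      ultimately show "\<exists>h'. airy_kernel h' \<and> (\<forall>x\<ge>b. (P \<circ> Q)
          (kernel_transform h a f) x = kernel_transform h' a f x) \<and>
          (\<forall>x\<ge>b. \<forall>w. (P \<circ> Q) (\<lambda>x. h x w) x = h' x w)"
        using p by (intro exI[of _ p]) simp
    qed
  qed
  from this[rule_format, OF h] obtain h' where "P (kernel_transform h a f) x = kernel_transform h' a f x" "\<forall>w. P
      (\<lambda>x. h x w) x = h' x w"
    using x by blast
  then show ?thesis by (simp add: kernel_transform_def)
qed

section \<open>Bispectrality\<close>

text \<open>Since \<open>Ai'' (y) = y Ai y\<close>, the functions \<open>p(z) Ai(x + z) + q(z) Ai'(x + z)\<close> with Laurent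
  polynomials \<open>p\<close>, \<open>q\<close> are closed under differentiation in \<open>z\<close>.\<close>

definition airy_pair :: "real \<Rightarrow> real \<Rightarrow> real list \<times> real list \<Rightarrow> real \<Rightarrow> real" where
  "airy_pair x k c z = lsum k (fst c) z * airy_deriv 0 (x + z) + lsum k (snd c) z * airy_deriv 1 (x + z)"

text \<open>By the Airy equation
  \<open>(p Ai + q Ai')' = (p' + (x + z) q) Ai + (q' + p) Ai'\<close>. The result starts at exponent
  \<open>k - 1\<close>, so the undifferentiated lists receive one leading zero and the list for
  \<open>z * q\<close> two.\<close>

fun pair_deriv :: "real \<Rightarrow> real \<Rightarrow> real list \<times> real list \<Rightarrow> real list \<times> real list" where
  "pair_deriv x k (ps, qs) =
     (ladd (lderiv k ps) (ladd (0 # map ((*) x) qs) (0 # 0 # qs)), ladd (lderiv k qs) (0 # ps))"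

primrec pair_deriv_iter :: "nat \<Rightarrow> real \<Rightarrow> real \<Rightarrow> real list \<times> real list \<Rightarrow> real list
    \<times> real list" where
  "pair_deriv_iter 0 x k c = c"
| "pair_deriv_iter (Suc n) x k c = pair_deriv_iter n x (k - 1) (pair_deriv x k c)"

fun pair_mult :: "real list \<Rightarrow> real list \<times> real list \<Rightarrow> real list \<times> real list" where
  "pair_mult bs (ps, qs) = (lmult bs ps, lmult bs qs)"

fun pair_add :: "real list \<times> real list \<Rightarrow> real list \<times> real list \<Rightarrow> real list \<times> real list" where
  "pair_add (ps, qs) (ps', qs') = (ladd ps ps', ladd qs qs')"

fun pair_pad :: "real list \<Rightarrow> real list \<times> real list \<Rightarrow> real list \<times> real list" where
  "pair_pad zs (ps, qs) = (zs @ ps, zs @ qs)"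

lemma airy_pair_add: "airy_pair x k (pair_add c d) z = airy_pair x k c z + airy_pair x k d z"
  by (cases c; cases d) (simp add: airy_pair_def lsum_ladd algebra_simps)

lemma airy_pair_pad: "airy_pair x k (pair_pad (0 # zs) c) z = airy_pair x (k + 1) (pair_pad zs c) z"
  "airy_pair x k (pair_pad [] c) z = airy_pair x k c z"
  by (cases c, simp add: airy_pair_def)+

lemma airy_pair_mult:
  "z > 0 \<Longrightarrow> airy_pair x k (pair_mult bs c) z = (\<Sum>i<length bs. bs ! i * z ^ i) * airy_pair x k c z"
  by (cases c) (simp add: airy_pair_def lsum_lmult algebra_simps)

lemma airy_pair_has_derivative:
  assumes "z > 0"
  shows "(airy_pair x k c has_real_derivative airy_pair x (k - 1) (pair_deriv x k c) z) (at z)"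
proof (cases c)
  case (Pair ps qs)
  have A: "((\<lambda>z. airy_deriv n (x + z)) has_real_derivative airy_deriv (Suc n) (x + z)) (at z)" for n
    using airy_deriv_has_derivative[of n "z + x", unfolded DERIV_shift] by (simp add: add.commute)
  have z: "lsum (1 + k) qs z = z * lsum k qs z"
    using lsum_mult_powr[of z 1 k qs] assms by simp
  have "(airy_pair x k c has_real_derivative
      (lsum (k - 1) (lderiv k ps) z * airy_deriv 0 (x + z) + lsum k ps z * airy_deriv (Suc 0) (x + z)) +
      (lsum (k - 1) (lderiv k qs) z * airy_deriv 1 (x + z) + lsum k qs z * airy_deriv (Suc 1) (x + z))) (at z)"
    unfolding airy_pair_def[abs_def] Pair fst_conv snd_conv
    by (rule derivative_eq_intros lsum_has_derivative[OF assms] A refl)+ simp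
  moreover have "airy_deriv (Suc 1) (x + z) = (x + z) * airy_deriv 0 (x + z)"
    using airy_deriv_2[of "x + z"] by (simp add: numeral_2_eq_2)
  ultimately show ?thesis
    by (simp add: Pair airy_pair_def lsum_ladd lsum_scale z algebra_simps)
qed

lemma Dz_iter_airy_pair:
  assumes "a > 0"
  shows "z \<ge> a \<Longrightarrow> (Dz a ^^ n) (airy_pair x k c) z = airy_pair x (k - real n) (pair_deriv_iter n x k c) z"
proof (induction n arbitrary: k c)
  case (Suc n)
  have "(Dz a ^^ Suc n) (airy_pair x k c) z = (Dz a ^^ n) (airy_pair x (k - 1) (pair_deriv x k c)) z"
    unfolding funpow_Suc_right o_apply using assms Suc.prems
    by (intro Dz_iter_cong Dz_eqI has_field_derivative_at_within[OF airy_pair_has_derivative]) auto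
  also have "\<dots> = airy_pair x (k - 1 - real n) (pair_deriv_iter n x (k - 1) (pair_deriv x k c)) z"
    by (rule Suc.IH[OF Suc.prems])
  finally show ?case by (simp add: algebra_simps)
qed simp

lemma sandwich_op_airy_pair:
  assumes "a > 0" "z \<ge> a" "length Cs = length cs"
    and C: "\<And>k y. k < length cs \<Longrightarrow> (cs ! k) y * (y - a) ^ k = (\<Sum>i<length (Cs ! k). Cs ! k ! i * y ^ i)"
  shows "sandwich_op a cs (airy_pair x s c) z =
    (\<Sum>k<length cs. airy_pair x (s - 2 - 2 * real k)
        (pair_deriv_iter k x (s - 1 - real k) (pair_mult (Cs ! k) (pair_deriv_iter k x (s - 1) c))) z)"
proof -
  have div: "1 / y * airy_pair x k d y = airy_pair x (k - 1) d y" if "y \<ge> a" for y k d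
    using lsum_mult_powr[of y "-1" k "fst d"] lsum_mult_powr[of y "-1" k "snd d"] that assms(1)
    by (simp add: airy_pair_def powr_minus_divide distrib_left mult.assoc[symmetric])
  have "(Dz a ^^ k) (\<lambda>y. (cs ! k) y * (y - a) ^ k * (Dz a ^^ k) (\<lambda>u. 1 / u * airy_pair x s c u) y) z
    = airy_pair x (s - 1 - 2 * real k) (pair_deriv_iter k x (s - 1 - real k) (pair_mult (Cs ! k) (pair_deriv_iter k x (s - 1) c))) z"
    if k: "k < length cs" for k
  proof -
    have "(Dz a ^^ k) (\<lambda>u. 1 / u * airy_pair x s c u) y = airy_pair x (s - 1 - real k) (pair_deriv_iter k x (s - 1) c) y" if "y \<ge> a" for y
    proof -
      have "(Dz a ^^ k) (\<lambda>u. 1 / u * airy_pair x s c u) y = (Dz a ^^ k) (airy_pair x (s - 1) c) y"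
        by (intro Dz_iter_cong div that)
      also have "\<dots> = airy_pair x (s - 1 - real k) (pair_deriv_iter k x (s - 1) c) y"
        by (rule Dz_iter_airy_pair[OF assms(1) that])
      finally show ?thesis .
    qed
    then have "(Dz a ^^ k) (\<lambda>y. (cs ! k) y * (y - a) ^ k * (Dz a ^^ k) (\<lambda>u. 1 / u * airy_pair x s c u) y) z
      = (Dz a ^^ k) (airy_pair x (s - 1 - real k) (pair_mult (Cs ! k) (pair_deriv_iter k x (s - 1) c))) z"
      using assms(1,2) k by (intro Dz_iter_cong) (auto simp: C airy_pair_mult)
    also have "\<dots> = airy_pair x (s - 1 - real k - real k) (pair_deriv_iter k x (s - 1
        - real k) (pair_mult (Cs ! k) (pair_deriv_iter k x (s - 1) c))) z"
      by (rule Dz_iter_airy_pair[OF assms(1,2)])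
    also have "s - 1 - real k - real k = s - 1 - 2 * real k" by simp
    finally show ?thesis .
  qed
  then have "sandwich_op a cs (airy_pair x s c) z = 
    1 / z * (\<Sum>k<length cs. airy_pair x (s - 1 - 2 * real k) (pair_deriv_iter k x (s - 1
        - real k) (pair_mult (Cs ! k) (pair_deriv_iter k x (s - 1) c))) z)"
    unfolding sandwich_op_def by (intro arg_cong2[of _ _ _ _ "(*)"] refl sum.cong) auto
  also have "\<dots> = (\<Sum>k<length cs. airy_pair x (s - 1 - 2 * real k - 1) (pair_deriv_iter k x (s - 1
      - real k) (pair_mult (Cs ! k) (pair_deriv_iter k x (s - 1) c))) z)"
    unfolding sum_distrib_left by (intro sum.cong refl div assms(2))
  finally show ?thesis by (simp add: algebra_simps)
qed

section \<open>The action of the two operators on \<open>Psi1\<close>\<close>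

lemma Psi1_eq: "Psi1 x z = airy_deriv 0 (x + z) - 1 / (x * z) * airy_deriv 1 (x + z)"
  by (simp add: Psi1_def Airy_Ai_eq deriv_Airy_Ai)

lemma Psi1_commute: "Psi1 x z = Psi1 z x"
  by (simp add: Psi1_def add.commute mult.commute)

text \<open>The factor \<open>x\<close> clears the denominator in the parameter, so that all
  coefficient lists computed from this pair are polynomial in \<open>x\<close>.\<close>

lemma Psi1_eq_airy_pair: "z > 0 \<Longrightarrow> x > 0 \<Longrightarrow> x * Psi1 x z = airy_pair x (- 1) ([0, x], [- 1]) z"
  by (simp add: Psi1_eq airy_pair_def powr_minus_divide field_simps)

lemma airy_kernel_Psi1: "airy_kernel Psi1"
proof (rule airy_kernel.cong)
  show "airy_kernel (\<lambda>x w. x powr 0 * (1 / w) ^ 0 * airy_deriv 0 (x + w) + (- 1) * (x powr (- 1) * (1 / w) ^ 1 * airy_deriv 1 (x + w)))"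
    by (intro airy_kernel.add airy_kernel.scale airy_kernel.base)
qed (simp add: Psi1_eq powr_minus_divide)

lemma test_function_Psi1:
  assumes "x > 0" "a > 0"
  shows "test_function a (Psi1 x)"
proof -
  have "Psi1 x = (\<lambda>z. Psi1 z x)" by (rule ext) (rule Psi1_commute)
  then show ?thesis using airy_kernel_test_function[OF assms(2,1) airy_kernel_Psi1] by simp
qed

lemma smooth_from_Psi1: "x > 0 \<Longrightarrow> a > 0 \<Longrightarrow> smooth_from a (Psi1 x)"
  by (intro test_function_smooth test_function_Psi1)

text \<open>The right-hand side is invariant under exchanging \<open>(z, t1)\<close> with
  \<open>(x, t2)\<close>, except for the terms with coefficients \<open>17/3\<close> and
  \<open>13/3\<close>; together these form a multiple of \<open>x * z * Psi1 x z\<close>.\<close>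

lemma S1_Psi1:
  assumes "t1 > 0" "z \<ge> t1" "x > 0"
  shows "x * z * S1 t1 t2 (Psi1 x) z =
     (z^3 * x^3 - 2 * z^3 * x^2 * t2 + z^3 * x * t2^2 - 2 * z^2 * x^3 * t1 + 2 * z^2 * x^2 * t1 * t2 + 2 * z^2 * t2 + z * x^3 * t1^2
         - 17/3 * z * x * t1 + 13/3 * z * x * t2 + 2 * x^2 * t1) * airy_deriv 0 (x + z) +
     (3 * z^2 * x^2 - 2 * z^2 * x * t2 - z^2 * t2^2 - 2 * z * x^2 * t1 - x^2 * t1^2 + 17/3 * t1 - 13/3 * t2) * airy_deriv 1 (x + z)"
proof -
  let ?L = "(\<lambda>k. pair_deriv_iter k x (- 1 - 1 - real k) (pair_mult (coeffs_S1 t1 t2 ! k) (pair_deriv_iter k x (- 1 - 1) ([0, x], [- 1]))))"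
  \<comment> \<open>The first exponent is \<open>-7\<close>. The six leading zeros record that the
    powers \<open>-7\<close> to \<open>-2\<close> of \<open>z\<close> cancel, the trailing ones that
    the two highest powers do.\<close>
  let ?c = "([0, 0, 0, 0, 0, 0, 2 * x^2 * t1, x^3 * t1^2 - 17/3 * x * t1 + 13/3 * x * t2, - 2 * x^3 * t1 + 2 * x^2 * t1 * t2 + 2 * t2, x^3
      - 2 * x^2 * t2 + x * t2^2, 0, 0],
      [0, 0, 0, 0, 0, 0, - (x^2 * t1^2) + 17/3 * t1 - 13/3 * t2, - 2 * x^2 * t1, 3 * x^2 - 2 * x * t2 - t2^2, 0, 0])"
  have *: "pair_add (pair_add (pair_pad [0, 0, 0, 0] (?L 0)) (pair_pad [0, 0] (?L (Suc 0)))) (?L (Suc (Suc 0))) = ?c"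
    unfolding coeffs_S1_def
    by (simp only: list_eval pair_deriv_iter.simps pair_deriv.simps pair_mult.simps pair_add.simps pair_pad.simps nth_Cons_0 nth_Cons_Suc
        of_nat_Suc of_nat_0 list.inject prod.inject, (intro conjI refl; algebra))
  have "x * S1 t1 t2 (Psi1 x) z = S1 t1 t2 (\<lambda>z. x * Psi1 x z) z"
    by (rule diff_op_cmult[OF assms(1) diff_op_S1 _ assms(2), symmetric]) (rule smooth_from_Psi1[OF assms(3,1)])
  also have "\<dots> = S1 t1 t2 (airy_pair x (- 1) ([0, x], [- 1])) z"
    by (rule diff_op_cong[OF assms(1) diff_op_S1 _ assms(2)]) (use assms in \<open>auto intro: Psi1_eq_airy_pair\<close>)
  also have "\<dots> = (\<Sum>k<3. airy_pair x (- 1 - 2 - 2 * real k) (?L k) z)"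
    unfolding S1_def
    by (subst sandwich_op_airy_pair[OF assms(1,2), where Cs = "coeffs_S1 t1 t2"])
     (simp add: coeffs_S1_def, auto simp: coeffs_S1_def less_Suc_eq numeral_eq_Suc field_simps)
  also have "\<dots> = airy_pair x (-7) (pair_add (pair_add (pair_pad [0, 0, 0, 0] (?L 0)) (pair_pad [0, 0] (?L (Suc 0)))) (?L (Suc (Suc 0)))) z"
    unfolding airy_pair_add by (simp add: lessThan_Suc eval_nat_numeral airy_pair_pad del: pair_pad.simps pair_mult.simps pair_deriv_iter.simps)
  finally have "x * z * S1 t1 t2 (Psi1 x) z = z * airy_pair x (-7) ?c z"
    unfolding * by simp
  also have "\<dots> = (z^3 * x^3 - 2 * z^3 * x^2 * t2 + z^3 * x * t2^2 - 2 * z^2 * x^3 * t1 + 2 * z^2 * x^2 * t1 * t2 + 2 * z^2 * t2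
      + z * x^3 * t1^2 - 17/3 * z * x * t1 + 13/3 * z * x * t2 + 2 * x^2 * t1) * airy_deriv 0 (x + z) +
     (3 * z^2 * x^2 - 2 * z^2 * x * t2 - z^2 * t2^2 - 2 * z * x^2 * t1 - x^2 * t1^2 + 17/3 * t1 - 13/3 * t2) * airy_deriv 1 (x + z)"
    using assms(1,2) by (simp add: airy_pair_def powr_minus_divide powr_numeral)
        (simp add: field_simps power2_eq_square power3_eq_cube eval_nat_numeral)
  finally show ?thesis .
qed

lemma S1_tilde_Psi1:
  assumes "t1 > 0" "z \<ge> t1" "x > 0"
  shows "x * z * S1_tilde t1 t2 (Psi1 x) z =
     (z^4 * x^4 - 3 * z^4 * x^3 * t2 + 3 * z^4 * x^2 * t2^2 - z^4 * x * t2^3 - 3 * z^3 * x^4 * t1 + 6 * z^3 * x^3 * t1 * t2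
         - 3 * z^3 * x^2 * t1 * t2^2 + 12 * z^3 * x^2 - 6 * z^3 * x * t2 - 6 * z^3 * t2^2 + 3 * z^2 * x^4 * t1^2
         - 3 * z^2 * x^3 * t1^2 * t2 + 12 * z^2 * x^3 - 12 * z^2 * x^2 * t1 - 12 * z^2 * x^2 * t2 + 3 * z^2 * x * t1 * t2
         + 3 * z^2 * t1 * t2^2 - z * x^4 * t1^3 - 6 * z * x^3 * t1 + 3 * z * x^2 * t1 * t2 + 5 * z * x * t1^3 - 8 * z * x * t1^2 * t2
         + 7 * z * x * t1 * t2^2 + 24 * z * x - 6 * x^3 * t1^2 + 3 * x^2 * t1^2 * t2 + 3 * t1 * t2) * airy_deriv 0 (x + z) +
     (8 * z^3 * x^3 - 15 * z^3 * x^2 * t2 + 6 * z^3 * x * t2^2 + z^3 * t2^3 - 15 * z^2 * x^3 * t1 + 18 * z^2 * x^2 * t1 * t2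
         - 3 * z^2 * x * t1 * t2^2 + 6 * z^2 * t2 + 6 * z * x^3 * t1^2 - 3 * z * x^2 * t1^2 * t2 - 3 * z * t1 * t2 + x^3 * t1^3
         + 6 * x^2 * t1 - 3 * x * t1 * t2 - 5 * t1^3 + 8 * t1^2 * t2 - 7 * t1 * t2^2 - 24) * airy_deriv 1 (x + z)"
proof -
  let ?L = "(\<lambda>k. pair_deriv_iter k x (- 1 - 1 - real k) (pair_mult (coeffs_S1_tilde t1 t2 ! k) (pair_deriv_iter k x (- 1 - 1) ([0,
      x], [- 1]))))"
  \<comment> \<open>Now the first exponent is \<open>-9\<close>, and the powers \<open>-9\<close> to
    \<open>-2\<close> as well as the three highest ones cancel.\<close>
  let ?c = "([0, 0, 0, 0, 0, 0, 0, 0, - 6 * x^3 * t1^2 + 3 * x^2 * t1^2 * t2 + 3 * t1 * t2, - (x^4 * t1^3) - 6 * x^3 * t1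
      + 3 * x^2 * t1 * t2 + 5 * x * t1^3 - 8 * x * t1^2 * t2 + 7 * x * t1 * t2^2 + 24 * x, 3 * x^4 * t1^2 - 3 * x^3 * t1^2 * t2 + 12 * x^3
      - 12 * x^2 * t1 - 12 * x^2 * t2 + 3 * x * t1 * t2 + 3 * t1 * t2^2, - 3 * x^4 * t1 + 6 * x^3 * t1 * t2 - 3 * x^2 * t1 * t2^2
      + 12 * x^2 - 6 * x * t2 - 6 * t2^2, x^4 - 3 * x^3 * t2 + 3 * x^2 * t2^2 - x * t2^3, 0, 0, 0],
      [0, 0, 0, 0, 0, 0, 0, 0, x^3 * t1^3 + 6 * x^2 * t1 - 3 * x * t1 * t2 - 5 * t1^3 + 8 * t1^2 * t2 - 7 * t1 * t2^2 - 24, 6 * x^3 * t1^2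
          - 3 * x^2 * t1^2 * t2 - 3 * t1 * t2, - 15 * x^3 * t1 + 18 * x^2 * t1 * t2 - 3 * x * t1 * t2^2 + 6 * t2, 8 * x^3 - 15 * x^2 * t2
          + 6 * x * t2^2 + t2^3, 0, 0, 0])"
  have *: "pair_add (pair_add (pair_add (pair_pad [0, 0, 0, 0, 0, 0] (?L 0)) (pair_pad [0, 0, 0, 0] (?L (Suc 0)))) (pair_pad [0,
      0] (?L (Suc (Suc 0))))) (?L (Suc (Suc (Suc 0)))) = ?c"
    unfolding coeffs_S1_tilde_def
    by (simp only: list_eval pair_deriv_iter.simps pair_deriv.simps pair_mult.simps pair_add.simps pair_pad.simps nth_Cons_0 nth_Cons_Suc
        of_nat_Suc of_nat_0 list.inject prod.inject, (intro conjI refl; algebra))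
  have "x * S1_tilde t1 t2 (Psi1 x) z = S1_tilde t1 t2 (\<lambda>z. x * Psi1 x z) z"
    by (rule diff_op_cmult[OF assms(1) diff_op_S1_tilde _ assms(2), symmetric]) (rule smooth_from_Psi1[OF assms(3,1)])
  also have "\<dots> = S1_tilde t1 t2 (airy_pair x (- 1) ([0, x], [- 1])) z"
    by (rule diff_op_cong[OF assms(1) diff_op_S1_tilde _ assms(2)]) (use assms in \<open>auto intro: Psi1_eq_airy_pair\<close>)
  also have "\<dots> = (\<Sum>k<4. airy_pair x (- 1 - 2 - 2 * real k) (?L k) z)"
    unfolding S1_tilde_def
    by (subst sandwich_op_airy_pair[OF assms(1,2), where Cs = "coeffs_S1_tilde t1 t2"])
     (simp add: coeffs_S1_tilde_def, auto simp: coeffs_S1_tilde_def less_Suc_eq numeral_eq_Suc field_simps)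
  also have "\<dots> = airy_pair x (-9) (pair_add (pair_add (pair_add (pair_pad [0, 0, 0, 0, 0, 0] (?L 0)) (pair_pad [0, 0, 0,
      0] (?L (Suc 0)))) (pair_pad [0, 0] (?L (Suc (Suc 0))))) (?L (Suc (Suc (Suc 0))))) z"
    unfolding airy_pair_add by (simp add: lessThan_Suc eval_nat_numeral airy_pair_pad del: pair_pad.simps pair_mult.simps pair_deriv_iter.simps)
  finally have "x * z * S1_tilde t1 t2 (Psi1 x) z = z * airy_pair x (-9) ?c z"
    unfolding * by simp
  also have "\<dots> = (z^4 * x^4 - 3 * z^4 * x^3 * t2 + 3 * z^4 * x^2 * t2^2 - z^4 * x * t2^3 - 3 * z^3 * x^4 * t1
      + 6 * z^3 * x^3 * t1 * t2 - 3 * z^3 * x^2 * t1 * t2^2 + 12 * z^3 * x^2 - 6 * z^3 * x * t2 - 6 * z^3 * t2^2 + 3 * z^2 * x^4 * t1^2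
      - 3 * z^2 * x^3 * t1^2 * t2 + 12 * z^2 * x^3 - 12 * z^2 * x^2 * t1 - 12 * z^2 * x^2 * t2 + 3 * z^2 * x * t1 * t2
      + 3 * z^2 * t1 * t2^2 - z * x^4 * t1^3 - 6 * z * x^3 * t1 + 3 * z * x^2 * t1 * t2 + 5 * z * x * t1^3 - 8 * z * x * t1^2 * t2
      + 7 * z * x * t1 * t2^2 + 24 * z * x - 6 * x^3 * t1^2 + 3 * x^2 * t1^2 * t2 + 3 * t1 * t2) * airy_deriv 0 (x + z) +
     (8 * z^3 * x^3 - 15 * z^3 * x^2 * t2 + 6 * z^3 * x * t2^2 + z^3 * t2^3 - 15 * z^2 * x^3 * t1 + 18 * z^2 * x^2 * t1 * t2
         - 3 * z^2 * x * t1 * t2^2 + 6 * z^2 * t2 + 6 * z * x^3 * t1^2 - 3 * z * x^2 * t1^2 * t2 - 3 * z * t1 * t2 + x^3 * t1^3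
         + 6 * x^2 * t1 - 3 * x * t1 * t2 - 5 * t1^3 + 8 * t1^2 * t2 - 7 * t1 * t2^2 - 24) * airy_deriv 1 (x + z)"
    using assms(1,2) by (simp add: airy_pair_def powr_minus_divide powr_numeral)
        (simp add: field_simps power2_eq_square power3_eq_cube eval_nat_numeral)
  finally show ?thesis .
qed

text \<open>The scalar is the difference of the shifts in the curve relation:
  \<open>10 * (t2 - t1) = (6 * t2 - 4 * t1) - (6 * t1 - 4 * t2)\<close>.\<close>

lemma S1_bispectral:
  assumes "t1 > 0" "t2 > 0" "z \<ge> t1" "x \<ge> t2"
  shows "S1 t1 t2 (Psi1 x) z = S1 t2 t1 (\<lambda>x. Psi1 x z) x + 10 * (t2 - t1) * Psi1 x z"
proof -
  have sym: "(\<lambda>x. Psi1 x z) = Psi1 z" by (rule ext) (rule Psi1_commute)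
  have xz: "x > 0" "z > 0" using assms by auto
  \<comment> \<open>With denominators cleared, the goal is a polynomial identity in which
    \<open>airy_deriv 0 (x + z)\<close> and \<open>airy_deriv 1 (x + z)\<close> are independent
    unknowns.\<close>
  have "x * z * Psi1 x z = x * z * airy_deriv 0 (x + z) - airy_deriv 1 (x + z)"
    using xz by (simp add: Psi1_eq field_simps)
  then have "x * z * (S1 t1 t2 (Psi1 x) z) = x * z * (S1 t2 t1 (Psi1 z) x + 10 * (t2 - t1) * Psi1 x z)"
    using S1_Psi1[OF assms(1,3) xz(1), of t2] S1_Psi1[OF assms(2,4) xz(2), of t1]
    unfolding add.commute[of z x] by algebra
  with xz show ?thesis unfolding sym by simp
qed

text \<open>Again a difference of shifts: if \<open>c t1 t2\<close> is the scalar added to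
  \<open>S1_tilde\<close> in the curve relation, then
  \<open>- 5 * (t2 - t1) ^ 3 = c t2 t1 - c t1 t2\<close>.\<close>

lemma S1_tilde_bispectral:
  assumes "t1 > 0" "t2 > 0" "z \<ge> t1" "x \<ge> t2"
  shows "S1_tilde t1 t2 (Psi1 x) z = S1_tilde t2 t1 (\<lambda>x. Psi1 x z) x + (- 5 * (t2 - t1) ^ 3) * Psi1 x z"
proof -
  have sym: "(\<lambda>x. Psi1 x z) = Psi1 z" by (rule ext) (rule Psi1_commute)
  have xz: "x > 0" "z > 0" using assms by auto
  have "x * z * Psi1 x z = x * z * airy_deriv 0 (x + z) - airy_deriv 1 (x + z)"
    using xz by (simp add: Psi1_eq field_simps)
  then have "x * z * (S1_tilde t1 t2 (Psi1 x) z) = x * z * (S1_tilde t2 t1 (Psi1 z) x + (- 5 * (t2 - t1) ^ 3) * Psi1 x z)"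
    using S1_tilde_Psi1[OF assms(1,3) xz(1), of t2] S1_tilde_Psi1[OF assms(2,4) xz(2), of t1]
    unfolding add.commute[of z x] by algebra
  with xz show ?thesis unfolding sym by simp
qed

section \<open>Commutation with the integral operator\<close>

lemma airy_deriv_measurable [measurable]: "airy_deriv k \<in> borel_measurable borel"
  using DERIV_isCont[OF airy_deriv_has_derivative]
  by (intro borel_measurable_continuous_onI continuous_at_imp_continuous_on) auto

lemma Psi1_bound:
  assumes "a > 0" "b > 0"
  shows "\<exists>K\<ge>0. \<forall>x\<ge>b. \<forall>w\<ge>a. \<bar>Psi1 x w\<bar> \<le> K * exp (- x) * exp (- w)"
proof -
  obtain C where C: "C \<ge> 0" "\<And>y. \<bar>airy_deriv 0 y\<bar> \<le> C * exp (- y)" using airy_deriv_bound by blast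
  obtain D where D: "D \<ge> 0" "\<And>y. \<bar>airy_deriv 1 y\<bar> \<le> D * exp (- y)" using airy_deriv_bound by blast
  show ?thesis
  proof (intro exI[of _ "C + 1 / (b * a) * D"] conjI allI impI)
    show "0 \<le> C + 1 / (b * a) * D" using assms C D by simp
    fix x w assume x: "x \<ge> b" and w: "w \<ge> a"
    have "\<bar>1 / (x * w)\<bar> \<le> 1 / (b * a)"
      using assms x w by (simp add: frac_le mult_mono)
    then have "\<bar>1 / (x * w) * airy_deriv 1 (x + w)\<bar> \<le> 1 / (b * a) * (D * exp (- (x + w)))"
      unfolding abs_mult using D(1) assms by (intro mult_mono D(2)) auto
    then have "\<bar>Psi1 x w\<bar> \<le> C * exp (- (x + w)) + 1 / (b * a) * (D * exp (- (x + w)))"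
      unfolding Psi1_eq using C(2)[of "x + w"] by linarith
    then show "\<bar>Psi1 x w\<bar> \<le> (C + 1 / (b * a) * D) * exp (- x) * exp (- w)"
      by (simp add: exp_add exp_diff exp_minus field_simps)
  qed
qed

lemma T1_eq_kernel_transform:
  assumes t1: "t1 > 0" and t2: "t2 > 0" and f: "test_function t1 f" and z: "z \<ge> t1"
  shows "T1 t1 t2 f z = kernel_transform Psi1 t2 (kernel_transform Psi1 t1 f) z"
proof -
  \<comment> \<open>The indicators extend the integrand to the whole plane, so that Fubini applies
    to the product of two copies of \<open>lborel\<close>.\<close>
  define F where "F = (\<lambda>x w. indicator {t2..} x * Psi1 x z * (Psi1 x w * (indicator {t1..} w * f w)))"
  have [measurable]: "(\<lambda>w. indicator {t1..} w * f w) \<in> borel_measurable borel"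
    using borel_measurable_indicator_atLeast[OF test_function_continuous[OF f]] by simp
  have meas: "(\<lambda>p. F (fst p) (snd p)) \<in> borel_measurable (lborel \<Otimes>\<^sub>M lborel)"
    unfolding F_def Psi1_eq by measurable
  obtain K where K: "K \<ge> 0" "\<forall>x\<ge>t2. \<forall>w\<ge>t1. \<bar>Psi1 x w\<bar> \<le> K * exp (- x) * exp (- w)"
    using Psi1_bound[OF t1 t2] by blast
  obtain B where B: "\<forall>w\<ge>t1. \<bar>w ^ 0 * f w\<bar> \<le> B" using test_function_bounded[OF f] by blast
  have B0: "B \<ge> 0" using B[rule_format, of t1] by simp
  define e where "e = (\<lambda>a x :: real. indicator {a..} x * exp (- x))"
  have e: "integrable lborel (e a)" for a
    using set_integrable_exp_minus[of a] by (simp add: set_integrable_def e_def)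
  have [measurable]: "e a \<in> borel_measurable borel" for a using e[of a] by simp
  have int: "integrable (lborel \<Otimes>\<^sub>M lborel) (\<lambda>p. K * K * B * (e t2 (fst p) * e t1 (snd p)))"
  proof (intro integrable_mult_right lborel_pair.Fubini_integrable)
    have "(\<lambda>x. LBINT y. norm (e t2 (fst (x, y)) * e t1 (snd (x, y)))) = (\<lambda>x. e t2 x * (LBINT y. e t1 y))"
      by (simp add: e_def abs_mult)
    then show "integrable lborel (\<lambda>x. LBINT y. norm (e t2 (fst (x, y)) * e t1 (snd (x, y))))"
      using e by simp
  qed (use e in auto)
  have bound: "\<bar>F x w\<bar> \<le> K * K * B * (e t2 x * e t1 w)" for x w
  proof (cases "x \<ge> t2 \<and> w \<ge> t1")
    case True
    \<comment> \<open>The decay of the factor \<open>Psi1 x z\<close> is given away;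
      \<open>Psi1 x w\<close> alone supplies the product majorant in \<open>x\<close> and
      \<open>w\<close>.\<close>
    have "exp (- x) * exp (- z) \<le> 1"
      using True t1 t2 z by (simp flip: exp_add)
    then have "\<bar>Psi1 x z\<bar> \<le> K * 1"
      using K(2)[rule_format, of x z] True z K(1) mult_left_mono[of "exp (- x) * exp (- z)" 1 K] by (simp add: mult.assoc)
    then have "\<bar>Psi1 x z * (Psi1 x w * f w)\<bar> \<le> K * ((K * exp (- x) * exp (- w)) * B)"
      unfolding abs_mult using K B True B0 by (intro mult_mono) auto
    then show ?thesis using True by (simp add: F_def e_def mult_ac)
  qed (auto simp: F_def e_def)
  have "integrable (lborel \<Otimes>\<^sub>M lborel) (\<lambda>p. F (fst p) (snd p))"
    by (rule Bochner_Integration.integrable_bound[OF int meas], rule AE_I2)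
      (unfold real_norm_def, rule order.trans[OF bound abs_ge_self])
  then have "(LBINT w. LBINT x. F x w) = (LBINT x. LBINT w. F x w)"
    by (rule lborel_pair.Fubini_integral[of F, unfolded case_prod_beta'])
  moreover have "(LBINT x. F x w) = indicator {t1..} w * (K1 t2 z w * f w)" for w
  proof -
    have "(LBINT x. F x w) = (LBINT x. (indicator {t2..} x *\<^sub>R (Psi1 x z * Psi1 x w)) * (indicator {t1..} w * f w))"
      by (simp add: F_def mult_ac)
    also have "\<dots> = K1 t2 z w * (indicator {t1..} w * f w)"
      unfolding K1_def set_lebesgue_integral_def by (rule integral_mult_left_zero)
    finally show ?thesis by (simp add: mult_ac)
  qed
  moreover have "(LBINT w. F x w) = indicator {t2..} x * (Psi1 z x * kernel_transform Psi1 t1 f x)" for x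
  proof -
    have "(LBINT w. F x w) = (LBINT w. (indicator {t2..} x * Psi1 z x) * (indicator {t1..} w *\<^sub>R (Psi1 x w * f w)))"
      by (simp add: F_def Psi1_commute[of x z] mult_ac)
    also have "\<dots> = (indicator {t2..} x * Psi1 z x) * kernel_transform Psi1 t1 f x"
      unfolding kernel_transform_def set_lebesgue_integral_def by (rule integral_mult_right_zero)
    finally show ?thesis by (simp add: mult_ac)
  qed
  ultimately show ?thesis
    by (simp add: T1_def kernel_transform_def set_lebesgue_integral_def)
qed

text \<open>The operator passes from \<open>f\<close> to the kernel by symmetry, becomes
  \<open>Q\<close> in the variable \<open>x\<close> by bispectrality, and then leaves the integral.
  The lemma serves both half-lines, with opposite signs of \<open>c\<close>.\<close>

lemma Psi1_transform_intertwines: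
  assumes a: "a > 0" and b: "b > 0" and cs: "list_all laurent cs" and Q: "diff_op b Q"
    and bispectral: "\<And>w. w \<ge> a \<Longrightarrow> sandwich_op a cs (Psi1 x) w = Q (\<lambda>x. Psi1 x w) x + c * Psi1 x w"
    and f: "test_function a f" and x: "x \<ge> b"
  shows "kernel_transform Psi1 a (sandwich_op a cs f) x =
    Q (kernel_transform Psi1 a f) x + c * kernel_transform Psi1 a f x"
proof -
  have \<Psi>: "test_function a (Psi1 x)" using x b a by (intro test_function_Psi1) auto
  note i = set_integrable_test_product[OF a diff_op_test_function[OF a diff_op_sandwich[OF cs] \<Psi>] f]
  note i' = set_integrable_mult_right[OF set_integrable_test_product[OF a \<Psi> f], of c]
  have "Q (kernel_transform Psi1 a f) x = (LBINT w:{a..}. Q (\<lambda>x. Psi1 x w) x * f w)"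
    by (rule diff_op_kernel_transform[OF a b f Q airy_kernel_Psi1 x])
  also have "\<dots> = (LBINT w:{a..}. sandwich_op a cs (Psi1 x) w * f w - c * (Psi1 x w * f w))"
    by (intro set_lebesgue_integral_cong) (auto simp: bispectral algebra_simps)
  also have "\<dots> = (LBINT w:{a..}. sandwich_op a cs (Psi1 x) w * f w) - (LBINT w:{a..}. c * (Psi1 x w * f w))"
    by (rule set_integral_diff(2), rule i, rule i')
  also have "(LBINT w:{a..}. sandwich_op a cs (Psi1 x) w * f w) = kernel_transform Psi1 a (sandwich_op a cs f) x"
    unfolding kernel_transform_def by (rule sandwich_op_symmetric[OF a cs \<Psi> f])
  also have "(LBINT w:{a..}. c * (Psi1 x w * f w)) = c * kernel_transform Psi1 a f x"
    by (simp add: kernel_transform_def)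
  finally show ?thesis by simp
qed

lemma sandwich_op_commutes_with_T1:
  assumes t1: "t1 > 0" and t2: "t2 > 0" and cs: "list_all laurent cs" and ds: "list_all laurent ds"
    and bispectral: "\<And>w x. w \<ge> t1 \<Longrightarrow> x \<ge> t2 \<Longrightarrow>
      sandwich_op t1 cs (Psi1 x) w = sandwich_op t2 ds (\<lambda>x. Psi1 x w) x + c * Psi1 x w"
  shows "commutes_with t1 (sandwich_op t1 cs) (T1 t1 t2)"
  unfolding commutes_with_def
proof (intro allI impI)
  fix f z assume f: "test_function t1 f" and z: "t1 \<le> z"
  define g where "g = kernel_transform Psi1 t1 f"
  note dcs = diff_op_sandwich[OF cs, of t1] and dds = diff_op_sandwich[OF ds, of t2]
  have g: "test_function t2 g"
    unfolding g_def by (rule kernel_transform_test_function[OF t1 t2 f airy_kernel_Psi1])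
  \<comment> \<open>The hypothesis read from right to left, which changes the sign of the
    scalar.\<close>
  have bispectral': "sandwich_op t2 ds (Psi1 z) x = sandwich_op t1 cs (\<lambda>z. Psi1 z x) z + (- c) * Psi1 z x" if "x \<ge> t2" for x
  proof -
    have "(\<lambda>x. Psi1 x z) = Psi1 z" "(\<lambda>z. Psi1 z x) = Psi1 x" "Psi1 x z = Psi1 z x"
      by (rule ext Psi1_commute)+
    with bispectral[OF z that] show ?thesis by simp
  qed
  note dg = diff_op_test_function[OF t2 dds g]
  have zint: "set_integrable lborel {t2..} (\<lambda>x. Psi1 z x * h x)" if "test_function t2 h" for h
    using z t1 t2 that by (intro set_integrable_test_product test_function_Psi1) auto
  have "T1 t1 t2 (sandwich_op t1 cs f) z = (LBINT x:{t2..}. Psi1 z x * kernel_transform Psi1 t1 (sandwich_op t1 cs f) x)"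
    using T1_eq_kernel_transform[OF t1 t2 diff_op_test_function[OF t1 dcs f] z] by (simp add: kernel_transform_def)
  also have "\<dots> = (LBINT x:{t2..}. Psi1 z x * sandwich_op t2 ds g x + c * (Psi1 z x * g x))"
    unfolding g_def
    by (intro set_lebesgue_integral_cong)
      (auto simp: Psi1_transform_intertwines[OF t1 t2 cs dds bispectral f] algebra_simps)
  also have "\<dots> = (LBINT x:{t2..}. Psi1 z x * sandwich_op t2 ds g x) + (LBINT x:{t2..}. c * (Psi1 z x * g x))"
    by (rule set_integral_add(2), rule zint[OF dg], rule set_integrable_mult_right, rule zint[OF g])
  also have "\<dots> = kernel_transform Psi1 t2 (sandwich_op t2 ds g) z + c * kernel_transform Psi1 t2 g z"
    by (simp add: kernel_transform_def)
  also have "\<dots> = sandwich_op t1 cs (kernel_transform Psi1 t2 g) z"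
    using Psi1_transform_intertwines[OF t2 t1 ds dcs bispectral' g z] by simp
  also have "\<dots> = sandwich_op t1 cs (T1 t1 t2 f) z"
    by (rule diff_op_cong[OF t1 dcs _ z]) (simp add: T1_eq_kernel_transform[OF t1 t2 f] g_def)
  finally show "sandwich_op t1 cs (T1 t1 t2 f) z = T1 t1 t2 (sandwich_op t1 cs f) z" by simp
qed

lemma S1_commutes_with_T1:
  assumes "t1 > 0" "t2 > 0"
  shows "commutes_with t1 (S1 t1 t2) (T1 t1 t2)"
proof -
  \<comment> \<open>Quantifying over both parameters makes one family of coefficient lists available
    for \<open>(t1, t2)\<close> and for the exchanged pair without writing it out.\<close>
  have "\<exists>cs. \<forall>t1 t2. S1 t1 t2 = sandwich_op t1 (cs t1 t2) \<and> list_all laurent (cs t1 t2)"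
    by (intro exI allI conjI, rule S1_def, unfold list.pred_inject(2)) (intro conjI list.pred_inject(1) laurent_intros)
  then obtain cs where cs: "\<forall>t1 t2. S1 t1 t2 = sandwich_op t1 (cs t1 t2) \<and> list_all laurent (cs t1 t2)"
    by (rule exE)
  show ?thesis
    using sandwich_op_commutes_with_T1[OF assms, of "cs t1 t2" "cs t2 t1"] S1_bispectral[OF assms] cs by metis
qed

lemma S1_tilde_commutes_with_T1:
  assumes "t1 > 0" "t2 > 0"
  shows "commutes_with t1 (S1_tilde t1 t2) (T1 t1 t2)"
proof -
  have "\<exists>cs. \<forall>t1 t2. S1_tilde t1 t2 = sandwich_op t1 (cs t1 t2) \<and> list_all laurent (cs t1 t2)"
    by (intro exI allI conjI, rule S1_tilde_def, unfold list.pred_inject(2)) (intro conjI list.pred_inject(1) laurent_intros)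
  then obtain cs where cs: "\<forall>t1 t2. S1_tilde t1 t2 = sandwich_op t1 (cs t1 t2) \<and> list_all laurent (cs t1 t2)"
    by (rule exE)
  show ?thesis
    using sandwich_op_commutes_with_T1[OF assms, of "cs t1 t2" "cs t2 t1"] S1_tilde_bispectral[OF assms] cs by metis
qed

section \<open>The curve\<close>

text \<open>The cubic has the roots \<open>(t1 + t2) / 3\<close>, \<open>(t1 - 2 * t2) / 3\<close>
  and \<open>(t2 - 2 * t1) / 3\<close>. Up to sign they differ by \<open>t2\<close>,
  \<open>t1\<close> and \<open>t1 - t2\<close>, so under the hypotheses they are distinct.\<close>

lemma nonsingular_curve_distinct:
  assumes "t1 \<noteq> 0" "t2 \<noteq> 0" "t1 \<noteq> t2"
  shows "nonsingular_curve (\<lambda>X Y. Y^2 - (X^3 - of_real (curve_g t1 t2) * X + of_real (curve_h t1 t2)))"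
  unfolding nonsingular_curve_def
proof (intro allI impI)
  fix X Y :: complex
  define g h where "g = complex_of_real (curve_g t1 t2)" and "h = complex_of_real (curve_h t1 t2)"
  define p q where "p = complex_of_real t1" and "q = complex_of_real t2"
  have pq: "p \<noteq> 0" "q \<noteq> 0" "p \<noteq> q" using assms by (auto simp: p_def q_def)
  have g: "3 * g = p^2 - p * q + q^2" by (simp add: g_def curve_g_def p_def q_def)
  have h: "27 * h = (p - 2 * q) * (2 * p - q) * (p + q)" by (simp add: h_def curve_h_def p_def q_def)
  assume "Y^2 - (X^3 - of_real (curve_g t1 t2) * X + of_real (curve_h t1 t2)) = 0"
  then have curve: "Y^2 - (X^3 - g * X + h) = 0" by (simp add: g_def h_def)
  have dX: "deriv (\<lambda>x. Y^2 - (x^3 - g * x + h)) X = g - 3 * X^2"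
    by (rule DERIV_imp_deriv) (auto intro!: derivative_eq_intros)
  have dY: "deriv (\<lambda>y. y^2 - (X^3 - g * X + h)) Y = 2 * Y"
    by (rule DERIV_imp_deriv) (auto intro!: derivative_eq_intros)
  have False if "g - 3 * X^2 = 0" "2 * Y = 0"
  proof -
    have sq: "(3 * X)^2 = p^2 - p * q + q^2" using that g by algebra
    have "(3 * X - (p + q)) * (3 * X - (p - 2 * q)) * (3 * X - (q - 2 * p)) = 0"
      using that curve g h by algebra
    then consider "3 * X = p + q" | "3 * X = p - 2 * q" | "3 * X = q - 2 * p" by auto
    \<comment> \<open>The derivative of the cubic at a root is the product of the differences to the
      other two: \<open>p * q\<close>, \<open>q * (q - p)\<close> and \<open>p * (p - q)\<close> in
      the three cases.\<close>
    then show False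
    proof cases
      case 1
      then have "3 * (p * q) = 0" using sq by algebra
      with pq show False by simp
    next
      case 2
      then have "3 * (q * (q - p)) = 0" using sq by algebra
      with pq show False by simp
    next
      case 3
      then have "3 * (p * (p - q)) = 0" using sq by algebra
      with pq show False by simp
    qed
  qed
  then show "deriv (\<lambda>x. Y^2 - (x^3 - of_real (curve_g t1 t2) * x + of_real (curve_h t1 t2))) X \<noteq> 0 \<or>
      deriv (\<lambda>y. y^2 - (X^3 - of_real (curve_g t1 t2) * X + of_real (curve_h t1 t2))) Y \<noteq> 0"
    unfolding g_def[symmetric] h_def[symmetric] dX dY by blast
qed

lemma nonsingular_curve_generic:
  "for_generic_positive (\<lambda>t1 t2. nonsingular_curve
     (\<lambda>X Y. Y^2 - (X^3 - of_real (curve_g t1 t2) * X + of_real (curve_h t1 t2))))"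
  unfolding for_generic_positive_def
\<comment> \<open>The witness is the polynomial \<open>t1 - t2\<close>, with \<open>t2\<close> as
  the outer and \<open>t1\<close> as the inner variable.\<close>
proof (intro exI[of _ "[:[:0, 1:], [:- 1:]:]"] conjI allI impI)
  fix t1 t2 :: real
  assume "t1 > 0" "t2 > 0" "poly (poly [:[:0, 1:], [:- 1:]:] [:t2:]) t1 \<noteq> 0"
  then show "nonsingular_curve (\<lambda>X Y. Y^2 - (X^3 - of_real (curve_g t1 t2) * X + of_real (curve_h t1 t2)))"
    by (intro nonsingular_curve_distinct) auto
qed simp

theorem mainTheorem2:
  shows "(\<forall>t1>0. \<forall>t2>0.
        commutes_with t1 (S1 t1 t2) (T1 t1 t2)
      \<and> commutes_with t1 (S1_tilde t1 t2) (T1 t1 t2)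
      \<and> diffop_eq t1 (S1 t1 t2 \<circ> S1_tilde t1 t2) (S1_tilde t1 t2 \<circ> S1 t1 t2)
      \<and> (let S = shift_op (S1 t1 t2) (6 * t1 - 4 * t2);
             S' = shift_op (S1_tilde t1 t2) 
                     (- (24 + 5 * t1^3 - 9 * t1^2 * t2 + 6 * t1 * t2^2))
         in diffop_eq t1 (S' ^^ 2)
              (\<lambda>f z. (S ^^ 3) f z - curve_g t1 t2 * S f z + curve_h t1 t2 * f z)))
    \<and> for_generic_positive (\<lambda>t1 t2. nonsingular_curve
        (\<lambda>X Y. Y^2 - (X^3 - of_real (curve_g t1 t2) * X + of_real (curve_h t1 t2))))"
  unfolding Let_def
  by (intro conjI allI impI S1_commutes_with_T1 S1_tilde_commutes_with_T1 S1_S1_tilde_commute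
      curve_relation nonsingular_curve_generic)

end
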